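(* Let $\beta\in\,]0,\pi[$ be determined by $\tan\frac\beta2=\frac12$. With the Hilbert space isomorphism $V:L^2(0,1)\to L^2(\mathbb{R}_+)$, its kernel $q_+$, the Laguerre functions $\operatorname{l}_n$ and the functions $h_n$ (for this $\beta$) defined in the context, one has $$V^{-1}\operatorname{l}_n=h_n\qquad\text{for all } n\in\mathbb{N}_0,$$ and, more precisely, $$\int_0^\infty q_+(s,x)\operatorname{l}_n(x)\,dx=h_n(s)\qquad\text{for all } s\in\,]0,1[,\ n\in\mathbb{N}_0 .$$
   Context: $\mathbb{R}_+=\{x>0\}$. For $s\in\,]0,1[$, $x>0$, $$q_+(s,x)=\tfrac12\pi^{-3/2}s^{-1}(1-s)^{-1/2}\int_{-1}^1e^{-ixu}(1-u^2)^{-1/2}\exp\Big(\tfrac{i}{2\pi}\ln\big(\tfrac1s-1\big)\ln\big(\tfrac{1-u}{1+u}\big)\Big)du ,$$ and $V:L^2(0,1)\to L^2(\mathbb{R}_+)$ is the Hilbert space isomorphism $Vh=\operatorname{l.i.m.}_{0<a,a'\to0}\int_a^{1-a'}q_+(s,\cdot)h(s)\,ds$ (limit in $L^2$). The Laguerre functions $\operatorname{l}_n$ on $\mathbb{R}_+$, an orthonormal basis of $L^2(\mathbb{R}_+)$, are given by the generating function $\sum_{n\ge0}\operatorname{l}_n(x)q^n=(1-q)^{-1}\exp\big(-\tfrac12\tfrac{1+q}{1-q}x\big)$, $|q|<1$. For $n\in\mathbb{N}_0$ and $s\in\,]0,1[$, $$h_n(s)=\Big(\tfrac{\sin\beta}{\pi}\Big)^{1/2}\big(\tfrac1s-1\big)^{\beta/(2\pi)}(1-s)^{-1/2}\,\mathrm{P}_n^{(1/2)}\Big(\tfrac1{2\pi}\ln\big(\tfrac1s-1\big);\beta\Big),$$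 where $\mathrm{P}_n^{(1/2)}(x;\beta)$ is the $n$th Meixner-Pollaczek polynomial of order $1/2$, given by $\sum_{n\ge0}\mathrm{P}_n^{(1/2)}(x;\beta)q^n=(1-qe^{i\beta})^{-1/2+ix}(1-qe^{-i\beta})^{-1/2-ix}$, $|q|<1$ (principal branches). *)

theory Defs
  imports "HOL-Complex_Analysis.Complex_Analysis"
begin

section \<open>Complex \<open>L\<^sup>2\<close> spaces as sets of classes modulo a.e. equality\<close>

definition square_integrable :: "'a measure \<Rightarrow> ('a \<Rightarrow> complex) set" where
  "square_integrable M =
     {f \<in> borel_measurable M. integrable M (\<lambda>x. (cmod (f x))\<^sup>2)}"

definition L2_class :: "'a measure \<Rightarrow> ('a \<Rightarrow> complex) \<Rightarrow> ('a \<Rightarrow> complex) set" where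
  "L2_class M f = {g \<in> square_integrable M. AE x in M. g x = f x}"

definition L2 :: "'a measure \<Rightarrow> ('a \<Rightarrow> complex) set set" where
  "L2 M = L2_class M ` square_integrable M"

text \<open>The limit in \<open>L\<^sup>2\<close> of measurable functions \<open>G i\<close> along the filter \<open>F\<close>, as a class: either
  the limit does not exist and the set is empty, or it is exactly one element of \<open>L2 M\<close>.
  A difference that is not square integrable counts as infinitely far away.\<close>

definition L2_lim :: "'a measure \<Rightarrow> 'i filter \<Rightarrow> ('i \<Rightarrow> 'a \<Rightarrow> complex) \<Rightarrow> ('a \<Rightarrow> complex) set" where
  "L2_lim M F G =
     {f \<in> square_integrable M.
        ((\<lambda>i. \<integral>\<^sup>+x. ennreal ((cmod (G i x - f x))\<^sup>2) \<partial>M) \<longlongrightarrow> 0) F}"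

abbreviation unit_interval :: "real measure" where
  "unit_interval \<equiv> restrict_space lborel {0<..<1}"

abbreviation half_line :: "real measure" where
  "half_line \<equiv> restrict_space lborel {0<..}"


section \<open>The kernel and the operator\<close>

definition q_plus :: "real \<Rightarrow> real \<Rightarrow> complex" where
  "q_plus s x =
     of_real (1/2 * pi powr (-3/2) * s powr (-1) * (1 - s) powr (-1/2)) *
     (LINT u:{-1<..<1}|lborel.
        exp (- \<i> * of_real (x * u)) * of_real ((1 - u\<^sup>2) powr (-1/2)) *
        exp (\<i> / of_real (2 * pi) * of_real (ln (1/s - 1) * ln ((1 - u) / (1 + u)))))"

text \<open>The two cut-off parameters tend to \<open>0\<close> independently, hence the product filter.
  The value does not depend on the representative \<open>h\<close> of the class \<open>H\<close>.\<close>

definition V_op :: "(real \<Rightarrow> complex) set \<Rightarrow> (real \<Rightarrow> complex) set" where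
  "V_op H = (\<Union>h\<in>H. L2_lim half_line (at_right 0 \<times>\<^sub>F at_right 0)
            (\<lambda>(a, a') x. LINT s:{a..1 - a'}|lborel. q_plus s x * h s))"


section \<open>Functions given by generating functions\<close>

definition gf_coeff :: "(complex \<Rightarrow> complex) \<Rightarrow> nat \<Rightarrow> complex" where
  "gf_coeff G = (THE c. \<forall>q. cmod q < 1 \<longrightarrow> (\<lambda>n. c n * q ^ n) sums G q)"

lemma gf_coeff_sums:
  assumes "G holomorphic_on ball 0 1" "cmod q < 1"
  shows "(\<lambda>n. gf_coeff G n * q ^ n) sums G q"
proof -
  let ?P = "\<lambda>c. \<forall>q. cmod q < 1 \<longrightarrow> (\<lambda>n. c n * q ^ n) sums G q"
  define c where "c = (\<lambda>n. (deriv ^^ n) G 0 / fact n)"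
  have c: "?P c"
    using holomorphic_power_series[OF assms(1)] by (auto simp: c_def)
  have "d = c" if d: "?P d" for d
  proof
    have conv: "fps_conv_radius (Abs_fps d) \<ge> 1"
      unfolding fps_conv_radius_def
    proof (rule conv_radius_geI_ex)
      fix r :: real
      assume r: "0 < r" "ereal r < 1"
      then have "cmod (of_real r) < 1" by simp
      then have "summable (\<lambda>n. d n * of_real r ^ n)"
        using d by (blast intro: sums_summable)
      then show "\<exists>z. cmod z = r \<and> summable (\<lambda>n. fps_nth (Abs_fps d) n * z ^ n)"
        using r by (intro exI[of _ "of_real r"]) auto
    qed
    have "G has_fps_expansion Abs_fps d"
      unfolding has_fps_expansion_def
    proof
      show "fps_conv_radius (Abs_fps d) > 0"
        using conv by (auto intro: less_le_trans[of _ 1])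
      have "eventually (\<lambda>z. z \<in> ball (0::complex) 1) (nhds 0)"
        by (intro eventually_nhds_in_open) auto
      then show "eventually (\<lambda>z. eval_fps (Abs_fps d) z = G z) (nhds 0)"
        by eventually_elim (use d in \<open>auto simp: eval_fps_def sums_iff\<close>)
    qed
    then have "fps_expansion G 0 = Abs_fps d"
      by (rule fps_expansion_eqI)
    then show "d n = c n" for n
      by (simp add: fps_eq_iff fps_expansion_def c_def)
  qed
  then have "?P (gf_coeff G)"
    unfolding gf_coeff_def by (rule theI[where P = ?P, OF c])
  then show ?thesis using assms(2) by blast
qed

definition laguerre_fun :: "nat \<Rightarrow> real \<Rightarrow> complex" where
  "laguerre_fun n x =
     gf_coeff (\<lambda>q. exp (- (1/2) * ((1 + q) / (1 - q)) * of_real x) / (1 - q)) n"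

lemma laguerre_fun_sums:
  assumes "cmod q < 1"
  shows "(\<lambda>n. laguerre_fun n x * q ^ n) sums
           (exp (- (1/2) * ((1 + q) / (1 - q)) * of_real x) / (1 - q))"
  unfolding laguerre_fun_def
  by (rule gf_coeff_sums) (use assms in \<open>auto intro!: holomorphic_intros\<close>)

text \<open>The Meixner-Pollaczek polynomials of order \<open>1/2\<close>; complex \<open>powr\<close> is the principal branch.\<close>

definition meixner_pollaczek :: "nat \<Rightarrow> real \<Rightarrow> real \<Rightarrow> complex" where
  "meixner_pollaczek n x \<beta> =
     gf_coeff (\<lambda>q. (1 - q * exp (\<i> * of_real \<beta>)) powr (-1/2 + \<i> * of_real x) *
                   (1 - q * exp (- \<i> * of_real \<beta>)) powr (-1/2 - \<i> * of_real x)) n"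

lemma meixner_pollaczek_sums:
  assumes "cmod q < 1"
  shows "(\<lambda>n. meixner_pollaczek n x \<beta> * q ^ n) sums
           ((1 - q * exp (\<i> * of_real \<beta>)) powr (-1/2 + \<i> * of_real x) *
            (1 - q * exp (- \<i> * of_real \<beta>)) powr (-1/2 - \<i> * of_real x))"
proof -
  have pos: "1 - z * w \<notin> \<real>\<^sub>\<le>\<^sub>0" if "cmod z < 1" "cmod w = 1" for z w :: complex
  proof -
    have "Re (z * w) < 1"
      using complex_Re_le_cmod[of "z * w"] that by (simp add: norm_mult)
    then show ?thesis by (auto simp: complex_nonpos_Reals_iff)
  qed
  have unit: "cmod (exp (\<i> * of_real \<beta>)) = 1" "cmod (exp (- \<i> * of_real \<beta>)) = 1"
    by (simp_all add: norm_exp_eq_Re)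
  show ?thesis
    unfolding meixner_pollaczek_def
    by (rule gf_coeff_sums)
       (use assms pos unit in \<open>auto intro!: holomorphic_intros\<close>)
qed

definition h_fun :: "real \<Rightarrow> nat \<Rightarrow> real \<Rightarrow> complex" where
  "h_fun \<beta> n s =
     of_real ((sin \<beta> / pi) powr (1/2) * (1/s - 1) powr (\<beta> / (2 * pi)) * (1 - s) powr (-1/2)) *
     meixner_pollaczek n (1 / (2 * pi) * ln (1/s - 1)) \<beta>"

end

theory Submission
  imports Defs "HOL-Probability.Probability" "HOL-Real_Asymp.Real_Asymp"
begin

text \<open>For \<open>z = cot \<alpha>\<close> the Laplace transform \<open>\<integral> q\<^sub>+(s,x) exp (- z x) dx\<close> has the closed form
  \<open>\<Phi>\<^sub>\<alpha>(s) = sin \<alpha> / sqrt (\<pi> s) * exp (- \<alpha> ln (1/s - 1) / \<pi>)\<close>: by Fubini and \<open>u = - tanh t\<close> it reduces to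
  \<open>\<integral> exp (\<i> \<omega> t) / cosh (t - \<i> \<alpha>) dt\<close>, whose dependence on \<open>\<alpha>\<close> is a shift of contour and whose value at
  \<open>\<alpha> = 0\<close> follows by letting \<open>\<alpha>\<close> and \<open>- \<alpha>\<close> tend to \<open>\<plusminus>\<pi>/2\<close>. The generating functions of the Laguerre functions
  and of the \<open>h\<^sub>n\<close> are \<open>exp (- z x) / (1 - q)\<close> and \<open>\<Phi>\<^sub>\<alpha> / (1 - q)\<close> for one and the same
  \<open>z = (1 + q) / (2 (1 - q))\<close>, so comparing coefficients in \<open>q\<close> gives the pointwise identity.

  For \<open>V\<close> itself, the Beta integral shows that \<open>exp (- z x) \<mapsto> \<Phi>\<^sub>\<alpha>\<close> preserves inner products for \<open>z > 0\<close>.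
  Testing against the dense span of \<open>exp (- x), exp (- 2 x), \<dots>\<close> then bounds the \<open>L\<^sup>2\<close> distance of \<open>l\<^sub>n\<close> to
  the truncated integral by that of \<open>h\<^sub>n\<close> to its truncation. Injectivity holds because a function orthogonal to
  all \<open>\<Phi>\<^sub>\<alpha>\<close> with \<open>Re \<alpha> = \<pi>/4\<close> has vanishing Fourier transform in the variable \<open>ln (1/s - 1)\<close>.\<close>


section \<open>The tilted integral\<close>

text \<open>That \<open>V\<close> is an isomorphism is nowhere assumed: the existence of the limit
  for \<open>h_fun \<beta> n\<close> and the uniqueness of the preimage are both proved. The
  obstacle is that a truncated integral is at first only a bounded measurable function of x, so the
  square integrability of its distance to the Laguerre function must come out of the estimate
  itself. Hence the norm is recovered by duality, from pairings with exponentials, which make sense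
  for bounded functions; these pairings are computable because truncation bounds the kernel and so
  allows Fubini.

  The value of \<beta> is forced at q = 0: there the Laguerre exponent is 1/2 and the angle is
  \<pi>/2 - \<beta>/2, whose cotangent is tan (\<beta>/2). For q > 0 the argument of 1 - q e^(i
  \<beta>) moves the angle so that its cotangent is multiplied by exactly (1 + q) / (1 - q).

  Real angles suffice for the generating functions and for the inner products. Complex angles enter
  only for injectivity, where the imaginary part supplies the frequency of the Fourier
  transform.\<close>

lemma Fubini_dominated:
  fixes f :: "'a \<Rightarrow> 'b \<Rightarrow> complex"
  assumes "sigma_finite_measure M" "sigma_finite_measure N"
    and f [measurable]: "case_prod f \<in> borel_measurable (M \<Otimes>\<^sub>M N)"
    and a: "integrable M a" and b: "integrable N b"
    and le: "\<And>x y. x \<in> space M \<Longrightarrow> y \<in> space N \<Longrightarrow> cmod (f x y) \<le> a x * b y"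
  shows "(\<integral>x. \<integral>y. f x y \<partial>N \<partial>M) = (\<integral>y. \<integral>x. f x y \<partial>M \<partial>N)"
proof -
  interpret pair_sigma_finite M N
    using assms(1,2) by (simp add: pair_sigma_finite_def)
  have [measurable]: "a \<in> borel_measurable M" "b \<in> borel_measurable N"
    using a b by auto
  have "integrable (M \<Otimes>\<^sub>M N) (\<lambda>(x, y). a x * b y)"
  proof (rule Fubini_integrable)
    show "integrable M (\<lambda>x. \<integral>y. norm (case (x, y) of (x, y) \<Rightarrow> a x * b y) \<partial>N)"
      using a by (simp add: abs_mult)
    show "AE x in M. integrable N (\<lambda>y. case (x, y) of (x, y) \<Rightarrow> a x * b y)"
      using b by simp
  qed simp
  then have "integrable (M \<Otimes>\<^sub>M N) (case_prod f)"
    by (rule Bochner_Integration.integrable_bound)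
       (auto simp: space_pair_measure intro!: AE_I2 order.trans[OF le])
  from Fubini_integral[OF this] show ?thesis ..
qed

lemma arcsine_integrable:
  "set_integrable lborel {-1<..<1} (\<lambda>u::real. (1 - u\<^sup>2) powr (-1/2))"
proof -
  have *: "{-1<..<1} = einterval (ereal (-1)) (ereal 1)" by (simp only: einterval_eq)
  have sq: "x\<^sup>2 < 1" if "-1 < x" "x < 1" for x :: real
    using that by (simp add: abs_square_less_1)
  show ?thesis unfolding *
  proof (rule interval_integral_FTC_nonneg)
    show "DERIV arcsin x :> (1 - x\<^sup>2) powr (-1/2)" if "ereal (-1) < ereal x" "ereal x < ereal 1" for x
    proof -
      have "(1 - x\<^sup>2) powr (-1/2) = inverse (sqrt (1 - x\<^sup>2))"
        using sq[of x] that by (simp add: powr_minus powr_half_sqrt)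
      then show ?thesis using DERIV_arcsin[of x] that by simp
    qed
    show "isCont (\<lambda>u. (1 - u\<^sup>2) powr (-1/2)) x" if "ereal (-1) < ereal x" "ereal x < ereal 1" for x
      using sq[of x] that by (intro continuous_intros) auto
    have "continuous_on {-1..1} arcsin" by (rule continuous_on_arcsin')
    then have "(arcsin \<longlongrightarrow> arcsin (-1)) (at_right (-1))" "(arcsin \<longlongrightarrow> arcsin 1) (at_left 1)"
      using continuous_on_Icc_at_rightD[of "-1" 1 arcsin] continuous_on_Icc_at_leftD[of "-1" 1 arcsin] by auto
    then show "((arcsin \<circ> real_of_ereal) \<longlongrightarrow> arcsin (-1)) (at_right (ereal (-1)))"
       "((arcsin \<circ> real_of_ereal) \<longlongrightarrow> arcsin 1) (at_left (ereal 1))"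
      unfolding ereal_tendsto_simps by auto
  qed auto
qed

text \<open>The \<open>u\<close>-integrand of \<^const>\<open>q_plus\<close> without the exponential factor, at \<open>\<mu> = ln (1/s - 1) / (2 \<pi>)\<close>.\<close>

definition eigen_weight :: "real \<Rightarrow> real \<Rightarrow> complex" where
  "eigen_weight \<mu> u = of_real ((1 - u\<^sup>2) powr (-1/2)) * cis (\<mu> * ln ((1 - u) / (1 + u)))"

lemma norm_eigen_weight: "cmod (eigen_weight \<mu> u) = (1 - u\<^sup>2) powr (-1/2)"
  by (simp add: eigen_weight_def norm_mult)

lemma eigen_weight_measurable [measurable]:
  "(\<lambda>(\<mu>, u). eigen_weight \<mu> u) \<in> borel_measurable (borel \<Otimes>\<^sub>M borel)"
  unfolding eigen_weight_def cis_conv_exp by measurable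

lemma eigen_weight_measurable' [measurable (raw)]:
  assumes "f \<in> borel_measurable M" "g \<in> borel_measurable M"
  shows "(\<lambda>x. eigen_weight (f x) (g x)) \<in> borel_measurable M"
  using measurable_compose[OF measurable_Pair[OF assms] eigen_weight_measurable] by simp

text \<open>For u = - tanh t this is cosh (t - i \<alpha>) / cosh t. Divided by sin \<alpha> it is
  cot \<alpha> + i u, the denominator that appears when exp (- i x u) exp (- x cot \<alpha>) is
  integrated over x.\<close>

definition tilt :: "complex \<Rightarrow> real \<Rightarrow> complex" where
  "tilt \<alpha> u = cos \<alpha> + \<i> * of_real u * sin \<alpha>"

definition tilt_bound :: "complex \<Rightarrow> real" where
  "tilt_bound \<alpha> = cos (Re \<alpha>) * exp (- \<bar>Im \<alpha>\<bar>)"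

lemma tilt_measurable [measurable (raw)]:
  assumes [measurable]: "f \<in> borel_measurable M" "g \<in> borel_measurable M"
  shows "(\<lambda>x. tilt (f x) (g x)) \<in> borel_measurable M"
proof -
  have [measurable]: "(cos :: complex \<Rightarrow> complex) \<in> borel_measurable borel"
      "(sin :: complex \<Rightarrow> complex) \<in> borel_measurable borel"
    by (auto intro!: borel_measurable_continuous_onI continuous_on_cos continuous_on_sin)
  show ?thesis unfolding tilt_def by measurable
qed

lemma tilt_bound_pos: "\<bar>Re \<alpha>\<bar> < pi/2 \<Longrightarrow> tilt_bound \<alpha> > 0"
  unfolding tilt_bound_def by (intro mult_pos_pos cos_gt_zero_pi) auto

text \<open>The real part is cos (Re \<alpha>) times a convex combination of exp (Im \<alpha>) and
  exp (- Im \<alpha>) with weights (1 - u)/2 and (1 + u)/2, so it stays away from 0 uniformly in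
  u.\<close>

lemma norm_tilt_ge:
  assumes "\<bar>Re \<alpha>\<bar> < pi/2" "\<bar>u\<bar> \<le> 1"
  shows "cmod (tilt \<alpha> u) \<ge> tilt_bound \<alpha>"
proof -
  have c: "cos (Re \<alpha>) > 0" using assms by (intro cos_gt_zero_pi) auto
  have "Re (tilt \<alpha> u) = cos (Re \<alpha>) * ((1+u)/2 * exp (-Im \<alpha>) + (1-u)/2 * exp (Im \<alpha>))"
    by (simp add: tilt_def Re_cos Im_sin Re_sin field_simps)
  also have "\<dots> \<ge> cos (Re \<alpha>) * ((1+u)/2 * exp (-\<bar>Im \<alpha>\<bar>) + (1-u)/2 * exp (-\<bar>Im \<alpha>\<bar>))"
    using c assms by (intro mult_left_mono add_mono) auto
  also have "cos (Re \<alpha>) * ((1+u)/2 * exp (-\<bar>Im \<alpha>\<bar>) + (1-u)/2 * exp (-\<bar>Im \<alpha>\<bar>)) = tilt_bound \<alpha>"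
    by (simp add: tilt_bound_def field_simps)
  finally show ?thesis using complex_Re_le_cmod order.trans by blast
qed

lemma tilt_nonzero: "\<bar>Re \<alpha>\<bar> < pi/2 \<Longrightarrow> \<bar>u\<bar> \<le> 1 \<Longrightarrow> tilt \<alpha> u \<noteq> 0"
  using norm_tilt_ge[of \<alpha> u] tilt_bound_pos[of \<alpha>] by auto

lemma eigen_weight_isCont:
  assumes "-1 < u" "u < 1"
  shows "isCont (eigen_weight \<mu>) u"
proof -
  have "1 - u\<^sup>2 > 0" using assms by (simp add: abs_square_less_1)
  then show ?thesis
    unfolding eigen_weight_def cis_conv_exp using assms
    by (auto intro!: continuous_intros)
qed

lemma tilt_div_integrable:
  assumes \<alpha>: "\<bar>Re \<alpha>\<bar> < pi/2" and g [measurable]: "g \<in> borel_measurable borel"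
    and B: "\<And>u. \<bar>u\<bar> < 1 \<Longrightarrow> cmod (g u) \<le> B"
  shows "set_integrable lborel {-1<..<1} (\<lambda>u. eigen_weight \<mu> u * g u)"
  unfolding set_integrable_def
proof (rule Bochner_Integration.integrable_bound)
  show "integrable lborel (\<lambda>u. B *\<^sub>R (indicator {-1<..<1} u *\<^sub>R (1 - u\<^sup>2) powr (-1/2)) :: real)"
    using arcsine_integrable unfolding set_integrable_def
    by (intro integrable_scaleR_right) auto
  have "cmod (eigen_weight \<mu> u * g u) \<le> \<bar>B\<bar> * (1 - u\<^sup>2) powr (-1/2)" if "\<bar>u\<bar> < 1" for u
    using B[OF that] mult_right_mono[of "cmod (g u)" "\<bar>B\<bar>" "(1 - u\<^sup>2) powr (-1/2)"]
    by (auto simp: norm_mult norm_eigen_weight mult.commute)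
  then show "AE u in lborel. norm (indicator {-1<..<1} u *\<^sub>R (eigen_weight \<mu> u * g u))
     \<le> norm (B *\<^sub>R (indicator {-1<..<1} u *\<^sub>R (1 - u\<^sup>2) powr (-1/2)))"
    by (auto simp: indicator_def abs_mult)
qed simp

text \<open>The derivative of \<open>tilt \<alpha> u\<close> in \<alpha>, not in u.\<close>

definition tilt_deriv :: "complex \<Rightarrow> real \<Rightarrow> complex" where
  "tilt_deriv \<alpha> u = - sin \<alpha> + \<i> * of_real u * cos \<alpha>"

text \<open>The integrand is, up to the factor \<open>\<i>\<close>, the \<open>u\<close>-derivative of
  \<open>sqrt (1 - u\<^sup>2) * cis (\<dots>) / tilt \<alpha> u\<close>.\<close>

lemma eigen_weight_by_parts:
  assumes \<alpha>: "\<bar>Re \<alpha>\<bar> < pi/2"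
  shows "(LINT u:{-1<..<1}|lborel. eigen_weight \<mu> u *
     (of_real (2 * \<mu>) / tilt \<alpha> u - tilt_deriv \<alpha> u / (tilt \<alpha> u)\<^sup>2)) = 0"
proof -
  let ?c = "\<lambda>u. cis (\<mu> * ln ((1 - u) / (1 + u)))" and ?w = "\<lambda>u. complex_of_real (sqrt (1 - u\<^sup>2))"
  let ?f = "\<lambda>u. eigen_weight \<mu> u * (of_real (2 * \<mu>) / tilt \<alpha> u - tilt_deriv \<alpha> u / (tilt \<alpha> u)\<^sup>2)"
  define F where "F u = \<i> * ?w u * ?c u / tilt \<alpha> u" for u
  have *: "{-1<..<1::real} = einterval (ereal (-1)) (ereal 1)" by (simp only: einterval_eq)
  have sq: "x\<^sup>2 < 1" if "-1 < x" "x < 1" for x :: real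
    using that by (simp add: abs_square_less_1)
  have "(LBINT u=ereal (-1)..ereal 1. ?f u) = 0 - 0"
  proof (rule interval_integral_FTC_integrable[where F=F])
    fix x :: real assume "ereal (-1) < ereal x" "ereal x < ereal 1"
    then have x: "-1 < x" "x < 1" by auto
    define r where "r = sqrt (1 - x\<^sup>2)"
    have r: "r > 0" "r\<^sup>2 = 1 - x\<^sup>2" using sq[OF x] by (auto simp: r_def)
    have nz: "tilt \<alpha> x \<noteq> 0" using \<alpha> x by (intro tilt_nonzero) auto
    have d1: "((\<lambda>u. of_real (sqrt (1 - u\<^sup>2)) :: complex) has_vector_derivative of_real (- x / r)) (at x)"
      unfolding r_def using sq[OF x]
      by (intro has_vector_derivative_of_real)
         (auto intro!: derivative_eq_intros simp: has_real_derivative_iff_has_vector_derivative[symmetric] field_simps)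
    have d2: "((\<lambda>u. \<mu> * ln ((1 - u) / (1 + u))) has_real_derivative (- 2 * \<mu> / r\<^sup>2)) (at x)"
    proof -
      have "((\<lambda>u. \<mu> * (ln (1 - u) - ln (1 + u))) has_real_derivative (\<mu> * (- 1 / (1 - x) - 1 / (1 + x)))) (at x)"
        using x by (auto intro!: derivative_eq_intros)
      moreover have "\<mu> * (- 1 / (1 - x) - 1 / (1 + x)) = - 2 * \<mu> / r\<^sup>2"
        using x sq[OF x] unfolding r(2) by (simp add: divide_simps) (simp add: algebra_simps power2_eq_square)
      moreover have "\<forall>\<^sub>F u in nhds x. \<mu> * (ln (1 - u) - ln (1 + u)) = \<mu> * ln ((1 - u) / (1 + u))"
        using x by (intro eventually_mono[OF eventually_nhds_in_open[of "{-1<..<1}" x]]) (auto simp: ln_div)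
      ultimately show ?thesis
        using DERIV_cong_ev[OF refl, of "\<lambda>u. \<mu> * (ln (1 - u) - ln (1 + u))"
           "\<lambda>u. \<mu> * ln ((1 - u) / (1 + u))" x "- 2 * \<mu> / r\<^sup>2" "- 2 * \<mu> / r\<^sup>2"]
        by simp
    qed
    have d3: "((\<lambda>u. ?c u) has_vector_derivative
        \<i> * of_real (- 2 * \<mu> / r\<^sup>2) * ?c x) (at x)"
    proof -
      have "((\<lambda>u. exp (\<i> * of_real (\<mu> * ln ((1 - u) / (1 + u))))) has_vector_derivative
        \<i> * of_real (- 2 * \<mu> / r\<^sup>2) * exp (\<i> * of_real (\<mu> * ln ((1 - x) / (1 + x))))) (at x)"
        using field_vector_diff_chain_at[of "\<lambda>u. \<i> * of_real (\<mu> * ln ((1 - u) / (1 + u)))" "\<i> * of_real (- 2 * \<mu> / r\<^sup>2)" x exp,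
            OF has_vector_derivative_mult_right[OF has_vector_derivative_of_real[OF d2]] DERIV_exp]
        by (simp add: o_def)
      then show ?thesis by (simp add: cis_conv_exp)
    qed
    have d4: "(tilt \<alpha> has_vector_derivative \<i> * sin \<alpha>) (at x)"
    proof -
      have "((\<lambda>u. cos \<alpha> + \<i> * sin \<alpha> * of_real u) has_vector_derivative 0 + \<i> * sin \<alpha> * of_real 1) (at x)"
        by (intro has_vector_derivative_add has_vector_derivative_const has_vector_derivative_mult_right
            has_vector_derivative_of_real DERIV_ident)
      then show ?thesis by (simp add: tilt_def [abs_def] mult_ac)
    qed
    define c where "c = ?c x"
    define R where "R = complex_of_real r"
    have R: "R \<noteq> 0" "R\<^sup>2 = 1 - (of_real x)\<^sup>2"
      using r by (simp_all add: R_def flip: of_real_power)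
    have ew: "eigen_weight \<mu> x = c / R"
      using r sq[OF x] by (simp add: eigen_weight_def c_def R_def powr_minus powr_half_sqrt r_def divide_simps)
    have rx: "?w x = R" by (simp add: R_def r_def)
    have d23: "((\<lambda>u. ?w u * ?c u) has_vector_derivative
        ?w x * (\<i> * of_real (- 2 * \<mu> / r\<^sup>2) * c) + of_real (- x / r) * c) (at x)"
      unfolding c_def by (rule has_vector_derivative_mult[OF d1 d3])
    have dinv: "((\<lambda>u. inverse (tilt \<alpha> u)) has_vector_derivative
        \<i> * sin \<alpha> * (- (inverse (tilt \<alpha> x) ^ Suc (Suc 0)))) (at x)"
      using field_vector_diff_chain_at[OF d4 DERIV_inverse[OF nz]] by (simp add: o_def)
    have "((\<lambda>u. \<i> * ((?w u * ?c u) * inverse (tilt \<alpha> u)))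
       has_vector_derivative
        \<i> * ((?w x * c) * (\<i> * sin \<alpha> * (- (inverse (tilt \<alpha> x) ^ Suc (Suc 0))))
          + (?w x * (\<i> * of_real (- 2 * \<mu> / r\<^sup>2) * c) + of_real (- x / r) * c) * inverse (tilt \<alpha> x))) (at x)"
      unfolding c_def
      by (rule has_vector_derivative_mult_right has_vector_derivative_mult dinv d23[unfolded c_def])+
    moreover have "\<i> * ((?w x * c) * (\<i> * sin \<alpha> * (- (inverse (tilt \<alpha> x) ^ Suc (Suc 0))))
          + (?w x * (\<i> * of_real (- 2 * \<mu> / r\<^sup>2) * c) + of_real (- x / r) * c) * inverse (tilt \<alpha> x)) = ?f x"
    proof -
      define t where "t = tilt \<alpha> x"
      have t: "t \<noteq> 0" "t = cos \<alpha> + \<i> * of_real x * sin \<alpha>" using nz by (auto simp: t_def tilt_def)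
      have "\<i> * ((R * c) * (\<i> * sin \<alpha> * (- (inverse t ^ Suc (Suc 0))))
          + (R * (\<i> * (- 2 * of_real \<mu> / R\<^sup>2) * c) + (- of_real x / R) * c) * inverse t)
         = c / R * ((R\<^sup>2 * sin \<alpha> + (2 * of_real \<mu> - \<i> * of_real x) * t) / t\<^sup>2)"
        using t(1) R(1) by (simp add: field_simps power2_eq_square)
      \<comment> \<open>With R^2 = 1 - x^2 the terms x^2 sin \<alpha> cancel against those of - i x
        t, leaving sin \<alpha> - i x cos \<alpha>, which is minus the \<alpha>-derivative of the
        tilt.\<close>
      also have "R\<^sup>2 * sin \<alpha> + (2 * of_real \<mu> - \<i> * of_real x) * t = 2 * of_real \<mu> * t - tilt_deriv \<alpha> x"
        unfolding R(2) tilt_deriv_def by (simp add: t(2) algebra_simps power2_eq_square)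
      also have "c / R * ((2 * of_real \<mu> * t - tilt_deriv \<alpha> x) / t\<^sup>2) = c / R * (of_real (2 * \<mu>) / t - tilt_deriv \<alpha> x / t\<^sup>2)"
        using t(1) by (simp add: divide_simps power2_eq_square)
      finally show ?thesis
        unfolding ew rx t_def by (simp add: R_def)
    qed
    ultimately show "(F has_vector_derivative ?f x) (at x)"
      by (simp add: F_def [abs_def] mult_ac divide_inverse)
    have tc: "isCont (tilt \<alpha>) x" "isCont (tilt_deriv \<alpha>) x"
      unfolding tilt_def [abs_def] tilt_deriv_def [abs_def] by (intro continuous_intros)+
    show "isCont ?f x" 
      by (intro continuous_intros eigen_weight_isCont[OF x] tc) (use nz in auto)
  next
    show "set_integrable lborel (einterval (ereal (-1)) (ereal 1)) ?f"
      unfolding *[symmetric]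
    proof (rule tilt_div_integrable[OF \<alpha>])
      let ?b = "tilt_bound \<alpha>"
      have b: "?b > 0" using tilt_bound_pos[OF \<alpha>] .
      fix u :: real assume u: "\<bar>u\<bar> < 1"
      have t: "cmod (tilt \<alpha> u) \<ge> ?b" using u \<alpha> by (intro norm_tilt_ge) auto
      have "cmod (tilt_deriv \<alpha> u) \<le> cmod (sin \<alpha>) + cmod (cos \<alpha>)"
        unfolding tilt_deriv_def using u
        by (intro order.trans[OF norm_triangle_ineq] add_mono) (auto simp: norm_mult mult_left_le_one_le)
      then have "cmod (tilt_deriv \<alpha> u / (tilt \<alpha> u)\<^sup>2) \<le> (cmod (sin \<alpha>) + cmod (cos \<alpha>)) / ?b\<^sup>2"
        unfolding norm_divide norm_power using b t by (intro frac_le power_mono) auto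
      moreover have "cmod (of_real (2 * \<mu>) / tilt \<alpha> u) \<le> cmod (of_real (2 * \<mu>)) / ?b"
        unfolding norm_divide using b t by (intro frac_le) auto
      ultimately show "cmod (of_real (2 * \<mu>) / tilt \<alpha> u - tilt_deriv \<alpha> u / (tilt \<alpha> u)\<^sup>2)
          \<le> cmod (of_real (2 * \<mu>)) / ?b + (cmod (sin \<alpha>) + cmod (cos \<alpha>)) / ?b\<^sup>2"
        by (intro order.trans[OF norm_triangle_ineq4] add_mono)
    qed (unfold tilt_deriv_def, measurable)
  next
    \<comment> \<open>The boundary terms vanish because sqrt (1 - u^2) does at both ends, while the
      tilt stays bounded away from 0.\<close>
    have lim: "(F \<longlongrightarrow> 0) (at v within {-1..1})" if v: "\<bar>v\<bar> = 1" for v :: real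
    proof (rule tendsto_0_le[where K=1])
      have "((\<lambda>u. sqrt (1 - u\<^sup>2) / tilt_bound \<alpha>) \<longlongrightarrow> sqrt (1 - v\<^sup>2) / tilt_bound \<alpha>) (at v within {-1..1})"
        using tilt_bound_pos[OF \<alpha>] by (intro tendsto_intros) auto
      moreover have "v\<^sup>2 = 1" using v by (metis power2_abs one_power2)
      ultimately show "((\<lambda>u. sqrt (1 - u\<^sup>2) / tilt_bound \<alpha>) \<longlongrightarrow> 0) (at v within {-1..1})" by simp
      have "norm (F x) \<le> norm (sqrt (1 - x\<^sup>2) / tilt_bound \<alpha>) * 1" if x: "x \<in> {-1..1}" for x
        unfolding F_def norm_divide norm_mult using norm_tilt_ge[OF \<alpha>, of x] tilt_bound_pos[OF \<alpha>] x
        by (auto intro!: frac_le simp: abs_square_le_1)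
      then show "\<forall>\<^sub>F x in at v within {-1..1}. norm (F x) \<le> norm (sqrt (1 - x\<^sup>2) / tilt_bound \<alpha>) * 1"
        by (auto simp: eventually_at_filter)
    qed
    show "((F \<circ> real_of_ereal) \<longlongrightarrow> 0) (at_right (ereal (-1)))"
      unfolding ereal_tendsto_simps using lim[of "-1"] at_within_Icc_at_right[of "-1" "1::real"] by simp
    show "((F \<circ> real_of_ereal) \<longlongrightarrow> 0) (at_left (ereal 1))"
      unfolding ereal_tendsto_simps using lim[of 1] at_within_Icc_at_left[of "-1" "1::real"] by simp
  qed auto
  then show ?thesis by (simp add: interval_lebesgue_integral_def del: of_real_mult)
qed

section \<open>Lebesgue measure restricted to intervals\<close>

lemma borel_measurable_pair_restrict_lborel:
  fixes f :: "real \<times> real \<Rightarrow> complex"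
  assumes "f \<in> borel_measurable (borel \<Otimes>\<^sub>M borel)"
  shows "f \<in> borel_measurable (restrict_space lborel A \<Otimes>\<^sub>M restrict_space lborel B)"
proof -
  have "(\<lambda>x::real. x) \<in> measurable (restrict_space lborel S) borel" for S
    by (rule measurable_restrict_space1) simp
  then have "(\<lambda>p::real \<times> real. (fst p, snd p)) \<in> measurable (restrict_space lborel A \<Otimes>\<^sub>M restrict_space lborel B) (borel \<Otimes>\<^sub>M borel)"
    by (intro measurable_Pair measurable_compose[OF measurable_fst] measurable_compose[OF measurable_snd])
  from measurable_compose[OF this assms] show ?thesis by simp
qed

lemma sigma_finite_restrict_lborel:
  "S \<in> sets borel \<Longrightarrow> sigma_finite_measure (restrict_space lborel S)"
  by (rule sigma_finite_measure_restrict_space) (auto intro: sigma_finite_lborel)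

lemma set_lebesgue_integral_eq_restrict_space:
  fixes f :: "real \<Rightarrow> complex"
  shows "S \<in> sets borel \<Longrightarrow> (LINT x:S|lborel. f x) = (LINT x|restrict_space lborel S. f x)"
  unfolding set_lebesgue_integral_def by (subst integral_restrict_space) auto

lemma set_integrable_eq_restrict_space:
  fixes f :: "real \<Rightarrow> 'b::{banach, second_countable_topology}"
  shows "S \<in> sets borel \<Longrightarrow> set_integrable lborel S f \<longleftrightarrow> integrable (restrict_space lborel S) f"
  unfolding set_integrable_def by (subst integrable_restrict_space) auto

lemma square_powr_neg_three_halves:
  fixes t :: real
  assumes "t > 0"
  shows "(t\<^sup>2) powr (-3/2) = inverse (t ^ 3)"
proof -
  have "(t\<^sup>2) powr (-3/2) = (t powr 2) powr (-3/2)" using assms by simp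
  also have "\<dots> = t powr (-3)" unfolding powr_powr by simp
  also have "\<dots> = inverse (t ^ 3)" using assms by (simp add: powr_minus)
  finally show ?thesis .
qed

section \<open>The shift of contour and the value at angle 0\<close>

text \<open>Under u = - tanh t one has ln ((1 - u) / (1 + u)) = 2 t, and the integral becomes that
  of exp (2 i \<mu> t) / cosh (t - i \<alpha>) over the real line.\<close>

definition tilted_integral :: "real \<Rightarrow> complex \<Rightarrow> complex" where
  "tilted_integral \<mu> \<alpha> = (LINT u:{-1<..<1}|lborel. eigen_weight \<mu> u / tilt \<alpha> u)"

lemma tilted_integrable:
  assumes \<alpha>: "\<bar>Re \<alpha>\<bar> < pi/2"
  shows "set_integrable lborel {-1<..<1} (\<lambda>u. eigen_weight \<mu> u / tilt \<alpha> u)"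
  unfolding divide_inverse
proof (rule tilt_div_integrable[OF \<alpha>])
  fix u :: real assume "\<bar>u\<bar> < 1"
  then show "cmod (inverse (tilt \<alpha> u)) \<le> inverse (tilt_bound \<alpha>)"
    unfolding norm_inverse using \<alpha> tilt_bound_pos[OF \<alpha>] by (intro le_imp_inverse_le norm_tilt_ge) auto
qed measurable

text \<open>In the variable \<open>t\<close> with \<open>u = - tanh t\<close> this is the shift of the contour
  \<open>\<real>\<close> to \<open>\<real> + \<i> \<alpha>\<close>.  Differentiating
  \<open>exp (2 \<mu> r \<alpha>) / tilt (r \<alpha>) u\<close> in \<open>r\<close> gives an integrand covered by
  \<open>eigen_weight_by_parts\<close>.\<close>

lemma tilted_integral_shift:
  assumes \<alpha>: "\<bar>Re \<alpha>\<bar> < pi/2"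
  shows "tilted_integral \<mu> \<alpha> * exp (2 * of_real \<mu> * \<alpha>) = tilted_integral \<mu> 0"
proof -
  define k where "k r u = \<alpha> * exp (2 * of_real \<mu> * of_real r * \<alpha>) *
     (of_real (2 * \<mu>) / tilt (of_real r * \<alpha>) u - tilt_deriv (of_real r * \<alpha>) u / (tilt (of_real r * \<alpha>) u)\<^sup>2)" for r u
  define f where "f r u = eigen_weight \<mu> u * k r u" for r u
  let ?M = "restrict_space lborel {0..1::real}" and ?N = "restrict_space lborel {-1<..<1::real}"
  have Re: "\<bar>Re (of_real r * \<alpha>)\<bar> < pi/2" if "r \<in> {0..1}" for r
  proof -
    have "\<bar>Re (of_real r * \<alpha>)\<bar> = r * \<bar>Re \<alpha>\<bar>" using that by (simp add: abs_mult)
    also have "\<dots> \<le> \<bar>Re \<alpha>\<bar>" using that by (intro mult_left_le_one_le) auto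
    finally show ?thesis using \<alpha> by simp
  qed
  have nz: "tilt (of_real r * \<alpha>) u \<noteq> 0" if "r \<in> {0..1}" "\<bar>u\<bar> \<le> 1" for r u
    using tilt_nonzero[OF Re[OF that(1)] that(2)] .
  have contk: "continuous_on ({0..1} \<times> {-1..1}) (\<lambda>(r, u). k r u)"
    unfolding k_def tilt_deriv_def case_prod_beta tilt_def
    using nz by (intro continuous_intros) (auto simp: tilt_def)
  \<comment> \<open>The singular weight is kept apart; the remaining factor is continuous on a
    compact rectangle, which supplies the constant of the Fubini majorant.\<close>
  have "compact ((\<lambda>(r, u). k r u) ` ({0..1} \<times> {-1..1}))"
    by (intro compact_continuous_image contk compact_Times) auto
  then obtain C where C: "\<And>r u. r \<in> {0..1} \<Longrightarrow> u \<in> {-1..1} \<Longrightarrow> cmod (k r u) \<le> C"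
    by (fastforce dest!: compact_imp_bounded simp: bounded_iff)
  \<comment> \<open>Integrating over u first gives 0 by the integration by parts; integrating over r
    first gives the difference of the values at r = 1 and r = 0.\<close>
  have "(\<integral>r. \<integral>u. f r u \<partial>?N \<partial>?M) = (\<integral>u. \<integral>r. f r u \<partial>?M \<partial>?N)"
  proof (rule Fubini_dominated)
    show "case_prod f \<in> borel_measurable (?M \<Otimes>\<^sub>M ?N)"
      unfolding f_def k_def tilt_deriv_def case_prod_beta
    proof (rule borel_measurable_pair_restrict_lborel)
      have [measurable]: "(cos :: complex \<Rightarrow> complex) \<in> borel_measurable borel"
        "(sin :: complex \<Rightarrow> complex) \<in> borel_measurable borel"
        by (auto intro!: borel_measurable_continuous_onI continuous_on_cos continuous_on_sin)
      show "(\<lambda>p. eigen_weight \<mu> (snd p) *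
         (\<alpha> * exp (2 * of_real \<mu> * of_real (fst p) * \<alpha>) *
          (of_real (2 * \<mu>) / tilt (of_real (fst p) * \<alpha>) (snd p) -
           (- sin (of_real (fst p) * \<alpha>) + \<i> * of_real (snd p) * cos (of_real (fst p) * \<alpha>)) /
           (tilt (of_real (fst p) * \<alpha>) (snd p))\<^sup>2))) \<in> borel_measurable (borel \<Otimes>\<^sub>M borel)"
        by measurable
    qed
    show "integrable ?M (\<lambda>_. C)"
      by (subst set_integrable_eq_restrict_space[symmetric]) (auto intro: borel_integrable_atLeastAtMost')
    show "integrable ?N (\<lambda>u. (1 - u\<^sup>2) powr (-1/2))"
      using arcsine_integrable by (subst set_integrable_eq_restrict_space[symmetric]) auto
    show "cmod (f r u) \<le> C * (1 - u\<^sup>2) powr (-1/2)" if "r \<in> space ?M" "u \<in> space ?N" for r u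
    proof -
      have "cmod (k r u) \<le> C" using that by (intro C) (auto simp: space_restrict_space)
      then show ?thesis
        unfolding f_def norm_mult norm_eigen_weight by (subst mult.commute) (rule mult_right_mono, auto)
    qed
  qed (simp_all add: sigma_finite_restrict_lborel)
  also have "(\<integral>r. \<integral>u. f r u \<partial>?N \<partial>?M) = (\<integral>r. 0 \<partial>?M)"
  proof (rule Bochner_Integration.integral_cong [OF refl])
    fix r assume "r \<in> space ?M"
    then have "r \<in> {0..1}" by (simp add: space_restrict_space)
    have "(\<integral>u. f r u \<partial>?N) = (LINT u:{-1<..<1}|lborel. \<alpha> * exp (2 * of_real \<mu> * of_real r * \<alpha>) * (eigen_weight \<mu> u *
     (of_real (2 * \<mu>) / tilt (of_real r * \<alpha>) u - tilt_deriv (of_real r * \<alpha>) u / (tilt (of_real r * \<alpha>) u)\<^sup>2)))"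
      by (subst set_lebesgue_integral_eq_restrict_space, simp, intro Bochner_Integration.integral_cong refl)
         (simp add: f_def k_def mult_ac)
    also have "\<dots> = 0"
      using eigen_weight_by_parts[OF Re[OF \<open>r \<in> {0..1}\<close>], of \<mu>] by (simp del: of_real_mult)
    finally show "(\<integral>u. f r u \<partial>?N) = 0" .
  qed
  also have "(\<integral>u. \<integral>r. f r u \<partial>?M \<partial>?N) = (\<integral>u. eigen_weight \<mu> u / tilt \<alpha> u * exp (2 * of_real \<mu> * \<alpha>) - eigen_weight \<mu> u / tilt 0 u \<partial>?N)"
  proof (rule Bochner_Integration.integral_cong [OF refl])
    fix u assume "u \<in> space ?N"
    then have u: "u \<in> {-1..1}" by (simp add: space_restrict_space)
    define G where "G r = exp (2 * of_real \<mu> * of_real r * \<alpha>) / tilt (of_real r * \<alpha>) u" for r :: real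
    have "(\<integral>r. k r u \<partial>?M) = (LINT r|lborel. indicator {0..1} r *\<^sub>R k r u)"
      by (subst integral_restrict_space) auto
    also have "\<dots> = G 1 - G 0"
    proof (rule integral_FTC_atLeastAtMost)
      fix r :: real assume r: "0 \<le> r" "r \<le> 1"
      have nz': "tilt (of_real r * \<alpha>) u \<noteq> 0" using r u by (intro nz) auto
      let ?G = "\<lambda>z. exp (2 * of_real \<mu> * z * \<alpha>) / tilt (z * \<alpha>) u"
      have "(?G has_field_derivative k r u) (at (of_real r))"
        unfolding tilt_def k_def using nz' unfolding tilt_def
        by (auto intro!: derivative_eq_intros simp: tilt_deriv_def divide_simps power2_eq_square) (simp add: algebra_simps)
      then have "(?G \<circ> of_real has_vector_derivative of_real 1 * k r u) (at r)"
        by (intro field_vector_diff_chain_at has_vector_derivative_of_real DERIV_ident)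
      then show "(G has_vector_derivative k r u) (at r within {0..1})"
        by (auto simp: G_def [abs_def] o_def intro: has_vector_derivative_at_within)
    next
      have "continuous_on {0..1} (\<lambda>r. case (r, u) of (r, u) \<Rightarrow> k r u)"
        using u by (intro continuous_on_compose2[OF contk]) (auto intro!: continuous_intros)
      then show "continuous_on {0..1} (\<lambda>r. k r u)" by simp
    qed simp
    finally have "(\<integral>r. f r u \<partial>?M) = eigen_weight \<mu> u * (G 1 - G 0)"
      by (simp add: f_def)
    then show "(\<integral>r. f r u \<partial>?M) = eigen_weight \<mu> u / tilt \<alpha> u * exp (2 * of_real \<mu> * \<alpha>) - eigen_weight \<mu> u / tilt 0 u"
      by (simp add: G_def right_diff_distrib)
  qed
  also have "\<dots> = tilted_integral \<mu> \<alpha> * exp (2 * of_real \<mu> * \<alpha>) - tilted_integral \<mu> 0"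
    using tilted_integrable[OF \<alpha>, of \<mu>] tilted_integrable[of 0 \<mu>]
    unfolding tilted_integral_def
    by (simp add: set_integrable_eq_restrict_space set_lebesgue_integral_eq_restrict_space
        Bochner_Integration.integral_diff del: times_divide_eq_left)
  finally show ?thesis by simp
qed

text \<open>As \<open>\<alpha> \<rightarrow> \<pi>/2\<close>, the kernels \<open>1 / tilt \<alpha> + 1 / tilt (-\<alpha>)\<close> become a
  multiple of the Dirac measure at \<open>0\<close>.\<close>

lemma tilted_integral_0: "tilted_integral \<mu> 0 = of_real (pi / cosh (pi * \<mu>))"
proof -
  define \<epsilon> where "\<epsilon> n = 1 / (real n + 2)" for n
  have \<epsilon>: "0 < \<epsilon> n" "\<epsilon> n < 1" for n by (auto simp: \<epsilon>_def)
  have \<epsilon>0: "\<epsilon> \<longlonglongrightarrow> 0" unfolding \<epsilon>_def by real_asymp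
  define \<alpha> where "\<alpha> n = arccos (\<epsilon> n)" for n
  have \<alpha>: "0 < \<alpha> n" "\<alpha> n < pi/2" for n
    using arccos_lt_bounded[of "\<epsilon> n"] arccos_less_arccos[of 0 "\<epsilon> n"] \<epsilon>[of n] by (auto simp: \<alpha>_def)
  have \<alpha>lim: "\<alpha> \<longlonglongrightarrow> pi/2"
    unfolding \<alpha>_def using isCont_tendsto_compose[OF isCont_arccos \<epsilon>0] by simp
  \<comment> \<open>The substitution u = \<open>g n y\<close> turns the sum of the two kernels times
    (1 - u^2)^(-1/2) du into exactly 2 / (1 + y^2) dy. Only the phase still depends on n, and it
    tends to 1 because \<open>g n y\<close> tends to 0.\<close>
  define g where "g n y = \<epsilon> n * y / sqrt (1 + (\<epsilon> n * y)\<^sup>2)" for n y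
  define S where "S n y = of_real (2 * inverse (1 + y\<^sup>2)) * cis (\<mu> * ln ((1 - g n y) / (1 + g n y)))" for n y
  have int1: "integrable lborel (\<lambda>y. 2 * inverse (1 + y\<^sup>2) :: real)"
    using integrable_inverse_1_plus_square by (auto simp: set_integrable_def)
  have val1: "(LINT y|lborel. inverse (1 + y\<^sup>2) :: real) = pi"
    using LBINT_inverse_1_plus_square by (simp add: interval_lebesgue_integral_def set_lebesgue_integral_def)
  have gpos: "0 < 1 + (\<epsilon> n * y)\<^sup>2" for n y by (simp add: add_pos_nonneg)
  have glim: "(\<lambda>n. g n y) \<longlonglongrightarrow> 0" for y
  proof -
    have "(\<lambda>n. g n y) \<longlonglongrightarrow> 0 * y / sqrt (1 + (0 * y)\<^sup>2)"
      unfolding g_def by (intro tendsto_intros \<epsilon>0) auto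
    then show ?thesis by simp
  qed
  have [measurable]: "(\<lambda>y. S n y) \<in> borel_measurable borel" for n
    unfolding S_def g_def cis_conv_exp by measurable
  have lim: "(\<lambda>n. LINT y|lborel. S n y) \<longlonglongrightarrow> (LINT y|lborel. of_real (2 * inverse (1 + y\<^sup>2)))"
  proof (rule integral_dominated_convergence[OF _ _ int1])
    have "(\<lambda>n. S n y) \<longlonglongrightarrow> of_real (2 * inverse (1 + y\<^sup>2)) * cis (\<mu> * ln ((1 - 0) / (1 + 0)))" for y
      unfolding S_def by (intro tendsto_intros glim) auto
    then show "AE y in lborel. (\<lambda>n. S n y) \<longlonglongrightarrow> of_real (2 * inverse (1 + y\<^sup>2))" by simp
    show "AE y in lborel. norm (S n y) \<le> 2 * inverse (1 + y\<^sup>2)" for n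
      by (auto simp: S_def norm_mult abs_mult simp del: of_real_mult)
  qed measurable
  have limval: "(LINT y|lborel. complex_of_real (2 * inverse (1 + y\<^sup>2))) = of_real (2 * pi)"
    by (subst integral_complex_of_real) (simp add: val1)
  have eq: "(LINT y|lborel. S n y) = tilted_integral \<mu> 0 * of_real (2 * cosh (2 * \<mu> * \<alpha> n))" for n
  proof -
    \<comment> \<open>The sum of 1 / tilt at \<alpha> and at - \<alpha> with cos \<alpha> =
      \<epsilon>: the two tilts are conjugate, their sum is 2 \<epsilon> and their product is the
      denominator here.\<close>
    define K where "K u = 2 * \<epsilon> n / ((\<epsilon> n)\<^sup>2 + (1 - (\<epsilon> n)\<^sup>2) * u\<^sup>2)" for u
    have e2: "(\<epsilon> n)\<^sup>2 < 1" using \<epsilon>[of n] by (simp add: power_less_one_iff)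
    have Kden: "(\<epsilon> n)\<^sup>2 + (1 - (\<epsilon> n)\<^sup>2) * u\<^sup>2 > 0" for u
      using \<epsilon>[of n] e2 by (intro add_pos_nonneg) auto
    have c: "cos (\<alpha> n) = \<epsilon> n" "(sin (\<alpha> n))\<^sup>2 = 1 - (\<epsilon> n)\<^sup>2"
      using \<epsilon>[of n] by (simp_all add: \<alpha>_def sin_squared_eq)
    have "tilt (of_real (\<alpha> n)) u * tilt (- of_real (\<alpha> n)) u = of_real ((\<epsilon> n)\<^sup>2 + (1 - (\<epsilon> n)\<^sup>2) * u\<^sup>2)" for u
      unfolding tilt_def c(2)[symmetric] cos_minus sin_minus cos_of_real sin_of_real c(1)
      by (simp add: algebra_simps power2_eq_square)
    moreover have "tilt (of_real (\<alpha> n)) u + tilt (- of_real (\<alpha> n)) u = of_real (2 * \<epsilon> n)" for u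
      unfolding tilt_def cos_minus sin_minus cos_of_real sin_of_real c(1) by simp
    moreover have "tilt (of_real (\<alpha> n)) u \<noteq> 0" "tilt (- of_real (\<alpha> n)) u \<noteq> 0" if "\<bar>u\<bar> \<le> 1" for u
      using \<alpha>[of n] that tilt_nonzero[of "of_real (\<alpha> n)" u] tilt_nonzero[of "- of_real (\<alpha> n)" u] by auto
    ultimately have K: "of_real (K u) = 1 / tilt (of_real (\<alpha> n)) u + 1 / tilt (- of_real (\<alpha> n)) u" if "\<bar>u\<bar> \<le> 1" for u
      unfolding K_def of_real_divide using that by (simp add: add_divide_eq_iff add_frac_eq add.commute)
    have ti: "set_integrable lborel {-1<..<1} (\<lambda>u. eigen_weight \<mu> u / tilt (of_real (\<alpha> n)) u)"
             "set_integrable lborel {-1<..<1} (\<lambda>u. eigen_weight \<mu> u / tilt (- of_real (\<alpha> n)) u)"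
      using \<alpha>[of n] by (auto intro!: tilted_integrable)
    let ?f = "\<lambda>u. eigen_weight \<mu> u * of_real (K u)"
    have fint: "set_integrable lborel {-1<..<1} ?f"
      using set_integral_add(1)[OF ti] 
      by (rule set_integrable_cong[THEN iffD1, rotated -1]) (auto simp: K algebra_simps)
    have "(LINT u:{-1<..<1}|lborel. ?f u) = tilted_integral \<mu> (of_real (\<alpha> n)) + tilted_integral \<mu> (- of_real (\<alpha> n))"
      unfolding tilted_integral_def set_integral_add(2)[OF ti, symmetric]
      by (intro set_lebesgue_integral_cong) (auto simp: K algebra_simps)
    also have "tilted_integral \<mu> (of_real (\<alpha> n)) = tilted_integral \<mu> 0 * of_real (exp (- 2 * \<mu> * \<alpha> n))"
      using tilted_integral_shift[of "of_real (\<alpha> n)" \<mu>] \<alpha>[of n] by (simp add: exp_minus field_simps flip: exp_of_real)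
    also have "tilted_integral \<mu> (- of_real (\<alpha> n)) = tilted_integral \<mu> 0 * of_real (exp (2 * \<mu> * \<alpha> n))"
      using tilted_integral_shift[of "- of_real (\<alpha> n)" \<mu>] \<alpha>[of n] by (simp add: exp_minus field_simps flip: exp_of_real)
    finally have 1: "(LINT u:{-1<..<1}|lborel. ?f u) = tilted_integral \<mu> 0 * of_real (2 * cosh (2 * \<mu> * \<alpha> n))"
      by (simp add: cosh_def algebra_simps)
    define g' where "g' y = \<epsilon> n * (1 + (\<epsilon> n * y)\<^sup>2) powr (-3/2)" for y
    have glt: "-1 < g n y" "g n y < 1" for y
    proof -
      have "\<bar>\<epsilon> n * y\<bar> < sqrt (1 + (\<epsilon> n * y)\<^sup>2)" by (rule real_less_rsqrt) simp
      then show "-1 < g n y" "g n y < 1" using gpos[of n y] by (auto simp: g_def divide_simps)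
    qed
    have Sg: "g' y *\<^sub>R ?f (g n y) = S n y" for y
    proof -
      define t where "t = sqrt (1 + (\<epsilon> n * y)\<^sup>2)"
      have t: "t > 0" "t\<^sup>2 = 1 + (\<epsilon> n * y)\<^sup>2" using gpos[of n y] by (auto simp: t_def)
      define Y where "Y = 1 + y\<^sup>2"
      have Y: "Y > 0" by (simp add: Y_def add_pos_nonneg)
      have gt: "g n y = \<epsilon> n * y / t" by (simp add: g_def t_def)
      have g1: "1 - (g n y)\<^sup>2 = 1 / t\<^sup>2"
      proof -
        have e: "(\<epsilon> n * y)\<^sup>2 = t\<^sup>2 - 1" using t(2) by simp
        show ?thesis unfolding gt power_divide e using t(1) by (simp add: field_simps)
      qed
      have "(1 - (g n y)\<^sup>2) powr (-1/2) = t"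
        unfolding g1 using t(1) by (simp add: powr_minus powr_half_sqrt real_sqrt_divide)
      moreover have "g' y = \<epsilon> n / t ^ 3"
      proof -
        show ?thesis unfolding g'_def t(2)[symmetric] square_powr_neg_three_halves[OF t(1)]
          using t(1) by (simp add: field_simps)
      qed
      moreover have "K (g n y) = 2 * t\<^sup>2 / (\<epsilon> n * (1 + y\<^sup>2))"
      proof -
        have "(\<epsilon> n)\<^sup>2 + (1 - (\<epsilon> n)\<^sup>2) * (g n y)\<^sup>2 = (\<epsilon> n)\<^sup>2 * (1 - (g n y)\<^sup>2) + (g n y)\<^sup>2"
          by (simp add: algebra_simps)
        also have "\<dots> = (\<epsilon> n)\<^sup>2 * (1 + y\<^sup>2) / t\<^sup>2"
          unfolding g1 unfolding gt using t(1) by (simp add: divide_simps) (simp add: algebra_simps power2_eq_square)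
        finally have den: "(\<epsilon> n)\<^sup>2 + (1 - (\<epsilon> n)\<^sup>2) * (g n y)\<^sup>2 = (\<epsilon> n)\<^sup>2 * (1 + y\<^sup>2) / t\<^sup>2" .
        show ?thesis unfolding K_def den Y_def[symmetric] using t(1) \<epsilon>[of n] Y
          by (simp add: field_simps power2_eq_square)
      qed
      ultimately have "g' y * (1 - (g n y)\<^sup>2) powr (-1/2) * K (g n y) = \<epsilon> n / t ^ 3 * t * (2 * t\<^sup>2 / (\<epsilon> n * (1 + y\<^sup>2)))"
        by simp
      also have "\<dots> = 2 * inverse (1 + y\<^sup>2)"
        unfolding Y_def[symmetric] using t(1) \<epsilon>[of n] Y by (simp add: field_simps power2_eq_square power3_eq_cube)
      finally show ?thesis unfolding S_def eigen_weight_def scaleR_conv_of_real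
        by (simp add: mult_ac flip: of_real_mult)
    qed
    have "(LBINT u=ereal (-1)..ereal 1. ?f u) = (LBINT y=-\<infinity>..\<infinity>. g' y *\<^sub>R ?f (g n y))"
    proof (rule interval_integral_substitution_integrable)
      fix y
      define t where "t = sqrt (1 + (\<epsilon> n * y)\<^sup>2)"
      have t: "t > 0" "1 + (\<epsilon> n * y)\<^sup>2 = t\<^sup>2" using gpos[of n y] by (auto simp: t_def)
      have g't: "g' y = \<epsilon> n / t ^ 3"
        unfolding g'_def t(2) square_powr_neg_three_halves[OF t(1)] using t(1) by (simp add: field_simps)
      have d1: "((\<lambda>y. 1 + (\<epsilon> n * y)\<^sup>2) has_real_derivative 2 * (\<epsilon> n)\<^sup>2 * y) (at y)"
        by (auto intro!: derivative_eq_intros simp: power2_eq_square)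
      have d2: "((\<lambda>y. sqrt (1 + (\<epsilon> n * y)\<^sup>2)) has_real_derivative (inverse t / 2) * (2 * (\<epsilon> n)\<^sup>2 * y)) (at y)"
        unfolding t_def by (rule DERIV_chain2[OF DERIV_real_sqrt d1]) (rule gpos)
      have d3: "((\<lambda>y. \<epsilon> n * y) has_real_derivative \<epsilon> n) (at y)"
        by (auto intro!: derivative_eq_intros)
      have "(\<epsilon> n * t - \<epsilon> n * y * (inverse t / 2 * (2 * (\<epsilon> n)\<^sup>2 * y))) / (t * t) = \<epsilon> n * (t\<^sup>2 - (\<epsilon> n * y)\<^sup>2) / t ^ 3"
        using t(1) by (simp add: divide_simps power2_eq_square power3_eq_cube) (simp add: algebra_simps)
      also have "t\<^sup>2 - (\<epsilon> n * y)\<^sup>2 = 1" using t(2) by simp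
      also have "\<epsilon> n * 1 / t ^ 3 = g' y" unfolding g't by simp
      finally show "DERIV (g n) y :> g' y"
        unfolding g_def using DERIV_divide[OF d3 d2] t(1) by (simp add: t_def[symmetric])
      have "isCont (eigen_weight \<mu>) (g n y)" using glt[of y] by (intro eigen_weight_isCont) auto
      then show "isCont ?f (g n y)"
        unfolding K_def using Kden[of "g n y"] by (intro continuous_intros) auto
      show "isCont g' y" unfolding g'_def using gpos[of n y] by (intro continuous_intros) auto
      show "0 \<le> g' y" unfolding g'_def using \<epsilon>[of n] by simp
    next
      show "((ereal \<circ> g n \<circ> real_of_ereal) \<longlongrightarrow> ereal (-1)) (at_right (-\<infinity>))"
        unfolding ereal_tendsto_simps g_def using \<epsilon>(1)[of n] by real_asymp
      show "((ereal \<circ> g n \<circ> real_of_ereal) \<longlongrightarrow> ereal 1) (at_left \<infinity>)"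
        unfolding ereal_tendsto_simps g_def using \<epsilon>(1)[of n] by real_asymp
      show "set_integrable lborel (einterval (-\<infinity>) \<infinity>) (\<lambda>y. g' y *\<^sub>R ?f (g n y))"
        unfolding Sg set_integrable_def
      proof (rule Bochner_Integration.integrable_bound[OF int1])
        show "AE y in lborel. norm (indicat_real (einterval (-\<infinity>) \<infinity>) y *\<^sub>R S n y) \<le> norm (2 * inverse (1 + y\<^sup>2))"
          by (auto simp: S_def norm_mult simp del: of_real_mult)
      qed simp
      show "set_integrable lborel (einterval (ereal (-1)) (ereal 1)) ?f"
        using fint by simp
    qed simp
    also have "\<dots> = (LINT y|lborel. S n y)"
      unfolding Sg by (simp add: interval_lebesgue_integral_def set_lebesgue_integral_def)
    finally show ?thesis using 1 by (simp add: interval_lebesgue_integral_def)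
  qed
  \<comment> \<open>At the angles \<plusminus>\<pi>/2 the two shift factors add up to 2 cosh (\<pi>
    \<mu>), whereas the limit kernel has total mass 2 \<pi>; the quotient is the value at angle
    0.\<close>
  have "(\<lambda>n. LINT y|lborel. S n y) \<longlonglongrightarrow> tilted_integral \<mu> 0 * of_real (2 * cosh (2 * \<mu> * (pi/2)))"
    unfolding eq by (intro tendsto_intros \<alpha>lim)
  from LIMSEQ_unique[OF this lim[unfolded limval]]
  have "tilted_integral \<mu> 0 * of_real (cosh (pi * \<mu>)) = of_real pi"
    by (simp add: mult.commute)
  then show ?thesis using cosh_real_pos[of "pi * \<mu>"] by (simp add: field_simps)
qed

section \<open>The Laplace transform of the kernel\<close>

lemma exp_half_line_integrable:
  fixes a :: real
  assumes "a > 0"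
  shows "set_integrable lborel {0<..} (\<lambda>x. exp (- a * x))"
proof -
  have "set_integrable lborel (einterval (ereal 0) \<infinity>) (\<lambda>x. exp (- a * x))"
  proof (rule interval_integral_FTC_nonneg)
    show "DERIV (\<lambda>x. - exp (- a * x) / a) x :> exp (- a * x)" for x
      using assms by (auto intro!: derivative_eq_intros)
    show "(((\<lambda>x. - exp (- a * x) / a) \<circ> real_of_ereal) \<longlongrightarrow> - 1 / a) (at_right (ereal 0))"
      unfolding ereal_tendsto_simps using assms by (auto intro!: tendsto_eq_intros)
    show "(((\<lambda>x. - exp (- a * x) / a) \<circ> real_of_ereal) \<longlongrightarrow> 0) (at_left \<infinity>)"
      unfolding ereal_tendsto_simps using assms by real_asymp
  qed (use assms in auto)
  moreover have "einterval (ereal 0) \<infinity> = {0<..}" by simp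
  ultimately show ?thesis by (simp only:)
qed

lemma cexp_half_line_integrable:
  assumes "Re w > 0"
  shows "set_integrable lborel {0<..} (\<lambda>x. exp (- w * of_real x))"
  unfolding set_integrable_def
  by (rule Bochner_Integration.integrable_bound[OF exp_half_line_integrable[OF assms, unfolded set_integrable_def]])
     (auto simp: indicator_def)

lemma cexp_half_line_integral:
  assumes "Re w > 0"
  shows "(LINT x:{0<..}|lborel. exp (- w * of_real x)) = 1 / w"
proof -
  have "w \<noteq> 0" using assms by auto
  have *: "{0::real<..} = einterval (ereal 0) \<infinity>" by simp
  have "(LBINT x=ereal 0..\<infinity>. exp (- w * of_real x)) = 0 - (- 1 / w)"
  proof (rule interval_integral_FTC_integrable)
    fix x :: real
    have "((\<lambda>z. - exp (- w * z) / w) has_field_derivative exp (- w * of_real x)) (at (of_real x))"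
      using \<open>w \<noteq> 0\<close> by (auto intro!: derivative_eq_intros)
    from field_vector_diff_chain_at[OF has_vector_derivative_of_real[OF DERIV_ident] this]
    show "((\<lambda>x. - exp (- w * of_real x) / w) has_vector_derivative exp (- w * of_real x)) (at x)"
      by (simp add: o_def)
    show "isCont (\<lambda>x. exp (- w * of_real x)) x" by (intro continuous_intros)
  next
    show "set_integrable lborel (einterval (ereal 0) \<infinity>) (\<lambda>x. exp (- w * of_real x))"
      using cexp_half_line_integrable[OF assms] by (simp only: *)
    have "((\<lambda>x. - exp (- w * of_real x) / w) \<longlongrightarrow> - exp (- w * of_real 0) / w) (at_right 0)"
      using \<open>w \<noteq> 0\<close> by (intro tendsto_intros)
    then show "(((\<lambda>x. - exp (- w * of_real x) / w) \<circ> real_of_ereal) \<longlongrightarrow> - 1 / w) (at_right (ereal 0))"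
      unfolding ereal_tendsto_simps by simp
    have "((\<lambda>x. exp (- Re w * x) / cmod w) \<longlongrightarrow> 0) at_top"
    proof -
      have "((\<lambda>x. exp (- Re w * x)) \<longlongrightarrow> 0) at_top" using assms by real_asymp
      then show ?thesis by (rule tendsto_divide_zero)
    qed
    then have "((\<lambda>x. - exp (- w * of_real x) / w) \<longlongrightarrow> 0) at_top"
      by (rule tendsto_0_le[where K=1]) (simp add: norm_divide)
    then show "(((\<lambda>x. - exp (- w * of_real x) / w) \<circ> real_of_ereal) \<longlongrightarrow> 0) (at_left \<infinity>)"
      unfolding ereal_tendsto_simps .
  qed simp
  then show ?thesis by (simp add: interval_lebesgue_integral_def)
qed

definition log_odds :: "real \<Rightarrow> real" where
  "log_odds s = ln (1/s - 1) / (2 * pi)"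

definition q_factor :: "real \<Rightarrow> real" where
  "q_factor s = 1/2 * pi powr (-3/2) * s powr (-1) * (1 - s) powr (-1/2)"

lemma q_factor_nonneg: "q_factor s \<ge> 0"
  by (simp add: q_factor_def)

lemma q_plus_eq:
  "q_plus s x = of_real (q_factor s) *
     (LINT u:{-1<..<1}|lborel. exp (- \<i> * of_real (x * u)) * eigen_weight (log_odds s) u)"
proof -
  have "exp (\<i> / of_real (2 * pi) * of_real (ln (1/s - 1) * ln ((1 - u) / (1 + u)))) =
        cis (log_odds s * ln ((1 - u) / (1 + u)))" for u
    unfolding cis_conv_exp log_odds_def by (rule arg_cong[of _ _ exp]) simp
  then show ?thesis
    unfolding q_plus_def q_factor_def[symmetric] eigen_weight_def by (simp only: mult.assoc)
qed

lemma q_plus_measurable [measurable (raw)]: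
  assumes [measurable]: "f \<in> borel_measurable M" "g \<in> borel_measurable M"
  shows "(\<lambda>x. q_plus (f x) (g x)) \<in> borel_measurable M"
  unfolding q_plus_eq set_lebesgue_integral_def log_odds_def q_factor_def by measurable

text \<open>Both exponentials under the integral have modulus 1, so the bound is uniform in x. Only
  the factor in s is unbounded, near 0 and 1, and this is what the truncation removes.\<close>

lemma norm_q_plus_le:
  "cmod (q_plus s x) \<le> q_factor s * (LINT u:{-1<..<1}|lborel. (1 - u\<^sup>2) powr (-1/2))"
proof -
  let ?f = "\<lambda>u. exp (- \<i> * of_real (x * u)) * eigen_weight (log_odds s) u"
  have n: "cmod (?f u) = (1 - u\<^sup>2) powr (-1/2)" for u
    by (simp add: norm_mult norm_eigen_weight)
  have "set_integrable lborel {-1<..<1} (\<lambda>u. eigen_weight (log_odds s) u * exp (- \<i> * of_real (x * u)))"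
    by (rule tilt_div_integrable[of 0 _ 1]) auto
  then have "set_integrable lborel {-1<..<1} ?f" by (simp add: mult.commute)
  from set_integral_norm_bound[OF this]
  have "cmod (LINT u:{-1<..<1}|lborel. ?f u) \<le> (LINT u:{-1<..<1}|lborel. (1 - u\<^sup>2) powr (-1/2))"
    unfolding n .
  then show ?thesis
    unfolding q_plus_eq norm_mult using q_factor_nonneg[of s] by (auto intro!: mult_left_mono)
qed

text \<open>The \<Phi> of the overview at angle \<alpha>, since 2 \<open>log_odds s\<close> = ln
  (1/s - 1) / \<pi>.\<close>

definition laplace_kernel :: "complex \<Rightarrow> real \<Rightarrow> complex" where
  "laplace_kernel \<alpha> s =
     of_real (pi powr (-1/2) * s powr (-1/2)) * (sin \<alpha> * exp (- 2 * of_real (log_odds s) * \<alpha>))"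

text \<open>The real part of cos \<alpha> times the conjugate of sin \<alpha> is sin (Re \<alpha>)
  cos (Re \<alpha>), whatever Im \<alpha> is. So the cotangent maps the strip into the right
  half-plane, where exp (- z x) is integrable over the half line.\<close>

lemma Re_cot_pos:
  assumes "0 < Re \<alpha>" "Re \<alpha> < pi/2"
  shows "Re (cos \<alpha> / sin \<alpha>) > 0" and "sin \<alpha> \<noteq> 0"
proof -
  have sc: "sin (Re \<alpha>) > 0" "cos (Re \<alpha>) > 0"
    using assms by (auto intro!: sin_gt_zero cos_gt_zero)
  have "Re (sin \<alpha>) > 0"
    unfolding Re_sin using sc by (auto intro!: mult_pos_pos add_pos_pos)
  then show nz: "sin \<alpha> \<noteq> 0" by auto
  have e: "exp (Im \<alpha>) * exp (- Im \<alpha>) = 1" by (simp flip: exp_add)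
  have "Re (cos \<alpha>) * Re (sin \<alpha>) + Im (cos \<alpha>) * Im (sin \<alpha>) = sin (Re \<alpha>) * cos (Re \<alpha>) * (exp (Im \<alpha>) * exp (- Im \<alpha>))"
    by (simp add: Re_sin Im_sin Re_cos Im_cos field_simps)
  also have "\<dots> > 0" unfolding e using sc by simp
  finally show "Re (cos \<alpha> / sin \<alpha>) > 0"
    unfolding Re_divide' using nz by (intro divide_pos_pos) auto
qed

text \<open>Here 1 / cosh (\<pi> \<open>log_odds s\<close>) = 2 sqrt (s (1 - s)), which cancels the
  factor (1 - s)^(-1/2) of the kernel and half of the power s^(-1).\<close>

lemma q_factor_cosh:
  assumes "0 < s" "s < 1"
  shows "q_factor s * (pi / cosh (pi * log_odds s)) = pi powr (-1/2) * s powr (-1/2)"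
proof -
  define a b where "a = sqrt s" and "b = sqrt (1 - s)"
  have ab: "a > 0" "b > 0" "a\<^sup>2 + b\<^sup>2 = 1" using assms by (auto simp: a_def b_def)
  have "1/s - 1 = (b / a)\<^sup>2"
    using assms by (simp add: a_def b_def power_divide field_simps)
  then have "pi * log_odds s = ln (b / a)"
    using ab by (simp add: log_odds_def ln_realpow)
  then have "cosh (pi * log_odds s) = (b / a + a / b) / 2"
    using ab by (simp add: cosh_def exp_minus)
  also have "\<dots> = 1 / (2 * a * b)"
  proof -
    have "(b / a + a / b) / 2 = (a\<^sup>2 + b\<^sup>2) / (2 * a * b)"
      using ab(1,2) by (simp add: field_simps power2_eq_square)
    then show ?thesis using ab(3) by simp
  qed
  finally have c: "cosh (pi * log_odds s) = 1 / (2 * a * b)" .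
  have p: "s powr (-1) = 1 / a\<^sup>2" "(1 - s) powr (-1/2) = 1 / b" "s powr (-1/2) = 1 / a"
    using assms by (simp_all add: a_def b_def powr_minus powr_half_sqrt inverse_eq_divide)
  have "pi powr (-3/2) = pi powr (-1/2) / pi"
  proof -
    have "pi powr (-3/2) = pi powr (-1/2 + -1)" by simp
    also have "\<dots> = pi powr (-1/2) * pi powr (-1)" by (rule powr_add)
    also have "pi powr (-1) = 1 / pi" by (simp add: powr_minus_divide)
    finally show ?thesis by simp
  qed
  then show ?thesis
    unfolding q_factor_def c p using ab by (simp add: field_simps power2_eq_square)
qed

text \<open>Integrating over x first leaves 1 / (z + i u) under the u-integral, and for z = cot
  \<alpha> this is sin \<alpha> / \<open>tilt \<alpha> u\<close>. The rest is the tilted integral,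
  known from the contour shift and its value at angle 0.\<close>

lemma q_plus_laplace:
  assumes s: "0 < s" "s < 1" and \<alpha>: "0 < Re \<alpha>" "Re \<alpha> < pi/2"
  shows "(LINT x:{0<..}|lborel. q_plus s x * exp (- (cos \<alpha> / sin \<alpha>) * of_real x)) = laplace_kernel \<alpha> s"
proof -
  define z where "z = cos \<alpha> / sin \<alpha>"
  have z: "Re z > 0" and sin: "sin \<alpha> \<noteq> 0" using Re_cot_pos[OF \<alpha>] by (auto simp: z_def)
  let ?M = "restrict_space lborel {0::real<..}" and ?N = "restrict_space lborel {-1<..<1::real}"
  define f where "f x u = exp (- \<i> * of_real (x * u)) * eigen_weight (log_odds s) u * exp (- z * of_real x)" for x u
  have inner: "(\<integral>u. f x u \<partial>?N) = (LINT u:{-1<..<1}|lborel. exp (- \<i> * of_real (x * u)) *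
      eigen_weight (log_odds s) u) * exp (- z * of_real x)" for x
    by (simp add: f_def set_lebesgue_integral_eq_restrict_space)
  have "(LINT x:{0<..}|lborel. q_plus s x * exp (- z * of_real x)) = (\<integral>x. of_real (q_factor s) * (\<integral>u. f x u \<partial>?N) \<partial>?M)"
    by (subst set_lebesgue_integral_eq_restrict_space, simp) (simp only: q_plus_eq inner mult.assoc)
  also have "\<dots> = of_real (q_factor s) * (\<integral>x. \<integral>u. f x u \<partial>?N \<partial>?M)"
    by simp
  also have "(\<integral>x. \<integral>u. f x u \<partial>?N \<partial>?M) = (\<integral>u. \<integral>x. f x u \<partial>?M \<partial>?N)"
  proof (rule Fubini_dominated)
    show "case_prod f \<in> borel_measurable (?M \<Otimes>\<^sub>M ?N)"
      unfolding f_def case_prod_beta by (rule borel_measurable_pair_restrict_lborel) measurable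
    show "integrable ?M (\<lambda>x. exp (- Re z * x))"
      using exp_half_line_integrable[OF z] by (subst set_integrable_eq_restrict_space[symmetric]) auto
    show "integrable ?N (\<lambda>u. (1 - u\<^sup>2) powr (-1/2))"
      using arcsine_integrable by (subst set_integrable_eq_restrict_space[symmetric]) auto
    show "cmod (f x u) \<le> exp (- Re z * x) * (1 - u\<^sup>2) powr (-1/2)" for x u
      by (simp add: f_def norm_mult norm_eigen_weight)
  qed (simp_all add: sigma_finite_restrict_lborel)
  also have "\<dots> = (\<integral>u. sin \<alpha> * (eigen_weight (log_odds s) u / tilt \<alpha> u) \<partial>?N)"
  proof (rule Bochner_Integration.integral_cong [OF refl])
    fix u
    have "(\<integral>x. f x u \<partial>?M) = (\<integral>x. eigen_weight (log_odds s) u * exp (- (z + \<i> * of_real u) * of_real x) \<partial>?M)"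
      by (rule Bochner_Integration.integral_cong [OF refl]) (simp add: f_def algebra_simps exp_add[symmetric] flip: exp_add)
    also have "\<dots> = eigen_weight (log_odds s) u * (LINT x:{0<..}|lborel. exp (- (z + \<i> * of_real u) * of_real x))"
      by (simp add: set_lebesgue_integral_eq_restrict_space)
    also have "\<dots> = eigen_weight (log_odds s) u * (1 / (z + \<i> * of_real u))"
      using z by (subst cexp_half_line_integral) auto
    also have "z + \<i> * of_real u = tilt \<alpha> u / sin \<alpha>"
      using sin by (simp add: z_def tilt_def field_simps)
    finally show "(\<integral>x. f x u \<partial>?M) = sin \<alpha> * (eigen_weight (log_odds s) u / tilt \<alpha> u)" by simp
  qed
  also have "\<dots> = sin \<alpha> * tilted_integral (log_odds s) \<alpha>"
    by (simp add: tilted_integral_def set_lebesgue_integral_eq_restrict_space del: times_divide_eq_right)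
  also have "tilted_integral (log_odds s) \<alpha> = of_real (pi / cosh (pi * log_odds s)) * exp (- 2 * of_real (log_odds s) * \<alpha>)"
    using tilted_integral_shift[of \<alpha> "log_odds s"] \<alpha> unfolding tilted_integral_0
    by (simp add: exp_minus field_simps)
  finally show ?thesis
    unfolding laplace_kernel_def q_factor_cosh[OF s, symmetric] z_def by (simp add: mult_ac)
qed

section \<open>Coefficients of power series\<close>

text \<open>Removing the first m terms and dividing by q^m leaves a series whose limit at 0 is its
  constant term. Positive real q suffice, and an explicit sequence of points is used so that the
  same limit yields both uniqueness and measurability of coefficients.\<close>

lemma power_series_coeff_tendsto:
  fixes c :: "nat \<Rightarrow> complex"
  assumes r: "0 < r" and sums: "\<And>q. 0 < q \<Longrightarrow> q < r \<Longrightarrow> (\<lambda>n. c n * of_real q ^ n) sums G q"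
  shows "(\<lambda>j. (G (r / (real j + 2)) - (\<Sum>k<m. c k * of_real (r / (real j + 2)) ^ k)) /
     of_real (r / (real j + 2)) ^ m) \<longlonglongrightarrow> c m"
proof -
  define f where "f x = (\<Sum>n. c (n + m) * x ^ n)" for x :: complex
  have shift: "(\<lambda>n. c (n + m) * of_real q ^ n) sums ((G q - (\<Sum>k<m. c k * of_real q ^ k)) / of_real q ^ m)"
    if q: "0 < q" "q < r" for q
  proof -
    have "(\<lambda>n. c (n + m) * of_real q ^ (n + m)) sums (G q - (\<Sum>k<m. c k * of_real q ^ k))"
      using sums[OF q] sums_iff_shift[of "\<lambda>n. c n * of_real q ^ n" m "G q - (\<Sum>k<m. c k * of_real q ^ k)"]
      by (simp only: diff_add_cancel)
    from sums_divide[OF this, of "of_real q ^ m"]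
    have "(\<lambda>n. c (n + m) * of_real q ^ (n + m) / of_real q ^ m) sums ((G q - (\<Sum>k<m. c k * of_real q ^ k)) / of_real q ^ m)" .
    moreover have "c (n + m) * of_real q ^ (n + m) / of_real q ^ m = c (n + m) * of_real q ^ n" for n
      using q by (simp add: power_add)
    ultimately show ?thesis by (simp only:)
  qed
  have sm: "summable (\<lambda>n. c (n + m) * of_real (r/2) ^ n)"
    by (rule sums_summable[OF shift]) (use r in auto)
  have fs: "(\<lambda>n. c (n + m) * x ^ n) sums f x" if "norm x < r/2" for x
    unfolding f_def using that r
    by (intro summable_sums powser_inside[OF sm]) (simp add: norm_divide)
  have "(f \<longlongrightarrow> c (0 + m)) (at 0)"
    by (rule powser_limit_0[of "r/2" "\<lambda>n. c (n + m)" f, OF _ fs]) (use r in auto)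
  moreover have "filterlim (\<lambda>j. of_real (r / (real j + 2)) :: complex) (at 0) sequentially"
    unfolding filterlim_at
  proof
    have "(\<lambda>j. r / (real j + 2)) \<longlonglongrightarrow> 0" by real_asymp
    then have "(\<lambda>j. of_real (r / (real j + 2)) :: complex) \<longlonglongrightarrow> of_real 0" by (rule tendsto_of_real)
    then show "(\<lambda>j. of_real (r / (real j + 2)) :: complex) \<longlonglongrightarrow> 0" by simp
    have "0 < r / (real j + 2)" for j using r by (intro divide_pos_pos) auto
    then have "complex_of_real (r / (real j + 2)) \<noteq> 0" for j
      unfolding of_real_eq_0_iff by (metis less_irrefl)
    then show "\<forall>\<^sub>F j in sequentially. complex_of_real (r / (real j + 2)) \<in> UNIV \<and> complex_of_real (r / (real j + 2)) \<noteq> 0"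
      by (intro always_eventually allI conjI UNIV_I)
  qed
  ultimately have "(\<lambda>j. f (of_real (r / (real j + 2)))) \<longlonglongrightarrow> c m"
    using filterlim_compose by fastforce
  moreover have "f (of_real (r / (real j + 2))) = (G (r / (real j + 2)) - (\<Sum>k<m. c k * of_real (r / (real j + 2)) ^ k)) /
     of_real (r / (real j + 2)) ^ m" for j
  proof -
    have "0 < r / (real j + 2)" "r / (real j + 2) < r" using r by (auto simp: divide_simps)
    from sums_unique[OF shift[OF this]] show ?thesis by (simp add: f_def)
  qed
  ultimately show ?thesis by simp
qed

lemma power_series_coeff_unique:
  fixes c d :: "nat \<Rightarrow> complex"
  assumes r: "0 < r" and c: "\<And>q. 0 < q \<Longrightarrow> q < r \<Longrightarrow> (\<lambda>n. c n * of_real q ^ n) sums G q"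
    and d: "\<And>q. 0 < q \<Longrightarrow> q < r \<Longrightarrow> (\<lambda>n. d n * of_real q ^ n) sums G q"
  shows "c m = d m"
proof (induction m rule: less_induct)
  case (less m)
  then have "(\<Sum>k<m. c k * z ^ k) = (\<Sum>k<m. d k * z ^ k)" for z
    by (intro sum.cong) auto
  then show ?case
    using LIMSEQ_unique[OF power_series_coeff_tendsto[OF r c, of m] ] power_series_coeff_tendsto[OF r d, of m]
    by simp
qed

text \<open>Coefficients given by a definite description show no dependence on x that could be
  inspected. By induction each is a pointwise limit of expressions in the generating function and
  the lower coefficients.\<close>

lemma power_series_coeff_measurable:
  fixes c :: "nat \<Rightarrow> 'a \<Rightarrow> complex"
  assumes r: "0 < r"
    and sums: "\<And>q x. 0 < q \<Longrightarrow> q < r \<Longrightarrow> x \<in> space M \<Longrightarrow> (\<lambda>n. c n x * of_real q ^ n) sums G q x"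
    and G: "\<And>q. 0 < q \<Longrightarrow> q < r \<Longrightarrow> G q \<in> borel_measurable M"
  shows "c m \<in> borel_measurable M"
proof (induction m rule: less_induct)
  case (less m)
  have q: "0 < r / (real j + 2)" "r / (real j + 2) < r" for j
    using r by (auto simp: divide_simps)
  show ?case
  proof (rule borel_measurable_LIMSEQ_metric)
    show "(\<lambda>x. (G (r / (real j + 2)) x - (\<Sum>k<m. c k x * of_real (r / (real j + 2)) ^ k)) /
       of_real (r / (real j + 2)) ^ m) \<in> borel_measurable M" for j
      using less G[OF q] by (intro borel_measurable_divide borel_measurable_diff borel_measurable_sum borel_measurable_times) auto
    show "(\<lambda>j. (G (r / (real j + 2)) x - (\<Sum>k<m. c k x * of_real (r / (real j + 2)) ^ k)) /
       of_real (r / (real j + 2)) ^ m) \<longlonglongrightarrow> c m x" if "x \<in> space M" for x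
      using power_series_coeff_tendsto[of r "\<lambda>n. c n x" "\<lambda>q. G q x" m] r sums that by blast
  qed
qed

text \<open>Cauchy's inequality on the circle of radius r. The circle is fixed once for all n, so
  that parameters of G enter the estimate only through B.\<close>

lemma power_series_coeff_bound:
  fixes c :: "nat \<Rightarrow> complex"
  assumes sums: "\<And>q. cmod q < 1 \<Longrightarrow> (\<lambda>n. c n * q ^ n) sums G q"
    and r: "0 < r" "r < 1" and B: "\<And>q. cmod q = r \<Longrightarrow> cmod (G q) \<le> B"
  shows "cmod (c n) \<le> B / r ^ n"
proof -
  have hol: "G holomorphic_on ball 0 1"
    by (rule power_series_holomorphic[where a = c]) (use sums in auto)
  have "(\<lambda>n. (deriv ^^ n) G 0 / fact n * q ^ n) sums G q" if "cmod q < 1" for q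
    using holomorphic_power_series[OF hol, of q] that by simp
  then have "c n = (deriv ^^ n) G 0 / fact n"
    using sums by (intro power_series_coeff_unique[where r = 1 and G = "\<lambda>q. G (of_real q)"]) auto
  moreover have "cmod ((deriv ^^ n) G 0) \<le> fact n * B / r ^ n"
  proof (rule Cauchy_inequality)
    show "G holomorphic_on ball 0 r" using r by (intro holomorphic_on_subset[OF hol]) auto
    show "continuous_on (cball 0 r) G"
      using r by (intro holomorphic_on_imp_continuous_on holomorphic_on_subset[OF hol]) auto
  qed (use r B in auto)
  ultimately show ?thesis
    using divide_right_mono[of "cmod ((deriv ^^ n) G 0)" "fact n * B / r ^ n" "fact n"] by (simp add: norm_divide)
qed

text \<open>The majorant leaves a geometric factor (q / r)^n, so that sum and integral commute for
  every q below r.\<close>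

lemma power_series_coeff_integral:
  fixes c :: "nat \<Rightarrow> 'a \<Rightarrow> complex"
  assumes r: "0 < r"
    and sums: "\<And>q x. 0 < q \<Longrightarrow> q < r \<Longrightarrow> x \<in> space M \<Longrightarrow> (\<lambda>n. c n x * of_real q ^ n) sums G q x"
    and c [measurable]: "\<And>n. c n \<in> borel_measurable M"
    and B: "integrable M B" "\<And>n x. x \<in> space M \<Longrightarrow> cmod (c n x) \<le> B x / r ^ n"
  shows "integrable M (c n)"
    and "0 < q \<Longrightarrow> q < r \<Longrightarrow> (\<lambda>n. (\<integral>x. c n x \<partial>M) * of_real q ^ n) sums (\<integral>x. G q x \<partial>M)"
proof -
  have int: "integrable M (c n)" for n
  proof (rule Bochner_Integration.integrable_bound)
    show "integrable M (\<lambda>x. B x / r ^ n)" using B(1) by simp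
    show "AE x in M. norm (c n x) \<le> norm (B x / r ^ n)"
      unfolding real_norm_def by (intro AE_I2 order.trans[OF B(2) abs_ge_self])
  qed simp
  then show "integrable M (c n)" .
  show "(\<lambda>n. (\<integral>x. c n x \<partial>M) * of_real q ^ n) sums (\<integral>x. G q x \<partial>M)" if q: "0 < q" "q < r"
  proof -
    define t where "t = q / r"
    have t: "0 < t" "t < 1" using q r by (auto simp: t_def)
    have bound: "cmod (c n x * of_real q ^ n) \<le> B x * t ^ n" if "x \<in> space M" for n x
      using mult_right_mono[OF B(2)[OF that], of "q ^ n"] q r
      by (simp add: norm_mult norm_power t_def power_divide)
    have sm: "summable (\<lambda>n. C * t ^ n)" for C
      using t by (intro summable_mult summable_geometric) auto
    have "(\<lambda>n. \<integral>x. c n x * of_real q ^ n \<partial>M) sums (\<integral>x. (\<Sum>n. c n x * of_real q ^ n) \<partial>M)"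
    proof (rule sums_integral)
      show "AE x in M. summable (\<lambda>n. norm (c n x * of_real q ^ n))"
        using bound by (intro AE_I2 summable_comparison_test'[OF sm]) auto
      show "summable (\<lambda>n. \<integral>x. norm (c n x * of_real q ^ n) \<partial>M)"
      proof (rule summable_comparison_test'[OF sm[of "\<integral>x. B x \<partial>M"]])
        fix n
        have "(\<integral>x. norm (c n x * of_real q ^ n) \<partial>M) \<le> (\<integral>x. B x * t ^ n \<partial>M)"
          using int B(1) bound by (intro integral_mono) auto
        then show "norm (\<integral>x. norm (c n x * of_real q ^ n) \<partial>M) \<le> (\<integral>x. B x \<partial>M) * t ^ n"
          by simp
      qed
    qed (use int in auto)
    also have "(\<integral>x. (\<Sum>n. c n x * of_real q ^ n) \<partial>M) = (\<integral>x. G q x \<partial>M)"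
      using sums[OF q] by (intro Bochner_Integration.integral_cong) (auto simp: sums_iff)
    finally show ?thesis by simp
  qed
qed

section \<open>The generating functions\<close>

text \<open>Cauchy's inequality on |q| = 1/2. There |1 - q| \<ge> 1/2 gives the factor 2, and (1 +
  q) / (1 - q) has real part at least (1 - 1/2) / (1 + 1/2) = 1/3, half of which is the decay rate
  1/6.\<close>

lemma norm_laguerre_fun_le:
  assumes "x \<ge> 0"
  shows "cmod (laguerre_fun n x) \<le> 2 * exp (- (x / 6)) / (1/2) ^ n"
proof (rule power_series_coeff_bound)
  show "(\<lambda>n. laguerre_fun n x * q ^ n) sums (exp (- (1/2) * ((1 + q) / (1 - q)) * of_real x) / (1 - q))"
    if "cmod q < 1" for q
    using laguerre_fun_sums[OF that] .
  fix q :: complex assume q: "cmod q = 1/2"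
  define w where "w = 1 - q"
  have w: "cmod w \<ge> 1/2"
    using norm_triangle_ineq2[of 1 q] q by (simp add: w_def)
  then have nz: "w \<noteq> 0" by auto
  have "(Re q)\<^sup>2 + (Im q)\<^sup>2 = 1/4"
    unfolding cmod_power2[symmetric] q by (simp add: power2_eq_square)
  \<comment> \<open>On this circle |w|^2 is affine in Re w, so the claim 2 Re w / |w|^2 \<ge> 4/3
    amounts to Re w \<le> 3/2.\<close>
  then have w2: "(cmod w)\<^sup>2 = 2 * Re w - 3/4"
    unfolding cmod_power2 w_def by (simp add: power2_eq_square algebra_simps)
  have "Re w \<le> 3/2"
    using complex_Re_le_cmod[of "- q"] q by (simp add: w_def)
  then have "2 * Re w / (cmod w)\<^sup>2 \<ge> 4/3"
    using w2 nz by (simp add: divide_simps)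
  moreover have "(1 + q) / (1 - q) = 2 / w - 1"
    using nz by (simp add: w_def field_simps)
  moreover have "Re (2 / w) = 2 * Re w / (cmod w)\<^sup>2"
    unfolding Re_divide' by simp
  ultimately have le: "1/3 \<le> Re ((1 + q) / (1 - q))" by simp
  have "Re (- (1/2) * X * of_real x) = - (Re X * x) / 2" for X by simp
  then have "exp (Re (- (1/2) * ((1 + q) / (1 - q)) * of_real x)) \<le> exp (- (x / 6))"
    using mult_right_mono[OF le assms] by (simp only: exp_le_cancel_iff)
  then have "exp (Re (- (1/2) * ((1 + q) / (1 - q)) * of_real x)) / cmod w \<le> exp (- (x / 6)) / (1/2)"
    using w by (intro frac_le) auto
  then show "cmod (exp (- (1/2) * ((1 + q) / (1 - q)) * of_real x) / (1 - q)) \<le> 2 * exp (- (x / 6))"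
    by (simp only: norm_divide norm_exp_eq_Re w_def divide_divide_eq_right div_by_1 mult.commute)
qed auto

section \<open>The angle behind the generating function of the
  \<open>h_fun \<beta> n\<close>\<close>

definition h_factor :: "real \<Rightarrow> real \<Rightarrow> real" where
  "h_factor \<beta> s = (sin \<beta> / pi) powr (1/2) * (1/s - 1) powr (\<beta> / (2 * pi)) * (1 - s) powr (-1/2)"

lemma h_fun_eq: "h_fun \<beta> n s = of_real (h_factor \<beta> s) * meixner_pollaczek n (log_odds s) \<beta>"
  by (simp add: h_fun_def h_factor_def log_odds_def)

lemma powr_log_odds:
  assumes "0 < s" "s < 1"
  shows "(1/s - 1) powr a = exp (2 * pi * a * log_odds s)"
  using assms by (simp add: powr_def log_odds_def)

text \<open>Read off from the generating function: with \<mu> = \<open>log_odds s\<close> and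
  \<theta> the argument of 1 - q e^(i \<beta>), its dependence on \<mu>, apart from the power
  s^(-1/2), is exp (\<beta> \<mu>) exp (- \<pi> \<mu>) exp (- 2 \<mu> \<theta>). This equals exp (-
  2 \<mu> \<alpha>) for the angle \<alpha> defined here.\<close>

definition gen_angle :: "real \<Rightarrow> real \<Rightarrow> real" where
  "gen_angle \<beta> q = pi/2 - \<beta>/2 + Im (Ln (1 - of_real q * cis \<beta>))"

lemma Re_one_minus_pos: "cmod z < 1 \<Longrightarrow> Re (1 - z) > 0"
  using complex_Re_le_cmod[of z] by simp

lemma laplace_kernel_real:
  "laplace_kernel (of_real \<alpha>) s =
     of_real (pi powr (-1/2) * s powr (-1/2) * (sin \<alpha> * exp (- 2 * log_odds s * \<alpha>)))"
proof -
  have "exp (- 2 * of_real (log_odds s) * of_real \<alpha>) = complex_of_real (exp (- 2 * log_odds s * \<alpha>))"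
    by (simp flip: exp_of_real)
  then show ?thesis
    unfolding laplace_kernel_def sin_of_real by (simp only: of_real_mult)
qed

context
  fixes \<beta> :: real
  assumes \<beta>: "0 < \<beta>" "\<beta> < pi" "tan (\<beta> / 2) = 1 / 2"
begin

text \<open>The condition tan (\<beta>/2) = 1/2 makes sin \<beta> = 2 sin (\<beta>/2) cos
  (\<beta>/2) a perfect square, so the normalising factor (sin \<beta>)^(1/2) is just cos
  (\<beta>/2).\<close>

lemma cos_half_angle: "cos (\<beta>/2) > 0" "sin (\<beta>/2) = cos (\<beta>/2) / 2" "sin \<beta> = (cos (\<beta>/2))\<^sup>2"
proof -
  show c: "cos (\<beta>/2) > 0" using \<beta> by (intro cos_gt_zero) auto
  show s: "sin (\<beta>/2) = cos (\<beta>/2) / 2" using \<beta>(3) c by (simp add: tan_def field_simps)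
  have "sin \<beta> = 2 * sin (\<beta>/2) * cos (\<beta>/2)" using sin_double[of "\<beta>/2"] by simp
  then show "sin \<beta> = (cos (\<beta>/2))\<^sup>2" unfolding s by (simp add: power2_eq_square)
qed

text \<open>Rotating w = 1 - q e^(i \<beta>) by - \<beta>/2 gives e^(- i \<beta>/2) - q e^(i
  \<beta>/2), with real part (1 - q) cos (\<beta>/2) and imaginary part - (1 + q) sin (\<beta>/2).
  In polar form the same number is |w| (sin \<alpha> - i cos \<alpha>), where \<alpha> is the angle
  in question.\<close>

lemma gen_angle:
  assumes q: "0 < q" "q < 1"
  shows "0 < gen_angle \<beta> q" "gen_angle \<beta> q < pi/2"
    and "cmod (1 - of_real q * cis \<beta>) * sin (gen_angle \<beta> q) = (1 - q) * cos (\<beta>/2)"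
    and "cmod (1 - of_real q * cis \<beta>) * cos (gen_angle \<beta> q) = (1 + q) * sin (\<beta>/2)"
proof -
  define w where "w = 1 - of_real q * cis \<beta>"
  define \<theta> where "\<theta> = Im (Ln w)"
  define R where "R = cmod w"
  have "Re w > 0" unfolding w_def using q by (intro Re_one_minus_pos) (simp add: norm_mult)
  then have w: "w \<noteq> 0" by auto
  have \<theta>: "\<bar>\<theta>\<bar> < pi/2"
    using Re_Ln_pos_lt[OF w] \<open>Re w > 0\<close> by (simp add: \<theta>_def)
  have R: "R > 0" using w by (simp add: R_def)
  have "w = of_real R * cis \<theta>"
    using exp_eq_polar[of "Ln w"] w by (simp add: R_def \<theta>_def Re_Ln)
  then have "Re w = R * cos \<theta>" "Im w = R * sin \<theta>" by simp_all
  then have Rc: "R * cos \<theta> = 1 - q * cos \<beta>" "R * sin \<theta> = - q * sin \<beta>"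
    by (simp_all add: w_def)
  have a: "gen_angle \<beta> q = pi/2 - (\<beta>/2 - \<theta>)" by (simp add: gen_angle_def \<theta>_def w_def)
  have co: "sin (pi/2 - t) = cos t" "cos (pi/2 - t) = sin t" for t :: real
    by (simp_all add: sin_diff cos_diff)
  have "R * sin (gen_angle \<beta> q) = R * cos \<theta> * cos (\<beta>/2) + R * sin \<theta> * sin (\<beta>/2)"
    unfolding a co(1) by (simp add: cos_diff algebra_simps)
  also have "\<dots> = cos (\<beta>/2) - q * (cos \<beta> * cos (\<beta>/2) + sin \<beta> * sin (\<beta>/2))"
    unfolding Rc by (simp add: algebra_simps)
  also have "cos \<beta> * cos (\<beta>/2) + sin \<beta> * sin (\<beta>/2) = cos (\<beta>/2)"
    using cos_diff[of \<beta> "\<beta>/2"] by simp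
  finally show 1: "cmod (1 - of_real q * cis \<beta>) * sin (gen_angle \<beta> q) = (1 - q) * cos (\<beta>/2)"
    by (simp add: R_def w_def algebra_simps)
  have "R * cos (gen_angle \<beta> q) = R * cos \<theta> * sin (\<beta>/2) - R * sin \<theta> * cos (\<beta>/2)"
    unfolding a co(2) by (simp add: sin_diff algebra_simps)
  also have "\<dots> = sin (\<beta>/2) + q * (sin \<beta> * cos (\<beta>/2) - cos \<beta> * sin (\<beta>/2))"
    unfolding Rc by (simp add: algebra_simps)
  also have "sin \<beta> * cos (\<beta>/2) - cos \<beta> * sin (\<beta>/2) = sin (\<beta>/2)"
    using sin_diff[of \<beta> "\<beta>/2"] by simp
  finally show 2: "cmod (1 - of_real q * cis \<beta>) * cos (gen_angle \<beta> q) = (1 + q) * sin (\<beta>/2)"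
    by (simp add: R_def w_def algebra_simps)
  have pos: "sin (gen_angle \<beta> q) > 0" "cos (gen_angle \<beta> q) > 0"
  proof -
    have "R * sin (gen_angle \<beta> q) > 0" "R * cos (gen_angle \<beta> q) > 0"
      unfolding R_def w_def 1 2 using q cos_half_angle(1,2) by simp_all
    then show "sin (gen_angle \<beta> q) > 0" "cos (gen_angle \<beta> q) > 0"
      using R by (simp_all add: zero_less_mult_iff)
  qed
  \<comment> \<open>A crude range from the bounds on \<beta> and \<theta>; positive sine and cosine
    then leave only the first quadrant.\<close>
  have range: "- (pi/2) < gen_angle \<beta> q" "gen_angle \<beta> q < pi"
    using \<beta> \<theta> by (auto simp: a)
  show "0 < gen_angle \<beta> q"
  proof (rule ccontr)
    assume "\<not> 0 < gen_angle \<beta> q"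
    then have "0 \<le> sin (- gen_angle \<beta> q)" using range by (intro sin_ge_zero) auto
    then show False using pos by simp
  qed
  show "gen_angle \<beta> q < pi/2"
  proof (rule ccontr)
    assume "\<not> gen_angle \<beta> q < pi/2"
    then have "0 \<le> sin (gen_angle \<beta> q - pi/2)" using range by (intro sin_ge_zero) auto
    then show False using pos by (simp add: sin_diff)
  qed
qed

lemma cot_gen_angle:
  assumes q: "0 < q" "q < 1"
  shows "cos (gen_angle \<beta> q) / sin (gen_angle \<beta> q) = (1 + q) / (1 - q) / 2"
proof -
  note g = gen_angle[OF q]
  have s: "sin (gen_angle \<beta> q) > 0" using g(1,2) by (intro sin_gt_zero) auto
  have "cmod (1 - of_real q * cis \<beta>) \<noteq> 0" using g(3) q cos_half_angle(1) by (metis diff_gt_0_iff_gt mult_pos_pos mult_zero_left less_irrefl)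
  then have "cos (gen_angle \<beta> q) / sin (gen_angle \<beta> q) = ((1 + q) * sin (\<beta>/2)) / ((1 - q) * cos (\<beta>/2))"
    unfolding g(3,4)[symmetric] by simp
  also have "\<dots> = (1 + q) / (1 - q) / 2"
    unfolding cos_half_angle(2) using cos_half_angle(1) q by (simp add: field_simps)
  finally show ?thesis .
qed

lemma laguerre_fun_sums_real:
  assumes q: "0 < q" "q < 1"
  shows "(\<lambda>n. laguerre_fun n x * of_real q ^ n) sums
     (exp (- of_real (cos (gen_angle \<beta> q) / sin (gen_angle \<beta> q)) * of_real x) / of_real (1 - q))"
proof -
  have "- (1/2) * ((1 + of_real q) / (1 - of_real q)) * complex_of_real x = - of_real ((1 + q) / (1 - q) / 2) * of_real x"
    by simp
  moreover have "cmod (of_real q) < 1" using q by simp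
  ultimately show ?thesis
    unfolding cot_gen_angle[OF q] using laguerre_fun_sums[of "of_real q" x]
    by (simp only: of_real_diff of_real_1)
qed

lemma h_fun_sums_real:
  assumes q: "0 < q" "q < 1" and s: "0 < s" "s < 1"
  shows "(\<lambda>n. h_fun \<beta> n s * of_real q ^ n) sums (laplace_kernel (of_real (gen_angle \<beta> q)) s / of_real (1 - q))"
proof -
  define \<mu> where "\<mu> = log_odds s"
  define w where "w = 1 - of_real q * cis \<beta>"
  define \<theta> where "\<theta> = Im (Ln w)"
  define R where "R = cmod w"
  define \<alpha> where "\<alpha> = gen_angle \<beta> q"
  have "Re w > 0" unfolding w_def using q by (intro Re_one_minus_pos) (simp add: norm_mult)
  then have w: "w \<noteq> 0" "w \<notin> \<real>\<^sub>\<le>\<^sub>0" by (auto simp: complex_nonpos_Reals_iff)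
  have R: "R > 0" using w by (simp add: R_def)
  have cw: "1 - of_real q * exp (- \<i> * of_real \<beta>) = cnj w"
    by (simp add: w_def cis_cnj cis_conv_exp exp_cnj)
  have ww: "1 - of_real q * exp (\<i> * of_real \<beta>) = w" by (simp add: w_def cis_conv_exp)
  \<comment> \<open>For real q the two bases are conjugate and so are the two exponents, hence the
    product of the powers is the exponential of a real number, namely exp (- 2 \<mu> \<theta>) /
    |w|.\<close>
  have "w powr (-1/2 + \<i> * of_real \<mu>) * cnj w powr (-1/2 - \<i> * of_real \<mu>)
       = exp ((-1/2 + \<i> * of_real \<mu>) * Ln w + (-1/2 - \<i> * of_real \<mu>) * cnj (Ln w))"
    using w by (simp add: powr_def cnj_Ln exp_add)
  also have "(-1/2 + \<i> * of_real \<mu>) * Ln w + (-1/2 - \<i> * of_real \<mu>) * cnj (Ln w) = of_real (- ln R - 2 * \<mu> * \<theta>)"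
    using w by (simp add: complex_eq_iff \<theta>_def R_def Re_Ln)
  also have "exp (of_real (- ln R - 2 * \<mu> * \<theta>)) = complex_of_real (exp (- 2 * \<mu> * \<theta>) / R)"
  proof -
    have "exp (- ln R - 2 * \<mu> * \<theta>) = exp (- 2 * \<mu> * \<theta>) / R"
      using R by (simp add: exp_diff exp_minus field_simps)
    then show ?thesis by (simp only: exp_of_real)
  qed
  finally have G: "w powr (-1/2 + \<i> * of_real \<mu>) * cnj w powr (-1/2 - \<i> * of_real \<mu>) = of_real (exp (- 2 * \<mu> * \<theta>) / R)" .
  have "h_factor \<beta> s * (exp (- 2 * \<mu> * \<theta>) / R) =
        pi powr (-1/2) * s powr (-1/2) * (sin \<alpha> * exp (- 2 * \<mu> * \<alpha>)) / (1 - q)"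
  proof -
    have "(sin \<beta> / pi) powr (1/2) = cos (\<beta>/2) * pi powr (-1/2)"
    proof -
      have "(sin \<beta> / pi) powr (1/2) = cos (\<beta>/2) / sqrt pi"
        unfolding cos_half_angle(3) using cos_half_angle(1) by (simp add: powr_half_sqrt real_sqrt_divide)
      also have "1 / sqrt pi = pi powr (-1/2)"
        by (simp add: powr_half_sqrt powr_minus_divide)
      then have "cos (\<beta>/2) / sqrt pi = cos (\<beta>/2) * pi powr (-1/2)"
        by (metis mult.right_neutral times_divide_eq_right)
      finally show ?thesis .
    qed
    moreover have "(1/s - 1) powr (\<beta> / (2 * pi)) = exp (\<mu> * \<beta>)"
      unfolding powr_log_odds[OF s] \<mu>_def by (simp add: mult.commute)
    moreover have "(1 - s) powr (-1/2) = s powr (-1/2) * exp (- pi * \<mu>)"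
    proof -
      have "exp (- pi * \<mu>) = (1/s - 1) powr (-1/2)"
        unfolding powr_log_odds[OF s] \<mu>_def by simp
      also have "1/s - 1 = (1 - s) / s" using s by (simp add: field_simps)
      finally show ?thesis using s by (simp add: powr_divide)
    qed
    ultimately have A: "h_factor \<beta> s = pi powr (-1/2) * s powr (-1/2) * cos (\<beta>/2) * (exp (\<mu> * \<beta>) * exp (- pi * \<mu>))"
      unfolding h_factor_def by simp
    have B: "exp (\<mu> * \<beta>) * exp (- pi * \<mu>) * exp (- 2 * \<mu> * \<theta>) = exp (- 2 * \<mu> * \<alpha>)"
      unfolding exp_add[symmetric] by (rule arg_cong[of _ _ exp]) (simp add: \<alpha>_def gen_angle_def \<theta>_def w_def algebra_simps)
    \<comment> \<open>The sine identity for the angle: the modulus of w converts the amplitude cos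
      (\<beta>/2) into sin \<alpha> and produces the factor 1 / (1 - q).\<close>
    have D: "cos (\<beta>/2) / R = sin \<alpha> / (1 - q)"
      using gen_angle(3)[OF q] R q by (simp add: \<alpha>_def R_def w_def field_simps)
    have "h_factor \<beta> s * (exp (- 2 * \<mu> * \<theta>) / R) = pi powr (-1/2) * s powr (-1/2) * (cos (\<beta>/2) / R) *
       (exp (\<mu> * \<beta>) * exp (- pi * \<mu>) * exp (- 2 * \<mu> * \<theta>))"
      unfolding A by (simp only: times_divide_eq_right times_divide_eq_left mult_ac)
    then show ?thesis unfolding B D by (simp only: times_divide_eq_right times_divide_eq_left mult_ac)
  qed
  then have "of_real (h_factor \<beta> s) * (of_real (exp (- 2 * \<mu> * \<theta>) / R)) = laplace_kernel (of_real \<alpha>) s / of_real (1 - q)"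
    unfolding laplace_kernel_real \<mu>_def[symmetric]
    by (simp only: flip: of_real_mult of_real_divide)
  moreover have "(\<lambda>n. of_real (h_factor \<beta> s) * (meixner_pollaczek n \<mu> \<beta> * of_real q ^ n)) sums
       (of_real (h_factor \<beta> s) * (of_real (exp (- 2 * \<mu> * \<theta>) / R)))"
    unfolding G[symmetric] using meixner_pollaczek_sums[of "of_real q" \<mu> \<beta>] q
    unfolding ww cw by (intro sums_mult) simp
  ultimately show ?thesis
    by (simp add: h_fun_eq \<mu>_def \<alpha>_def mult.assoc)
qed

end

section \<open>The Beta integral and inner products of the Laplace kernels\<close>

text \<open>Euler's reflection formula for the Gamma function. Convergence at s = 0 is due to b < 1,
  at s = 1 to b > 0.\<close>

lemma beta_integral:
  fixes b :: real
  assumes "0 < b" "b < 1"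
  shows "set_integrable lborel {0<..<1} (\<lambda>s. s powr (- b) * (1 - s) powr (b - 1))"
    and "(LINT s:{0<..<1}|lborel. s powr (- b) * (1 - s) powr (b - 1)) = pi / sin (pi * b)"
proof -
  let ?f = "\<lambda>s. s powr (- b) * (1 - s) powr (b - 1)"
  have "set_integrable lborel {0..1} ?f"
    using integrable_Beta[of "1 - b" b] assms by simp
  then show int: "set_integrable lborel {0<..<1} ?f"
    by (rule set_integrable_subset) auto
  have "(?f has_integral Beta (1 - b) b) {0..1}"
    using has_integral_Beta_real[of "1 - b" b] assms by simp
  then have "integral {0<..<1} ?f = Beta (1 - b) b"
    by (simp add: has_integral_Icc_iff_Ioo integral_unique)
  then have "(LINT s:{0<..<1}|lborel. ?f s) = Beta (1 - b) b"
    using set_borel_integral_eq_integral(2)[OF int] by simp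
  also have "Beta (1 - b) b = pi / sin (pi * b)"
  proof -
    have "complex_of_real (Gamma b * Gamma (1 - b)) = of_real (pi / sin (pi * b))"
    proof -
      have "1 - complex_of_real b = of_real (1 - b)" by simp
      then show ?thesis
        using Gamma_reflection_complex[of "of_real b"]
        by (simp only: Gamma_complex_of_real sin_of_real flip: of_real_mult of_real_divide)
    qed
    then have "Gamma b * Gamma (1 - b) = pi / sin (pi * b)" by (simp only: of_real_eq_iff)
    then show ?thesis by (simp add: Beta_def mult.commute)
  qed
  finally show "(LINT s:{0<..<1}|lborel. ?f s) = pi / sin (pi * b)" .
qed

lemma laplace_kernel_mult_real:
  assumes s: "0 < s" "s < 1"
  shows "laplace_kernel (of_real \<alpha>) s * laplace_kernel (of_real \<gamma>) s =
    of_real (sin \<alpha> * sin \<gamma> / pi * (s powr (- (1 - (\<alpha> + \<gamma>) / pi)) * (1 - s) powr ((1 - (\<alpha> + \<gamma>) / pi) - 1)))"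
proof -
  define \<mu> where "\<mu> = log_odds s"
  have K1: "pi powr (-1/2) * pi powr (-1/2) = 1 / pi"
    by (simp add: powr_minus_divide flip: powr_add)
  have K2: "s powr (-1/2) * s powr (-1/2) * (exp (- 2 * \<mu> * \<alpha>) * exp (- 2 * \<mu> * \<gamma>)) =
     s powr (- (1 - (\<alpha> + \<gamma>) / pi)) * (1 - s) powr ((1 - (\<alpha> + \<gamma>) / pi) - 1)"
  proof -
    have "exp (- 2 * \<mu> * \<alpha>) * exp (- 2 * \<mu> * \<gamma>) = (1/s - 1) powr (- ((\<alpha> + \<gamma>) / pi))"
      unfolding powr_log_odds[OF s] \<mu>_def exp_add[symmetric] by (simp add: field_simps)
    also have "1/s - 1 = (1 - s) / s" using s by (simp add: field_simps)
    also have "((1 - s) / s) powr (- ((\<alpha> + \<gamma>) / pi)) = (1 - s) powr (- ((\<alpha> + \<gamma>) / pi)) * s powr ((\<alpha> + \<gamma>) / pi)"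
      using s by (simp add: powr_divide powr_minus field_simps)
    finally have e: "exp (- 2 * \<mu> * \<alpha>) * exp (- 2 * \<mu> * \<gamma>) = (1 - s) powr (- ((\<alpha> + \<gamma>) / pi)) * s powr ((\<alpha> + \<gamma>) / pi)" .
    have "s powr (-1/2) * s powr (-1/2) * s powr ((\<alpha> + \<gamma>) / pi) = s powr (- (1 - (\<alpha> + \<gamma>) / pi))"
      unfolding powr_add[symmetric] by (rule arg_cong[of _ _ "\<lambda>t. s powr t"]) simp
    then show ?thesis unfolding e by (simp add: mult_ac)
  qed
  have "(pi powr (-1/2) * s powr (-1/2) * (sin \<alpha> * exp (- 2 * \<mu> * \<alpha>))) *
     (pi powr (-1/2) * s powr (-1/2) * (sin \<gamma> * exp (- 2 * \<mu> * \<gamma>))) =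
     sin \<alpha> * sin \<gamma> * (pi powr (-1/2) * pi powr (-1/2)) *
       (s powr (-1/2) * s powr (-1/2) * (exp (- 2 * \<mu> * \<alpha>) * exp (- 2 * \<mu> * \<gamma>)))"
    by (simp only: mult_ac)
  also have "\<dots> = sin \<alpha> * sin \<gamma> / pi * (s powr (- (1 - (\<alpha> + \<gamma>) / pi)) * (1 - s) powr ((1 - (\<alpha> + \<gamma>) / pi) - 1))"
    unfolding K1 K2 by simp
  finally have *: "(pi powr (-1/2) * s powr (-1/2) * (sin \<alpha> * exp (- 2 * \<mu> * \<alpha>))) *
     (pi powr (-1/2) * s powr (-1/2) * (sin \<gamma> * exp (- 2 * \<mu> * \<gamma>))) =
     sin \<alpha> * sin \<gamma> / pi * (s powr (- (1 - (\<alpha> + \<gamma>) / pi)) * (1 - s) powr ((1 - (\<alpha> + \<gamma>) / pi) - 1))" .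
  show ?thesis
    unfolding *[symmetric] laplace_kernel_real \<mu>_def by (simp only: of_real_mult)
qed

text \<open>The Beta integral at b = 1 - (\<alpha> + \<gamma>) / \<pi> yields \<pi> / sin (\<alpha>
  + \<gamma>), and sin (\<alpha> + \<gamma>) / (sin \<alpha> sin \<gamma>) = cot \<alpha> + cot
  \<gamma>. The result is also the integral of the product of the two exponentials with rates cot
  \<alpha> and cot \<gamma>, which is the preservation of inner products.\<close>

lemma laplace_kernel_gram:
  assumes \<alpha>: "0 < \<alpha>" "\<alpha> < pi/2" and \<gamma>: "0 < \<gamma>" "\<gamma> < pi/2"
  shows "integrable unit_interval (\<lambda>s. laplace_kernel (of_real \<alpha>) s * laplace_kernel (of_real \<gamma>) s)"
    and "(\<integral>s. laplace_kernel (of_real \<alpha>) s * laplace_kernel (of_real \<gamma>) s \<partial>unit_interval) =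
       of_real (1 / (cos \<alpha> / sin \<alpha> + cos \<gamma> / sin \<gamma>))"
proof -
  define b where "b = 1 - (\<alpha> + \<gamma>) / pi"
  have b: "0 < b" "b < 1" using assms by (auto simp: b_def divide_simps)
  let ?f = "\<lambda>s. s powr (- b) * (1 - s) powr (b - 1)"
  have eq: "laplace_kernel (of_real \<alpha>) s * laplace_kernel (of_real \<gamma>) s = of_real (sin \<alpha> * sin \<gamma> / pi * ?f s)"
    if "s \<in> space unit_interval" for s
    unfolding b_def using that by (intro laplace_kernel_mult_real) (auto simp: space_restrict_space)
  have int: "integrable unit_interval ?f"
    using beta_integral(1)[OF b] by (subst set_integrable_eq_restrict_space[symmetric]) auto
  then have "integrable unit_interval (\<lambda>s. complex_of_real (sin \<alpha> * sin \<gamma> / pi * ?f s))"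
    by (intro integrable_of_real integrable_mult_right)
  then show "integrable unit_interval (\<lambda>s. laplace_kernel (of_real \<alpha>) s * laplace_kernel (of_real \<gamma>) s)"
    using eq by (subst Bochner_Integration.integrable_cong[OF refl eq]) auto
  have "(\<integral>s. laplace_kernel (of_real \<alpha>) s * laplace_kernel (of_real \<gamma>) s \<partial>unit_interval) =
     (\<integral>s. complex_of_real (sin \<alpha> * sin \<gamma> / pi * ?f s) \<partial>unit_interval)"
    by (rule Bochner_Integration.integral_cong[OF refl eq])
  also have "\<dots> = of_real (sin \<alpha> * sin \<gamma> / pi * (\<integral>s. ?f s \<partial>unit_interval))"
    by (simp only: integral_complex_of_real integral_mult_right_zero)
  also have "(\<integral>s. ?f s \<partial>unit_interval) = (LINT s:{0<..<1}|lborel. ?f s)"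
    unfolding set_lebesgue_integral_def by (subst integral_restrict_space) auto
  also have "\<dots> = pi / sin (pi * b)" by (rule beta_integral(2)[OF b])
  also have "pi * b = pi - (\<alpha> + \<gamma>)" by (simp add: b_def field_simps)
  also have "sin \<alpha> * sin \<gamma> / pi * (pi / sin (pi - (\<alpha> + \<gamma>))) = 1 / (cos \<alpha> / sin \<alpha> + cos \<gamma> / sin \<gamma>)"
  proof -
    have "sin \<alpha> > 0" "sin \<gamma> > 0" "sin (\<alpha> + \<gamma>) > 0" using assms by (auto intro!: sin_gt_zero)
    then show ?thesis by (simp add: sin_diff sin_add divide_simps) (simp add: algebra_simps)
  qed
  finally show "(\<integral>s. laplace_kernel (of_real \<alpha>) s * laplace_kernel (of_real \<gamma>) s \<partial>unit_interval) =
       of_real (1 / (cos \<alpha> / sin \<alpha> + cos \<gamma> / sin \<gamma>))" .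
qed

section \<open>Measurability, and majorants uniform in n\<close>

lemma log_odds_measurable [measurable (raw)]:
  assumes [measurable]: "f \<in> borel_measurable M"
  shows "(\<lambda>x. log_odds (f x)) \<in> borel_measurable M"
  unfolding log_odds_def by measurable

lemma laplace_kernel_measurable [measurable (raw)]:
  assumes [measurable]: "f \<in> borel_measurable M"
  shows "(\<lambda>x. laplace_kernel \<alpha> (f x)) \<in> borel_measurable M"
  unfolding laplace_kernel_def by measurable

lemma laguerre_fun_measurable [measurable]: "laguerre_fun n \<in> borel_measurable borel"
proof (rule power_series_coeff_measurable[where r = 1 and
    G = "\<lambda>q x. exp (- (1/2) * ((1 + of_real q) / (1 - of_real q)) * of_real x) / (1 - of_real q)"])
  show "(\<lambda>n. laguerre_fun n x * of_real q ^ n) sums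
      (exp (- (1/2) * ((1 + of_real q) / (1 - of_real q)) * of_real x) / (1 - of_real q))"
    if "0 < q" "q < 1" for q x
    using that by (intro laguerre_fun_sums) simp
  show "(\<lambda>x. exp (- (1/2) * ((1 + of_real q) / (1 - of_real q)) * of_real x) / (1 - of_real q) :: complex) \<in> borel_measurable borel" for q
    by measurable
qed simp

lemma laguerre_fun_measurable' [measurable (raw)]:
  "f \<in> borel_measurable M \<Longrightarrow> (\<lambda>x. laguerre_fun n (f x)) \<in> borel_measurable M"
  by (rule measurable_compose[OF _ laguerre_fun_measurable])

lemma norm_powr_minus_half_le:
  assumes "cmod w \<ge> 1/2" "\<bar>Im (Ln w)\<bar> \<le> \<kappa>" "Re y = - 1/2" "\<bar>Im y\<bar> = m"
  shows "cmod (w powr y) \<le> 2 * exp (m * \<kappa>)"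
proof -
  have w: "w \<noteq> 0" using assms(1) by auto
  \<comment> \<open>The weaker lower bound 1/4 is enough and its power - 1/2 is the round value
    2.\<close>
  have "cmod w powr (- 1/2) \<le> (1/4) powr (- 1/2)"
    using assms(1) by (intro powr_mono2') auto
  also have "(1/4) powr (- 1/2 :: real) = 2"
  proof -
    have "(1/4 :: real) = (1/2) powr 2" by (simp add: powr_numeral power2_eq_square)
    then have "(1/4 :: real) powr (- 1/2) = (1/2) powr (2 * (- 1/2))" by (simp only: powr_powr)
    then show ?thesis by (simp add: powr_minus)
  qed
  finally have 1: "cmod w powr (- 1/2) \<le> 2" .
  have "- Im y * Arg w \<le> \<bar>Im y\<bar> * \<bar>Im (Ln w)\<bar>"
    using w by (simp add: Arg_eq_Im_Ln flip: abs_mult)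
  also have "\<dots> \<le> m * \<kappa>"
    using assms(2,4) by (intro mult_mono) auto
  finally have "exp (- Im y * Arg w) \<le> exp (m * \<kappa>)" by simp
  then show ?thesis
    unfolding norm_powr_complex assms(3) using 1 by (intro mult_mono) auto
qed

text \<open>On a small circle the arguments of both factors are at most \<kappa>, so the growth rate
  in \<mu> can be made as small as desired at the cost of a small radius. This freedom is needed
  because \<open>h_factor\<close> leaves only limited room for exponential growth in
  \<open>log_odds s\<close>.\<close>

lemma meixner_pollaczek_bound:
  assumes "\<kappa> > 0"
  obtains r where "0 < r" "r < 1/2"
    and "\<And>n \<mu> \<beta>. cmod (meixner_pollaczek n \<mu> \<beta>) \<le> 4 * exp (2 * \<bar>\<mu>\<bar> * \<kappa>) / r ^ n"
proof -
  let ?A = "\<lambda>\<mu> \<beta> q. (1 - q * exp (\<i> * of_real \<beta>)) powr (-1/2 + \<i> * of_real \<mu>)"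
  let ?B = "\<lambda>\<mu> \<beta> q. (1 - q * exp (- \<i> * of_real \<beta>)) powr (-1/2 - \<i> * of_real \<mu>)"
  have "isCont (\<lambda>w::complex. Ln (1 - w)) 0" by (intro continuous_intros) auto
  then obtain \<delta> where \<delta>: "\<delta> > 0" "\<And>w. dist w 0 < \<delta> \<Longrightarrow> dist (Ln (1 - w)) (Ln (1 - 0)) < \<kappa>"
    unfolding continuous_at_eps_delta using assms by blast
  \<comment> \<open>The bound 1/4 gives |1 - w| \<ge> 1/2 on the circle and keeps r below the radius
    1/2 of the Laguerre estimate, so that one r can later serve both families.\<close>
  define r where "r = min (\<delta>/2) (1/4)"
  have r: "0 < r" "r < 1/2" "r < \<delta>" using \<delta>(1) by (auto simp: r_def)
  have Ln: "\<bar>Im (Ln (1 - w))\<bar> \<le> \<kappa>" "cmod (1 - w) \<ge> 1/2" if "cmod w = r" for w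
  proof -
    have "cmod (Ln (1 - w)) < \<kappa>" using \<delta>(2)[of w] that r by (simp add: dist_norm)
    then show "\<bar>Im (Ln (1 - w))\<bar> \<le> \<kappa>" using abs_Im_le_cmod[of "Ln (1 - w)"] by linarith
    show "cmod (1 - w) \<ge> 1/2" using norm_triangle_ineq2[of 1 w] that r by simp
  qed
  have "cmod (meixner_pollaczek n \<mu> \<beta>) \<le> 4 * exp (2 * \<bar>\<mu>\<bar> * \<kappa>) / r ^ n" for n \<mu> \<beta>
  proof (rule power_series_coeff_bound)
    show "(\<lambda>n. meixner_pollaczek n \<mu> \<beta> * q ^ n) sums
           (?A \<mu> \<beta> q *
            ?B \<mu> \<beta> q)"
      if "cmod q < 1" for q using meixner_pollaczek_sums[OF that] .
    fix q :: complex assume q: "cmod q = r"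
    have "cmod (q * exp (\<i> * of_real \<beta>)) = r" "cmod (q * exp (- \<i> * of_real \<beta>)) = r"
      using q by (simp_all add: norm_mult norm_exp_eq_Re)
    then have "cmod (?A \<mu> \<beta> q) \<le> 2 * exp (\<bar>\<mu>\<bar> * \<kappa>)"
      "cmod (?B \<mu> \<beta> q) \<le> 2 * exp (\<bar>\<mu>\<bar> * \<kappa>)"
      using Ln by (auto intro!: norm_powr_minus_half_le)
    then have "cmod (?A \<mu> \<beta> q) *
       cmod (?B \<mu> \<beta> q) \<le> (2 * exp (\<bar>\<mu>\<bar> * \<kappa>)) * (2 * exp (\<bar>\<mu>\<bar> * \<kappa>))"
      by (intro mult_mono) auto
    also have "\<dots> = 4 * exp (2 * \<bar>\<mu>\<bar> * \<kappa>)"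
      by (simp add: mult.assoc flip: exp_add)
    finally show "cmod (?A \<mu> \<beta> q *
       ?B \<mu> \<beta> q) \<le> 4 * exp (2 * \<bar>\<mu>\<bar> * \<kappa>)"
      unfolding norm_mult .
  qed (use r in auto)
  with r that show ?thesis by blast
qed

lemma h_factor_measurable [measurable (raw)]:
  assumes [measurable]: "f \<in> borel_measurable M"
  shows "(\<lambda>x. h_factor \<beta> (f x)) \<in> borel_measurable M"
  unfolding h_factor_def by measurable

lemma ident_measurable_restrict_lborel [measurable]:
  "(\<lambda>x. x) \<in> borel_measurable (restrict_space lborel S)"
  by (rule measurable_restrict_space1) simp

lemma cexp_measurable_restrict_lborel [measurable]:
  "(\<lambda>x. exp (- w * of_real x) :: complex) \<in> borel_measurable (restrict_space lborel S)"
  by (rule measurable_restrict_space1) (auto intro!: borel_measurable_continuous_onI continuous_intros)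

text \<open>The square of \<open>h_factor\<close> is a Beta integrand with b = \<beta>/\<pi>, up to
  a constant. The exponential is at most the sum of the powers of 1/s - 1 with exponents
  \<plusminus>2 \<kappa>/\<pi>, which moves b to (\<beta> \<plusminus> 2 \<kappa>)/\<pi>; the
  conditions on \<kappa> keep both values in (0, 1).\<close>

lemma h_factor_square_integrable:
  assumes \<beta>: "0 < \<beta>" "\<beta> < pi" and \<kappa>: "0 < \<kappa>" "2 * \<kappa> < \<beta>" "2 * \<kappa> < pi - \<beta>"
  shows "integrable unit_interval (\<lambda>s. (h_factor \<beta> s * exp (2 * \<bar>log_odds s\<bar> * \<kappa>))\<^sup>2)"
proof (rule Bochner_Integration.integrable_bound)
  define f where "f b s = s powr (- b) * (1 - s) powr (b - 1)" for b s :: real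
  have int: "integrable unit_interval (f b)" if "0 < b" "b < 1" for b
    unfolding f_def using beta_integral(1)[OF that] by (subst set_integrable_eq_restrict_space[symmetric]) auto
  let ?b1 = "(\<beta> + 2 * \<kappa>) / pi" and ?b2 = "(\<beta> - 2 * \<kappa>) / pi"
  show "integrable unit_interval (\<lambda>s. sin \<beta> / pi * (f ?b1 s + f ?b2 s))"
    using \<beta> \<kappa> by (intro integrable_mult_right Bochner_Integration.integrable_add int) (auto simp: divide_simps)
  have le: "(h_factor \<beta> s * exp (2 * \<bar>log_odds s\<bar> * \<kappa>))\<^sup>2 \<le> sin \<beta> / pi * (f ?b1 s + f ?b2 s)"
    if s: "0 < s" "s < 1" for s
  proof -
    define u where "u = 1/s - 1"
    have u: "u > 0" "u = (1 - s) / s" using s by (auto simp: u_def field_simps)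
    have sin: "sin \<beta> > 0" using \<beta> by (intro sin_gt_zero)
    have sq: "(x powr a)\<^sup>2 = x powr (a * 2)" if "x > 0" for x a :: real
      using that by (simp add: powr_powr flip: powr_numeral)
    have "(h_factor \<beta> s)\<^sup>2 = sin \<beta> / pi * (u powr (\<beta> / pi) * (1 - s) powr (-1))"
      unfolding h_factor_def power_mult_distrib u_def[symmetric] using s u(1) sin
      by (simp add: sq)
    moreover have "(exp (2 * \<bar>log_odds s\<bar> * \<kappa>))\<^sup>2 \<le> u powr (2 * \<kappa> / pi) + u powr (- 2 * \<kappa> / pi)"
    proof -
      have "(exp (2 * \<bar>log_odds s\<bar> * \<kappa>))\<^sup>2 = exp (4 * \<kappa> * \<bar>log_odds s\<bar>)"
        by (simp add: power2_eq_square flip: exp_add)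
      also have "\<dots> \<le> exp (4 * \<kappa> * log_odds s) + exp (- 4 * \<kappa> * log_odds s)"
        by (cases "log_odds s \<ge> 0") auto
      also have "\<dots> = u powr (2 * \<kappa> / pi) + u powr (- 2 * \<kappa> / pi)"
        unfolding u_def powr_log_odds[OF s] by simp
      finally show ?thesis .
    qed
    ultimately have "(h_factor \<beta> s * exp (2 * \<bar>log_odds s\<bar> * \<kappa>))\<^sup>2 \<le>
       sin \<beta> / pi * (u powr (\<beta> / pi) * (1 - s) powr (-1)) * (u powr (2 * \<kappa> / pi) + u powr (- 2 * \<kappa> / pi))"
      unfolding power_mult_distrib using sin by (simp add: mult_left_mono del: times_divide_eq_left)
    also have "\<dots> = sin \<beta> / pi * (u powr ?b1 * (1 - s) powr (-1) + u powr ?b2 * (1 - s) powr (-1))"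
    proof -
      have "u powr ?b1 = u powr (\<beta> / pi) * u powr (2 * \<kappa> / pi)" "u powr ?b2 = u powr (\<beta> / pi) * u powr (- 2 * \<kappa> / pi)"
        unfolding powr_add[symmetric] by (simp_all add: add_divide_distrib diff_divide_distrib)
      then show ?thesis by (simp only: ring_distribs mult_ac)
    qed
    also have "\<dots> = sin \<beta> / pi * (f ?b1 s + f ?b2 s)"
    proof -
      have "u powr b * (1 - s) powr (-1) = f b s" for b
      proof -
        have "u powr b * (1 - s) powr (-1) = s powr (- b) * ((1 - s) powr b * (1 - s) powr (-1))"
          unfolding u(2) using s by (simp add: powr_divide powr_minus field_simps)
        also have "(1 - s) powr b * (1 - s) powr (-1) = (1 - s) powr (b - 1)"
          unfolding powr_add[symmetric] by simp
        finally show ?thesis by (simp add: f_def)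
      qed
      then show ?thesis by simp
    qed
    finally show ?thesis .
  qed
  show "AE s in unit_interval. norm ((h_factor \<beta> s * exp (2 * \<bar>log_odds s\<bar> * \<kappa>))\<^sup>2)
     \<le> norm (sin \<beta> / pi * (f ?b1 s + f ?b2 s))"
    unfolding real_norm_def abs_power2
    by (intro AE_I2 order.trans[OF le abs_ge_self]) (auto simp: space_restrict_space)
qed measurable

text \<open>One square integrable B and one radius for all n are what termwise integration against
  another square integrable function requires. The choice of \<kappa> makes 2 \<kappa> half the
  distance of \<beta> to the nearer end of (0, \<pi>).\<close>

lemma h_fun_bound:
  assumes \<beta>: "0 < \<beta>" "\<beta> < pi"
  obtains r B where "0 < r" "r < 1/2" "B \<in> borel_measurable unit_interval"
    "integrable unit_interval (\<lambda>s. (B s)\<^sup>2)" "\<And>s. B s \<ge> 0"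
    "\<And>n s. cmod (h_fun \<beta> n s) \<le> B s / r ^ n"
proof -
  define \<kappa> where "\<kappa> = min \<beta> (pi - \<beta>) / 4"
  have \<kappa>: "0 < \<kappa>" "2 * \<kappa> < \<beta>" "2 * \<kappa> < pi - \<beta>" using \<beta> by (auto simp: \<kappa>_def)
  obtain r where r: "0 < r" "r < 1/2"
    and mp: "\<And>n \<mu> \<beta>. cmod (meixner_pollaczek n \<mu> \<beta>) \<le> 4 * exp (2 * \<bar>\<mu>\<bar> * \<kappa>) / r ^ n"
    using meixner_pollaczek_bound[OF \<kappa>(1)] by blast
  define B where "B s = 4 * (h_factor \<beta> s * exp (2 * \<bar>log_odds s\<bar> * \<kappa>))" for s
  have hf: "h_factor \<beta> s \<ge> 0" for s by (simp add: h_factor_def)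
  show ?thesis
  proof (rule that[OF r])
    show "B \<in> borel_measurable unit_interval" unfolding B_def by measurable
    show "integrable unit_interval (\<lambda>s. (B s)\<^sup>2)"
      unfolding B_def power_mult_distrib[of 4]
      by (intro integrable_mult_right h_factor_square_integrable \<beta> \<kappa>)
    show "B s \<ge> 0" for s using hf by (simp add: B_def)
    show "cmod (h_fun \<beta> n s) \<le> B s / r ^ n" for n s
      using mult_left_mono[OF mp[of n "log_odds s" \<beta>] hf[of s]] hf[of s]
      by (simp add: h_fun_eq norm_mult B_def mult_ac)
  qed
qed

lemma integrable_mult_square_integrable:
  fixes f g :: "'a \<Rightarrow> real"
  assumes [measurable]: "f \<in> borel_measurable M" "g \<in> borel_measurable M"
    and "integrable M (\<lambda>x. (f x)\<^sup>2)" "integrable M (\<lambda>x. (g x)\<^sup>2)"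
  shows "integrable M (\<lambda>x. f x * g x)"
proof (rule Bochner_Integration.integrable_bound)
  show "integrable M (\<lambda>x. (f x)\<^sup>2 + (g x)\<^sup>2)" using assms by simp
  have "\<bar>f x * g x\<bar> \<le> (f x)\<^sup>2 + (g x)\<^sup>2" for x
  proof -
    have "0 \<le> \<bar>f x\<bar> * \<bar>g x\<bar>" by simp
    then show ?thesis
      unfolding abs_mult using sum_squares_bound[of "\<bar>f x\<bar>" "\<bar>g x\<bar>"] by (simp only: power2_abs mult.assoc)
  qed
  then show "AE x in M. norm (f x * g x) \<le> norm ((f x)\<^sup>2 + (g x)\<^sup>2)"
    by (auto intro: order.trans[OF _ abs_ge_self])
qed measurable

text \<open>In the exponential Im \<alpha> contributes only a phase, so a complex angle differs in
  modulus from its real part by a constant in s.\<close>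

lemma norm_laplace_kernel: "cmod (laplace_kernel \<alpha> s) =
   cmod (sin \<alpha>) / sin (Re \<alpha>) * cmod (laplace_kernel (of_real (Re \<alpha>)) s)" if "0 < Re \<alpha>" "Re \<alpha> < pi/2"
proof -
  have "sin (Re \<alpha>) > 0" using that by (intro sin_gt_zero) auto
  then show ?thesis
    by (simp add: laplace_kernel_def norm_mult sin_of_real)
qed

lemma laplace_kernel_square_integrable:
  assumes \<alpha>: "0 < Re \<alpha>" "Re \<alpha> < pi/2"
  shows "integrable unit_interval (\<lambda>s. (cmod (laplace_kernel \<alpha> s))\<^sup>2)"
proof -
  have "integrable unit_interval (\<lambda>s. (laplace_kernel (of_real (Re \<alpha>)) s * laplace_kernel (of_real (Re \<alpha>)) s))"
    using laplace_kernel_gram(1)[OF \<alpha> \<alpha>] .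
  then have "integrable unit_interval (\<lambda>s. (cmod (laplace_kernel (of_real (Re \<alpha>)) s))\<^sup>2)"
    by (rule Bochner_Integration.integrable_norm[THEN Bochner_Integration.integrable_cong[THEN iffD1, rotated -1]])
       (auto simp: norm_mult power2_eq_square)
  then show ?thesis
    unfolding norm_laplace_kernel[OF \<alpha>] power_mult_distrib by (rule integrable_mult_right)
qed

lemma norm_laguerre_integrable: "integrable half_line (\<lambda>x. 2 * exp (- (x / 6)))"
  using exp_half_line_integrable[of "1/6"] by (simp add: set_integrable_eq_restrict_space)

section \<open>The pointwise identity and its weak form\<close>

context
  fixes \<beta> :: real
  assumes \<beta>: "0 < \<beta>" "\<beta> < pi" "tan (\<beta> / 2) = 1 / 2"
begin

lemma h_fun_measurable: "h_fun \<beta> n \<in> borel_measurable unit_interval"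
proof (rule power_series_coeff_measurable[where r = 1 and
    G = "\<lambda>q s. laplace_kernel (of_real (gen_angle \<beta> q)) s / of_real (1 - q)"])
  show "(\<lambda>n. h_fun \<beta> n s * of_real q ^ n) sums (laplace_kernel (of_real (gen_angle \<beta> q)) s / of_real (1 - q))"
    if "0 < q" "q < 1" "s \<in> space unit_interval" for q s
    using that by (intro h_fun_sums_real \<beta>) (auto simp: space_restrict_space)
  show "(\<lambda>s. laplace_kernel (of_real (gen_angle \<beta> q)) s / of_real (1 - q)) \<in> borel_measurable unit_interval" for q
    by measurable
qed simp

text \<open>The kernel is bounded in x and the Laguerre functions are at most 2 exp (- x / 6) 2^n,
  which justifies termwise integration for 0 < q < 1/2. Such small q already determine the
  coefficients.\<close>

lemma q_plus_laguerre:
  assumes s: "0 < s" "s < 1"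
  shows "set_integrable lborel {0<..} (\<lambda>x. q_plus s x * laguerre_fun n x)"
    and "(LINT x:{0<..}|lborel. q_plus s x * laguerre_fun n x) = h_fun \<beta> n s"
proof -
  define C where "C = q_factor s * (LINT u:{-1<..<1}|lborel. (1 - u\<^sup>2) powr (-1/2))"
  have C: "cmod (q_plus s x) \<le> C" for x unfolding C_def by (rule norm_q_plus_le)
  then have C0: "C \<ge> 0" using order.trans[OF norm_ge_zero] by blast
  define c where "c n x = q_plus s x * laguerre_fun n x" for n x
  define G where "G q x = q_plus s x * (exp (- of_real (cos (gen_angle \<beta> q) / sin (gen_angle \<beta> q)) * of_real x) / of_real (1 - q))" for q x
  have m: "c n \<in> borel_measurable half_line" for n
    unfolding c_def
    by (intro borel_measurable_times q_plus_measurable laguerre_fun_measurable' borel_measurable_const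
        ident_measurable_restrict_lborel)
  have sums: "(\<lambda>n. c n x * of_real q ^ n) sums G q x" if "0 < q" "q < 1/2" for q x
    unfolding c_def G_def mult.assoc using that by (intro sums_mult laguerre_fun_sums_real \<beta>) auto
  have bound: "cmod (c n x) \<le> C * (2 * exp (- (x / 6))) / (1/2) ^ n" if "x \<in> space half_line" for n x
  proof -
    have "x \<ge> 0" using that by (simp add: space_restrict_space)
    from mult_mono[OF C[of x] norm_laguerre_fun_le[OF this, of n]] C0
    show ?thesis by (simp add: c_def norm_mult)
  qed
  have B: "integrable half_line (\<lambda>x. C * (2 * exp (- (x / 6))))"
    by (intro integrable_mult_right norm_laguerre_integrable)
  note * = power_series_coeff_integral[of "1/2" half_line c G, OF _ sums m B bound]
  show "set_integrable lborel {0<..} (\<lambda>x. q_plus s x * laguerre_fun n x)"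
    using *(1)[of n] by (simp add: set_integrable_eq_restrict_space c_def [abs_def])
  have "(\<integral>x. c n x \<partial>half_line) = h_fun \<beta> n s"
  proof (rule power_series_coeff_unique[where r = "1/2" and c = "\<lambda>n. \<integral>x. c n x \<partial>half_line" and d = "\<lambda>n. h_fun \<beta> n s"])
    fix q :: real assume q: "0 < q" "q < 1/2"
    show "(\<lambda>n. (\<integral>x. c n x \<partial>half_line) * of_real q ^ n) sums (\<integral>x. G q x \<partial>half_line)"
      using *(2)[of q] q by simp
    let ?\<alpha> = "of_real (gen_angle \<beta> q) :: complex"
    have "(\<integral>x. G q x \<partial>half_line) = (\<integral>x. q_plus s x * exp (- (cos ?\<alpha> / sin ?\<alpha>) * of_real x) \<partial>half_line) / of_real (1 - q)"
      unfolding G_def by (simp add: cos_of_real sin_of_real)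
    also have "\<dots> = laplace_kernel ?\<alpha> s / of_real (1 - q)"
      using q_plus_laplace[OF s, of ?\<alpha>] gen_angle(1,2)[OF \<beta>, of q] q
      by (simp add: set_lebesgue_integral_eq_restrict_space)
    finally show "(\<lambda>n. h_fun \<beta> n s * of_real q ^ n) sums (\<integral>x. G q x \<partial>half_line)"
      using h_fun_sums_real[OF \<beta> _ _ s, of q] q by simp
  qed simp
  then show "(LINT x:{0<..}|lborel. q_plus s x * laguerre_fun n x) = h_fun \<beta> n s"
    by (simp add: set_lebesgue_integral_eq_restrict_space c_def)
qed

lemma h_fun_square_integrable: "h_fun \<beta> n \<in> square_integrable unit_interval"
proof -
  obtain r B where r: "0 < r" "r < 1/2" "B \<in> borel_measurable unit_interval"
    "integrable unit_interval (\<lambda>s. (B s)\<^sup>2)" "\<And>s. B s \<ge> 0"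
    "\<And>n s. cmod (h_fun \<beta> n s) \<le> B s / r ^ n"
    using h_fun_bound[OF \<beta>(1,2)] by metis
  note [measurable] = h_fun_measurable
  have "integrable unit_interval (\<lambda>s. (cmod (h_fun \<beta> n s))\<^sup>2)"
  proof (rule Bochner_Integration.integrable_bound)
    show "integrable unit_interval (\<lambda>s. (B s)\<^sup>2 / (r ^ n)\<^sup>2)" using r(4) by simp
    show "AE s in unit_interval. norm ((cmod (h_fun \<beta> n s))\<^sup>2) \<le> norm ((B s)\<^sup>2 / (r ^ n)\<^sup>2)"
    proof (intro AE_I2)
      fix s
      from power_mono[OF r(6)[of n s] norm_ge_zero, of 2]
      show "norm ((cmod (h_fun \<beta> n s))\<^sup>2) \<le> norm ((B s)\<^sup>2 / (r ^ n)\<^sup>2)"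
        by (simp add: power_divide)
    qed
  qed measurable
  then show ?thesis by (simp add: square_integrable_def h_fun_measurable)
qed

text \<open>The weak form of the claim on \<open>V\<close>, tested against one exponential. Weighted
  by q^n and summed, both sides become 1 / ((z + w) (1 - q)), where z and w are the cotangents of
  \<open>gen_angle \<beta> q\<close> and \<gamma>: on the left by the Gram formula, on the right by
  direct integration.\<close>

lemma h_fun_pairing:
  assumes \<gamma>: "0 < \<gamma>" "\<gamma> < pi/2"
  shows "(\<integral>s. h_fun \<beta> n s * laplace_kernel (of_real \<gamma>) s \<partial>unit_interval) =
     (\<integral>x. laguerre_fun n x * exp (- of_real (cos \<gamma> / sin \<gamma>) * of_real x) \<partial>half_line)"
proof -
  obtain r B where r: "0 < r" "r < 1/2" "B \<in> borel_measurable unit_interval"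
    "integrable unit_interval (\<lambda>s. (B s)\<^sup>2)" "\<And>s. B s \<ge> 0"
    "\<And>n s. cmod (h_fun \<beta> n s) \<le> B s / r ^ n"
    using h_fun_bound[OF \<beta>(1,2)] by metis
  note [measurable] = h_fun_measurable r(3)
  define w where "w = cos \<gamma> / sin \<gamma>"
  have w: "w > 0" unfolding w_def using \<gamma> by (intro divide_pos_pos cos_gt_zero sin_gt_zero) auto
  let ?L = "laplace_kernel (of_real \<gamma>)"
  define c1 where "c1 n s = h_fun \<beta> n s * ?L s" for n s
  define G1 where "G1 q s = laplace_kernel (of_real (gen_angle \<beta> q)) s / of_real (1 - q) * ?L s" for q s
  define c2 where "c2 n x = laguerre_fun n x * exp (- of_real w * of_real x)" for n and x :: real
  define G2 where "G2 q x = exp (- of_real (cos (gen_angle \<beta> q) / sin (gen_angle \<beta> q)) * of_real x) / of_real (1 - q) *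
      exp (- of_real w * of_real x :: complex)" for q x :: real
  have s1: "(\<lambda>n. c1 n s * of_real q ^ n) sums G1 q s" if "0 < q" "q < r" "s \<in> space unit_interval" for q s
  proof -
    have "(\<lambda>n. (h_fun \<beta> n s * of_real q ^ n) * ?L s) sums G1 q s"
      unfolding G1_def using that r by (intro sums_mult2 h_fun_sums_real \<beta>) (auto simp: space_restrict_space)
    then show ?thesis by (simp add: c1_def mult_ac)
  qed
  have s2: "(\<lambda>n. c2 n x * of_real q ^ n) sums G2 q x" if "0 < q" "q < r" for q x
  proof -
    have "(\<lambda>n. (laguerre_fun n x * of_real q ^ n) * exp (- of_real w * of_real x)) sums G2 q x"
      unfolding G2_def using that r by (intro sums_mult2 laguerre_fun_sums_real \<beta>) auto
    then show ?thesis by (simp add: c2_def mult_ac)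
  qed
  have m1: "c1 n \<in> borel_measurable unit_interval" for n unfolding c1_def by measurable
  have m2: "c2 n \<in> borel_measurable half_line" for n
    unfolding c2_def
    by (intro borel_measurable_times laguerre_fun_measurable' ident_measurable_restrict_lborel cexp_measurable_restrict_lborel)
  have B1: "integrable unit_interval (\<lambda>s. B s * cmod (?L s))"
    using \<gamma> r(4) by (intro integrable_mult_square_integrable laplace_kernel_square_integrable) auto
  have b1: "cmod (c1 n s) \<le> B s * cmod (?L s) / r ^ n" for n s
    using mult_right_mono[OF r(6)[of n s], of "cmod (?L s)"] by (simp add: c1_def norm_mult)
  have b2: "cmod (c2 n x) \<le> 2 * exp (- (x / 6)) / r ^ n" if "x \<in> space half_line" for n x
  proof -
    have x: "x > 0" using that by (simp add: space_restrict_space)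
    have "cmod (c2 n x) = cmod (laguerre_fun n x) * exp (- (w * x))" by (simp add: c2_def norm_mult)
    also have "\<dots> \<le> cmod (laguerre_fun n x)" using w x by (intro mult_left_le) auto
    also have "\<dots> \<le> 2 * exp (- (x / 6)) / (1/2) ^ n" using x by (intro norm_laguerre_fun_le) simp
    also have "\<dots> \<le> 2 * exp (- (x / 6)) / r ^ n" using r by (intro divide_left_mono power_mono) auto
    finally show ?thesis .
  qed
  have eq: "(\<integral>s. G1 q s \<partial>unit_interval) = (\<integral>x. G2 q x \<partial>half_line)" if q: "0 < q" "q < r" for q
  proof -
    define z where "z = cos (gen_angle \<beta> q) / sin (gen_angle \<beta> q)"
    have g: "0 < gen_angle \<beta> q" "gen_angle \<beta> q < pi/2" using gen_angle(1,2)[OF \<beta>, of q] q r by auto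
    have z: "z > 0" unfolding z_def using g by (intro divide_pos_pos cos_gt_zero sin_gt_zero) auto
    have "(\<integral>s. G1 q s \<partial>unit_interval) = (\<integral>s. laplace_kernel (of_real (gen_angle \<beta> q)) s * ?L s \<partial>unit_interval) / of_real (1 - q)"
      unfolding G1_def by (simp flip: integral_divide_zero)
    also have "\<dots> = of_real (1 / (z + w)) / of_real (1 - q)"
      unfolding laplace_kernel_gram(2)[OF g \<gamma>] z_def w_def ..
    also have "of_real (1 / (z + w)) = (LINT x:{0<..}|lborel. exp (- of_real (z + w) * complex_of_real x))"
      using z w by (subst cexp_half_line_integral) auto
    also have "\<dots> / of_real (1 - q) = (\<integral>x. exp (- of_real (z + w) * complex_of_real x) / of_real (1 - q) \<partial>half_line)"
      by (simp add: set_lebesgue_integral_eq_restrict_space)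
    also have "\<dots> = (\<integral>x. G2 q x \<partial>half_line)"
      unfolding G2_def z_def[symmetric]
      by (intro Bochner_Integration.integral_cong refl) (simp add: algebra_simps flip: exp_add)
    finally show ?thesis .
  qed
  have "(\<integral>s. c1 n s \<partial>unit_interval) = (\<integral>x. c2 n x \<partial>half_line)"
  proof (rule power_series_coeff_unique[where r = r and c = "\<lambda>n. \<integral>s. c1 n s \<partial>unit_interval" and d = "\<lambda>n. \<integral>x. c2 n x \<partial>half_line"])
    fix q :: real assume q: "0 < q" "q < r"
    show "(\<lambda>n. (\<integral>s. c1 n s \<partial>unit_interval) * of_real q ^ n) sums (\<integral>s. G1 q s \<partial>unit_interval)"
      by (rule power_series_coeff_integral(2)[OF r(1) s1 m1 B1 b1 q])
    show "(\<lambda>n. (\<integral>x. c2 n x \<partial>half_line) * of_real q ^ n) sums (\<integral>s. G1 q s \<partial>unit_interval)"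
      unfolding eq[OF q] by (rule power_series_coeff_integral(2)[OF r(1) s2 m2 norm_laguerre_integrable b2 q])
  qed (rule r)
  then show ?thesis by (simp add: c1_def c2_def w_def)
qed

end

section \<open>Square integrable functions\<close>

text \<open>Meaningful for square integrable functions, where the Bochner integral is not the
  default 0. Distances not yet known to be finite are written with the extended integral
  instead.\<close>

definition l2norm :: "'a measure \<Rightarrow> ('a \<Rightarrow> complex) \<Rightarrow> real" where
  "l2norm M f = sqrt (\<integral>x. (cmod (f x))\<^sup>2 \<partial>M)"

lemma l2norm_nonneg [simp]: "l2norm M f \<ge> 0"
  by (simp add: l2norm_def)

lemma l2norm_square: "(l2norm M f)\<^sup>2 = (\<integral>x. (cmod (f x))\<^sup>2 \<partial>M)"
  by (simp add: l2norm_def)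

lemma square_integrableD:
  assumes "f \<in> square_integrable M"
  shows "f \<in> borel_measurable M" "integrable M (\<lambda>x. (cmod (f x))\<^sup>2)"
  using assms by (auto simp: square_integrable_def)

lemma square_integrable_mono:
  assumes g: "g \<in> square_integrable M" and f: "f \<in> borel_measurable M"
    and le: "\<And>x. x \<in> space M \<Longrightarrow> cmod (f x) \<le> cmod (g x)"
  shows "f \<in> square_integrable M"
proof -
  note [measurable] = f
  have "integrable M (\<lambda>x. (cmod (f x))\<^sup>2)"
  proof (rule Bochner_Integration.integrable_bound[OF square_integrableD(2)[OF g]])
    show "AE x in M. norm ((cmod (f x))\<^sup>2) \<le> norm ((cmod (g x))\<^sup>2)"
      using le by (auto intro!: AE_I2 power_mono)
  qed measurable
  then show ?thesis using f by (simp add: square_integrable_def)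
qed

lemma cexp_square_integrable:
  assumes "Re z > 0"
  shows "(\<lambda>x. exp (- z * of_real x)) \<in> square_integrable half_line"
proof -
  have "(cmod (exp (- z * of_real x)))\<^sup>2 = exp (- (2 * Re z) * x)" for x
    by (simp add: power2_eq_square flip: exp_add)
  then show ?thesis
    using exp_half_line_integrable[of "2 * Re z"] assms cexp_measurable_restrict_lborel
    by (simp add: square_integrable_def set_integrable_eq_restrict_space)
qed

lemma square_integrable_exp_bound:
  assumes "f \<in> borel_measurable half_line" "a > 0"
    and le: "\<And>x. x > 0 \<Longrightarrow> cmod (f x) \<le> C * exp (- a * x)"
  shows "f \<in> square_integrable half_line"
proof (rule square_integrable_mono[OF _ assms(1)])
  show "(\<lambda>x. of_real C * exp (- of_real a * of_real x)) \<in> square_integrable half_line"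
    using cexp_square_integrable[of "of_real a"] assms(2)
    by (auto simp: square_integrable_def norm_mult power_mult_distrib)
  fix x assume "x \<in> space half_line"
  then have "x > 0" by (simp add: space_restrict_space)
  then have "cmod (f x) \<le> \<bar>C\<bar> * exp (- a * x)"
    by (rule order.trans[OF le mult_right_mono[OF abs_ge_self]]) simp
  then show "cmod (f x) \<le> cmod (of_real C * exp (- of_real a * of_real x))"
    by (simp add: norm_mult)
qed

lemma integral_mult_sum:
  fixes d :: "'a \<Rightarrow> complex"
  assumes "\<And>i. integrable M (\<lambda>x. d x * e i x)"
  shows "(\<integral>x. d x * (\<Sum>i\<le>N. c i * e i x) \<partial>M) = (\<Sum>i\<le>(N::nat). c i * (\<integral>x. d x * e i x \<partial>M))"
proof -
  have "(\<integral>x. d x * (\<Sum>i\<le>N. c i * e i x) \<partial>M) = (\<integral>x. (\<Sum>i\<le>N. c i * (d x * e i x)) \<partial>M)"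
    by (simp only: sum_distrib_left mult.left_commute)
  then show ?thesis using assms by (simp add: Bochner_Integration.integral_sum)
qed

lemma integrable_cmod_mult:
  assumes f: "f \<in> square_integrable M" and g: "g \<in> square_integrable M"
  shows "integrable M (\<lambda>x. cmod (f x) * cmod (g x))"
  using square_integrableD[OF f] square_integrableD[OF g]
  by (intro integrable_mult_square_integrable) auto

lemma integrable_mult_square_integrable_complex:
  assumes f: "f \<in> square_integrable M" and g: "g \<in> square_integrable M"
  shows "integrable M (\<lambda>x. f x * g x)"
proof (rule Bochner_Integration.integrable_bound[OF integrable_cmod_mult[OF f g]])
  show "(\<lambda>x. f x * g x) \<in> borel_measurable M"
    using square_integrableD[OF f] square_integrableD[OF g] by auto
qed (auto simp: norm_mult)

lemma Cauchy_Schwarz_cmod: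
  assumes f: "f \<in> square_integrable M" and g: "g \<in> square_integrable M"
  shows "(\<integral>x. cmod (f x) * cmod (g x) \<partial>M) \<le> l2norm M f * l2norm M g"
proof -
  note F = square_integrableD[OF f] and G = square_integrableD[OF g]
  have [measurable]: "f \<in> borel_measurable M" "g \<in> borel_measurable M" using F G by auto
  have "(\<integral>\<^sup>+x. ennreal (cmod (f x)) * ennreal (cmod (g x)) \<partial>M)\<^sup>2 \<le>
     (\<integral>\<^sup>+x. (ennreal (cmod (f x)))\<^sup>2 \<partial>M) * (\<integral>\<^sup>+x. (ennreal (cmod (g x)))\<^sup>2 \<partial>M)"
    by (rule Cauchy_Schwarz_nn_integral) measurable
  also have "(\<integral>\<^sup>+x. ennreal (cmod (f x)) * ennreal (cmod (g x)) \<partial>M) = ennreal (\<integral>x. cmod (f x) * cmod (g x) \<partial>M)"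
    using integrable_cmod_mult[OF f g] by (subst nn_integral_eq_integral[symmetric]) (auto simp: ennreal_mult)
  also have "(\<integral>\<^sup>+x. (ennreal (cmod (f x)))\<^sup>2 \<partial>M) = ennreal ((l2norm M f)\<^sup>2)"
    unfolding l2norm_square using F by (subst nn_integral_eq_integral[symmetric]) (auto simp: ennreal_power)
  also have "(\<integral>\<^sup>+x. (ennreal (cmod (g x)))\<^sup>2 \<partial>M) = ennreal ((l2norm M g)\<^sup>2)"
    unfolding l2norm_square using G by (subst nn_integral_eq_integral[symmetric]) (auto simp: ennreal_power)
  finally have "(\<integral>x. cmod (f x) * cmod (g x) \<partial>M)\<^sup>2 \<le> (l2norm M f * l2norm M g)\<^sup>2"
    by (simp add: ennreal_power power_mult_distrib flip: ennreal_mult)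
  then show ?thesis by (rule power2_le_imp_le) simp
qed

lemma Cauchy_Schwarz_integral:
  assumes f: "f \<in> square_integrable M" and g: "g \<in> square_integrable M"
  shows "cmod (\<integral>x. f x * g x \<partial>M) \<le> l2norm M f * l2norm M g"
proof -
  have "cmod (\<integral>x. f x * g x \<partial>M) \<le> (\<integral>x. cmod (f x * g x) \<partial>M)" by simp
  also have "\<dots> \<le> l2norm M f * l2norm M g"
    unfolding norm_mult by (rule Cauchy_Schwarz_cmod[OF f g])
  finally show ?thesis .
qed

lemma square_integrable_add:
  assumes f: "f \<in> square_integrable M" and g: "g \<in> square_integrable M"
  shows "(\<lambda>x. f x + g x) \<in> square_integrable M"
proof -
  note F = square_integrableD[OF f] and G = square_integrableD[OF g]
  have "integrable M (\<lambda>x. (cmod (f x + g x))\<^sup>2)"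
  proof (rule Bochner_Integration.integrable_bound)
    show "integrable M (\<lambda>x. (cmod (f x))\<^sup>2 + 2 * (cmod (f x) * cmod (g x)) + (cmod (g x))\<^sup>2)"
      using F G integrable_cmod_mult[OF f g] by auto
    have "(cmod (f x + g x))\<^sup>2 \<le> (cmod (f x) + cmod (g x))\<^sup>2" for x
      by (intro power_mono norm_triangle_ineq) simp
    then show "AE x in M. norm ((cmod (f x + g x))\<^sup>2) \<le> norm ((cmod (f x))\<^sup>2 + 2 * (cmod (f x) * cmod (g x)) + (cmod (g x))\<^sup>2)"
      by (auto simp: power2_sum algebra_simps)
  qed (use F G in measurable)
  then show ?thesis using F G by (auto simp: square_integrable_def)
qed

lemma square_integrable_cmult:
  "f \<in> square_integrable M \<Longrightarrow> (\<lambda>x. c * f x) \<in> square_integrable M"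
  by (auto simp: square_integrable_def norm_mult power_mult_distrib)

lemma square_integrable_diff:
  assumes f: "f \<in> square_integrable M" and g: "g \<in> square_integrable M"
  shows "(\<lambda>x. f x - g x) \<in> square_integrable M"
  using square_integrable_add[OF f square_integrable_cmult[OF g, of "-1"]] by simp

lemma square_integrable_sum:
  "finite A \<Longrightarrow> (\<And>i. i \<in> A \<Longrightarrow> f i \<in> square_integrable M) \<Longrightarrow> (\<lambda>x. \<Sum>i\<in>A. f i x) \<in> square_integrable M"
proof (induction A rule: finite_induct)
  case empty
  then show ?case by (simp add: square_integrable_def)
next
  case (insert a A)
  then show ?case using square_integrable_add[of "f a" M "\<lambda>x. \<Sum>i\<in>A. f i x"] by simp
qed

lemma l2norm_triangle:
  assumes f: "f \<in> square_integrable M" and g: "g \<in> square_integrable M"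
  shows "l2norm M (\<lambda>x. f x + g x) \<le> l2norm M f + l2norm M g"
proof -
  note F = square_integrableD[OF f] and G = square_integrableD[OF g]
  note FG = square_integrableD[OF square_integrable_add[OF f g]]
  have "(l2norm M (\<lambda>x. f x + g x))\<^sup>2 \<le> (\<integral>x. (cmod (f x))\<^sup>2 + 2 * (cmod (f x) * cmod (g x)) + (cmod (g x))\<^sup>2 \<partial>M)"
    unfolding l2norm_square
  proof (rule integral_mono[OF FG(2)])
    show "integrable M (\<lambda>x. (cmod (f x))\<^sup>2 + 2 * (cmod (f x) * cmod (g x)) + (cmod (g x))\<^sup>2)"
      using F G integrable_cmod_mult[OF f g] by auto
    have "(cmod (f x + g x))\<^sup>2 \<le> (cmod (f x) + cmod (g x))\<^sup>2" for x
      by (intro power_mono norm_triangle_ineq) simp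
    then show "(cmod (f x + g x))\<^sup>2 \<le> (cmod (f x))\<^sup>2 + 2 * (cmod (f x) * cmod (g x)) + (cmod (g x))\<^sup>2" for x
      by (simp add: power2_sum algebra_simps)
  qed
  also have "\<dots> = (l2norm M f)\<^sup>2 + 2 * (\<integral>x. cmod (f x) * cmod (g x) \<partial>M) + (l2norm M g)\<^sup>2"
    using F G integrable_cmod_mult[OF f g] by (simp add: l2norm_square)
  also have "\<dots> \<le> (l2norm M f + l2norm M g)\<^sup>2"
    using Cauchy_Schwarz_cmod[OF f g] by (simp add: power2_sum)
  finally show ?thesis by (rule power2_le_imp_le) simp
qed

text \<open>The norm of a linear combination depends on the Gram matrix alone. For two systems with
  the same matrix this gives equal norms without a map between the two spaces.\<close>

lemma integral_norm_square_sum: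
  fixes u :: "nat \<Rightarrow> 'a \<Rightarrow> complex"
  assumes int: "\<And>i j. i \<le> N \<Longrightarrow> j \<le> N \<Longrightarrow> integrable M (\<lambda>x. u i x * cnj (u j x))"
    and gram: "\<And>i j. i \<le> N \<Longrightarrow> j \<le> N \<Longrightarrow> (\<integral>x. u i x * cnj (u j x) \<partial>M) = g i j"
  shows "of_real (\<integral>x. (cmod (\<Sum>i\<le>N. c i * u i x))\<^sup>2 \<partial>M) = (\<Sum>i\<le>N. \<Sum>j\<le>N. c i * cnj (c j) * g i j)"
proof -
  have "complex_of_real (\<integral>x. (cmod (\<Sum>i\<le>N. c i * u i x))\<^sup>2 \<partial>M) =
     (\<integral>x. of_real ((cmod (\<Sum>i\<le>N. c i * u i x))\<^sup>2) \<partial>M)"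
    by (rule integral_complex_of_real[symmetric])
  also have "\<dots> = (\<integral>x. (\<Sum>i\<le>N. \<Sum>j\<le>N. c i * cnj (c j) * (u i x * cnj (u j x))) \<partial>M)"
    by (intro Bochner_Integration.integral_cong refl)
       (simp only: complex_norm_square cnj_sum complex_cnj_mult sum_product mult_ac)
  also have "\<dots> = (\<Sum>i\<le>N. \<integral>x. (\<Sum>j\<le>N. c i * cnj (c j) * (u i x * cnj (u j x))) \<partial>M)"
    using int by (intro Bochner_Integration.integral_sum Bochner_Integration.integrable_sum integrable_mult_right) auto
  also have "\<dots> = (\<Sum>i\<le>N. \<Sum>j\<le>N. \<integral>x. c i * cnj (c j) * (u i x * cnj (u j x)) \<partial>M)"
    using int by (intro sum.cong refl Bochner_Integration.integral_sum integrable_mult_right) auto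
  also have "\<dots> = (\<Sum>i\<le>N. \<Sum>j\<le>N. c i * cnj (c j) * g i j)"
    using gram by (intro sum.cong refl) simp
  finally show ?thesis .
qed

section \<open>Fourier uniqueness and totality of the Laplace kernels\<close>

text \<open>Levy's uniqueness theorem concerns probability measures, so f is split into positive and
  negative part. Frequency 0 shows that both have the same mass m. If m > 0, the normalised images
  under X have equal characteristic functions and hence coincide; if m = 0, f vanishes almost
  everywhere.\<close>

lemma Fourier_uniqueness_real:
  fixes f X :: "'a \<Rightarrow> real"
  assumes f: "integrable M f" and X [measurable]: "X \<in> borel_measurable M"
    and zero: "\<And>t. (\<integral>x. of_real (f x) * iexp (t * X x) \<partial>M) = 0"
    and A: "A \<in> sets borel"
  shows "(\<integral>x. f x * indicator A (X x) \<partial>M) = 0"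
proof -
  let ?I = "\<lambda>R t. \<integral>x. of_real (R x) * iexp (t * X x) \<partial>M"
  let ?J = "\<lambda>R. \<integral>x. R x * indicator A (X x) \<partial>M"
  have [measurable]: "f \<in> borel_measurable M" using f by auto
  define P where "P = (\<lambda>x. max (f x) 0)"
  define Q where "Q = (\<lambda>x. max (- f x) 0)"
  have PQ: "f x = P x - Q x" "P x \<ge> 0" "Q x \<ge> 0" for x by (auto simp: P_def Q_def)
  have int: "integrable M P" "integrable M Q" using f by (auto simp: P_def Q_def)
  have [measurable]: "P \<in> borel_measurable M" "Q \<in> borel_measurable M" using int by auto
  have inte: "integrable M (\<lambda>x. of_real (R x) * iexp (t * X x))" if "integrable M R" for R :: "'a \<Rightarrow> real" and t
    by (rule Bochner_Integration.integrable_bound[OF that]) (use that in \<open>auto simp: norm_mult\<close>)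
  have eq: "?I P t = ?I Q t" for t
  proof -
    have "?I P t - ?I Q t =
      (\<integral>x. of_real (P x) * iexp (t * X x) - of_real (Q x) * iexp (t * X x) \<partial>M)"
      by (intro Bochner_Integration.integral_diff[symmetric] inte int)
    also have "\<dots> = ?I f t"
      by (intro Bochner_Integration.integral_cong refl) (simp add: PQ(1) algebra_simps)
    finally show ?thesis using zero[of t] by simp
  qed
  define m where "m = (\<integral>x. P x \<partial>M)"
  have m: "(\<integral>x. Q x \<partial>M) = m"
  proof -
    have "complex_of_real (\<integral>x. P x \<partial>M) = of_real (\<integral>x. Q x \<partial>M)"
      using eq[of 0] by (simp flip: integral_complex_of_real)
    then show ?thesis by (simp add: m_def)
  qed
  have m0: "m \<ge> 0" unfolding m_def using PQ by (intro Bochner_Integration.integral_nonneg) auto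
  show ?thesis
  proof (cases "m = 0")
    case True
    have "AE x in M. P x = 0" "AE x in M. Q x = 0"
      using True m int PQ integral_nonneg_eq_0_iff_AE[of M P] integral_nonneg_eq_0_iff_AE[of M Q] by (auto simp: m_def)
    then have "AE x in M. f x * indicator A (X x) = 0" by eventually_elim (simp add: PQ(1))
    then show ?thesis by (rule integral_eq_zero_AE)
  next
    case False
    with m0 have mp: "m > 0" by simp
    define D where "D R = distr (density M (\<lambda>x. R x / m)) borel X" for R
    have rd: "real_distribution (D R)" if [measurable]: "R \<in> borel_measurable M" and R: "integrable M R" "\<And>x. R x \<ge> 0" "(\<integral>x. R x \<partial>M) = m" for R
    proof -
      have "emeasure (density M (\<lambda>x. R x / m)) (space M) = (\<integral>\<^sup>+x. ennreal (R x / m) \<partial>M)"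
        by (subst emeasure_density) (auto intro!: nn_integral_cong)
      also have "\<dots> = ennreal (\<integral>x. R x / m \<partial>M)"
        using R mp by (intro nn_integral_eq_integral) auto
      also have "\<dots> = 1" using R mp by simp
      finally have "prob_space (density M (\<lambda>x. R x / m))" by (intro prob_spaceI) simp
      then interpret prob_space "density M (\<lambda>x. R x / m)" .
      show ?thesis unfolding D_def by (rule real_distribution_distr) simp
    qed
    have ch: "char (D R) t = ?I R t / of_real m"
      if [measurable]: "R \<in> borel_measurable M" and R: "\<And>x. R x \<ge> 0" for R t
    proof -
      have "char (D R) t = (\<integral>x. (R x / m) *\<^sub>R iexp (t * X x) \<partial>M)"
        unfolding char_def D_def using R mp by (simp add: integral_distr integral_density)
      also have "\<dots> = (\<integral>x. of_real (R x) * iexp (t * X x) / of_real m \<partial>M)"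
        by (intro Bochner_Integration.integral_cong refl) (simp add: scaleR_conv_of_real)
      finally show ?thesis by simp
    qed
    have "char (D P) t = char (D Q) t" for t
      using ch[of P t] ch[of Q t] PQ eq[of t] by simp
    then have DPQ: "D P = D Q"
      using PQ int m by (intro Levy_uniqueness rd ext) (auto simp: m_def)
    have ind: "(\<integral>y. indicator A y \<partial>D R) = ?J R / m"
      if [measurable]: "R \<in> borel_measurable M" and R: "\<And>x. R x \<ge> 0" for R
    proof -
      have [measurable]: "A \<in> sets borel" by (rule A)
      have "(\<integral>y. indicator A y \<partial>D R) = (\<integral>x. (R x / m) *\<^sub>R indicator A (X x) \<partial>M :: real)"
      proof -
        have "(\<integral>y. indicator A y \<partial>D R) = (\<integral>x. indicator A (X x) \<partial>density M (\<lambda>x. R x / m) :: real)"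
          unfolding D_def by (rule integral_distr) measurable
        also have "\<dots> = (\<integral>x. (R x / m) *\<^sub>R indicator A (X x) \<partial>M)"
          using R mp by (intro integral_density) auto
        finally show ?thesis .
      qed
      then show ?thesis by simp
    qed
    have "?J P / m = ?J Q / m"
      using ind[of P] ind[of Q] PQ(2,3) by (simp only: DPQ \<open>P \<in> borel_measurable M\<close> \<open>Q \<in> borel_measurable M\<close>)
    then have "?J P = ?J Q"
      using mp by simp
    moreover have inti: "integrable M (\<lambda>x. R x * indicator A (X x))" if "integrable M R" for R :: "'a \<Rightarrow> real"
    proof -
      have [measurable]: "A \<in> sets borel" by (rule A)
      show ?thesis using that
        by (intro Bochner_Integration.integrable_bound[OF that]) (auto simp: indicator_def)
    qed
    moreover have "?J f = (\<integral>x. P x * indicator A (X x) - Q x * indicator A (X x) \<partial>M)"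
      by (intro Bochner_Integration.integral_cong refl) (simp add: PQ(1) algebra_simps)
    ultimately show ?thesis using int by simp
  qed
qed

text \<open>Conjugating the hypothesis at - t shows that the conjugate of f has vanishing transform
  as well. Hence so have the real and imaginary parts, to which the real case applies.\<close>

lemma Fourier_uniqueness:
  fixes f :: "'a \<Rightarrow> complex" and X :: "'a \<Rightarrow> real"
  assumes f: "integrable M f" and X [measurable]: "X \<in> borel_measurable M"
    and zero: "\<And>t. (\<integral>x. f x * iexp (t * X x) \<partial>M) = 0"
    and A: "A \<in> sets borel"
  shows "(\<integral>x. indicator A (X x) *\<^sub>R f x \<partial>M) = 0"
proof -
  have [measurable]: "f \<in> borel_measurable M" using f by auto
  have [measurable]: "A \<in> sets borel" by (rule A)
  have inte: "integrable M (\<lambda>x. g x * iexp (t * X x))" if "integrable M g" for g :: "'a \<Rightarrow> complex" and t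
    by (rule Bochner_Integration.integrable_bound[OF that]) (use that in \<open>auto simp: norm_mult\<close>)
  have cz: "(\<integral>x. cnj (f x) * iexp (t * X x) \<partial>M) = 0" for t
  proof -
    have "(\<integral>x. cnj (f x) * iexp (t * X x) \<partial>M) = (\<integral>x. cnj (f x * iexp (- t * X x)) \<partial>M)"
      by (intro Bochner_Integration.integral_cong refl) (simp add: exp_cnj)
    also have "\<dots> = cnj (\<integral>x. f x * iexp (- t * X x) \<partial>M)" by (rule Bochner_Integration.integral_cnj)
    finally show ?thesis using zero[of "- t"] by simp
  qed
  have icnj: "integrable M (\<lambda>x. cnj (f x))" using f by simp
  have "(\<integral>x. of_real (Re (f x)) * iexp (t * X x) \<partial>M) = 0" for t
  proof -
    have "(\<integral>x. of_real (Re (f x)) * iexp (t * X x) \<partial>M) = (\<integral>x. (1/2) * (f x * iexp (t * X x) + cnj (f x) * iexp (t * X x)) \<partial>M)"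
      by (intro Bochner_Integration.integral_cong refl) (simp add: complex_add_cnj flip: distrib_right)
    also have "\<dots> = 0"
      using zero[of t] cz[of t] inte[OF f] inte[OF icnj] by simp
    finally show ?thesis .
  qed
  then have re: "(\<integral>x. Re (f x) * indicator A (X x) \<partial>M) = 0"
    using f by (intro Fourier_uniqueness_real A) auto
  have "(\<integral>x. of_real (Im (f x)) * iexp (t * X x) \<partial>M) = 0" for t
  proof -
    have "(\<integral>x. of_real (Im (f x)) * iexp (t * X x) \<partial>M) = (\<integral>x. (1/(2*\<i>)) * (f x * iexp (t * X x) - cnj (f x) * iexp (t * X x)) \<partial>M)"
    proof (intro Bochner_Integration.integral_cong refl)
      fix x
      have "of_real (Im z) * e = (1/(2*\<i>)) * (z * e - cnj z * e)" for z e
        unfolding left_diff_distrib[symmetric] complex_diff_cnj by (simp add: complex_eq_iff)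
      then show "of_real (Im (f x)) * iexp (t * X x) = (1/(2*\<i>)) * (f x * iexp (t * X x) - cnj (f x) * iexp (t * X x))" .
    qed
    also have "\<dots> = 0"
      using zero[of t] cz[of t] inte[OF f] inte[OF icnj] by simp
    finally show ?thesis .
  qed
  then have im: "(\<integral>x. Im (f x) * indicator A (X x) \<partial>M) = 0"
    using f by (intro Fourier_uniqueness_real A) auto
  have "integrable M (\<lambda>x. indicator A (X x) *\<^sub>R f x)"
    by (rule Bochner_Integration.integrable_bound[OF f]) (auto simp: indicator_def)
  then show ?thesis
    using re im by (simp add: complex_eq_iff mult.commute flip: integral_Re integral_Im)
qed

lemma laplace_kernel_total:
  assumes g: "g \<in> square_integrable unit_interval"
    and zero: "\<And>\<alpha>. 0 < Re \<alpha> \<Longrightarrow> Re \<alpha> < pi/2 \<Longrightarrow> (\<integral>s. g s * laplace_kernel \<alpha> s \<partial>unit_interval) = 0"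
  shows "AE s in unit_interval. g s = 0"
proof -
  let ?L = "laplace_kernel (of_real (pi/4))"
  define f where "f s = g s * ?L s" for s
  have L: "laplace_kernel \<alpha> \<in> square_integrable unit_interval" if "0 < Re \<alpha>" "Re \<alpha> < pi/2" for \<alpha>
    using laplace_kernel_square_integrable[OF that] by (simp add: square_integrable_def)
  have f: "integrable unit_interval f"
    unfolding f_def by (intro integrable_mult_square_integrable_complex g L) auto
  have zf: "(\<integral>s. f s * iexp (t * log_odds s) \<partial>unit_interval) = 0" for t
  proof -
    \<comment> \<open>The imaginary part - t/2 makes exp (- 2 m \<alpha>) equal to its value at
      \<pi>/4 times exp (i t m).\<close>
    define \<alpha> where "\<alpha> = of_real (pi/4) - \<i> * of_real (t/2)"
    have re: "0 < Re \<alpha>" "Re \<alpha> < pi/2" by (auto simp: \<alpha>_def)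
    have nz: "sin \<alpha> \<noteq> 0" "sin (of_real (pi/4) :: complex) \<noteq> 0"
      using Re_cot_pos(2)[OF re] Re_cot_pos(2)[of "of_real (pi/4)"] by auto
    have e: "exp (- 2 * of_real m * \<alpha>) = exp (- 2 * of_real m * of_real (pi/4)) * iexp (t * m)" for m
      unfolding exp_add[symmetric] \<alpha>_def by (rule arg_cong[of _ _ exp]) (simp add: algebra_simps)
    have "f s * iexp (t * log_odds s) = (sin (of_real (pi/4)) / sin \<alpha>) * (g s * laplace_kernel \<alpha> s)" for s
      unfolding f_def laplace_kernel_def e using nz by (simp add: field_simps)
    then show ?thesis using zero[OF re] by simp
  qed
  have X: "log_odds \<in> borel_measurable unit_interval"
    using log_odds_measurable[OF ident_measurable_restrict_lborel] by simp
  interpret sigma_finite_measure unit_interval by (rule sigma_finite_restrict_lborel) simp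
  have "AE s in unit_interval. f s = 0"
  proof (rule density_zero[OF f])
    fix B assume B: "B \<in> sets unit_interval"
    \<comment> \<open>The inverse of \<open>log_odds\<close> on the unit interval. It shows that
      every Borel set B there is a preimage under \<open>log_odds\<close>, so vanishing integrals
      over such preimages already force f = 0 almost everywhere.\<close>
    define S where "S y = 1 / (1 + exp (2 * pi * y))" for y :: real
    have [measurable]: "S \<in> borel_measurable borel" unfolding S_def by measurable
    have SX: "S (log_odds s) = s" if "s \<in> {0<..<1}" for s
    proof -
      have "exp (2 * pi * log_odds s) = 1/s - 1"
        using that by (simp add: log_odds_def)
      then show ?thesis using that by (simp add: S_def)
    qed
    have B': "B \<in> sets borel" "B \<subseteq> {0<..<1}"
      using B by (auto simp: sets_restrict_space)
    define A where "A = S -` B"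
    have A: "A \<in> sets borel" unfolding A_def using measurable_sets[of S borel borel B] B' by simp
    have "(LINT s:B|unit_interval. f s) = (\<integral>s. indicator A (log_odds s) *\<^sub>R f s \<partial>unit_interval)"
      unfolding set_lebesgue_integral_def
      by (intro Bochner_Integration.integral_cong refl) (auto simp: A_def SX space_restrict_space indicator_def)
    also have "\<dots> = 0" by (rule Fourier_uniqueness[OF f X zf A])
    finally show "(LINT s:B|unit_interval. f s) = 0" .
  qed
  moreover have "?L s \<noteq> 0" if "s \<in> space unit_interval" for s
    using that Re_cot_pos(2)[of "of_real (pi/4)"] by (simp add: laplace_kernel_def space_restrict_space)
  ultimately show ?thesis
    by (auto simp: f_def)
qed

section \<open>Test functions on the half line\<close>

lemma continuous_approx_AE:
  fixes \<psi> :: "real \<Rightarrow> complex"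
  assumes [measurable]: "\<psi> \<in> borel_measurable borel" and K: "\<And>x. cmod (\<psi> x) \<le> K" "K > 0"
  obtains g where "\<And>n. continuous_on UNIV (g n)" "\<And>n x. cmod (g n x) \<le> K"
    "AE x in lborel. (\<lambda>n. g n x) \<longlonglongrightarrow> \<psi> x"
proof -
  have "\<psi> \<in> borel_measurable lebesgue" by (intro measurable_completion) simp
  then have "\<psi> measurable_on UNIV" by (rule lebesgue_measurable_imp_measurable_on) simp
  then obtain N f where N: "negligible N" and f: "\<And>n. continuous_on UNIV (f n)"
    and lim: "\<And>x. x \<notin> N \<Longrightarrow> (\<lambda>n. f n x) \<longlonglongrightarrow> \<psi> x"
    unfolding measurable_on_def by auto
  \<comment> \<open>Radial truncation to the disc of radius K: it preserves continuity, and it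
    preserves the limit because the modulus of \<psi> is at most K.\<close>
  define g where "g n x = f n x * of_real (K / max K (cmod (f n x)))" for n :: nat and x
  show ?thesis
  proof (rule that)
    show "continuous_on UNIV (g n)" for n
      unfolding g_def using K(2) by (intro continuous_intros f) auto
    show "cmod (g n x) \<le> K" for n x
    proof -
      have "cmod (g n x) = cmod (f n x) * (K / max K (cmod (f n x)))"
      proof -
        have "K / max K (cmod (f n x)) > 0" using K(2) by (intro divide_pos_pos) (auto simp: less_max_iff_disj)
        then show ?thesis unfolding g_def norm_mult norm_of_real by (simp only: abs_of_pos)
      qed
      also have "\<dots> \<le> K" using K(2) by (auto simp: max_def divide_simps)
      finally show ?thesis .
    qed
    have "(\<lambda>n. g n x) \<longlonglongrightarrow> \<psi> x" if "x \<notin> N" for x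
    proof -
      have "(\<lambda>n. g n x) \<longlonglongrightarrow> \<psi> x * of_real (K / max K (cmod (\<psi> x)))"
        unfolding g_def using K(2) by (intro tendsto_intros lim that) auto
      moreover have "max K (cmod (\<psi> x)) = K" using K(1)[of x] by (simp add: max.absorb1)
      ultimately show ?thesis using K(2) by simp
    qed
    moreover have "AE x in lborel. x \<notin> N"
    proof -
      have "N \<in> null_sets lebesgue" using N by (simp add: negligible_iff_null_sets)
      then have "AE x in lebesgue. x \<notin> N" by (rule AE_not_in)
      then show ?thesis by (simp add: AE_completion_iff)
    qed
    ultimately show "AE x in lborel. (\<lambda>n. g n x) \<longlonglongrightarrow> \<psi> x" by auto
  qed
qed

lemma complex_polynomial_approx:
  fixes F :: "real \<Rightarrow> complex"
  assumes F: "continuous_on {0..1} F" and "\<delta> > 0"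
  obtains N and c :: "nat \<Rightarrow> complex" where "\<And>y. y \<in> {0..1} \<Longrightarrow> cmod (F y - (\<Sum>i\<le>N. c i * of_real y ^ i)) < \<delta>"
proof -
  have "continuous_on {0..1} (\<lambda>y. Re (F y))" "continuous_on {0..1} (\<lambda>y. Im (F y))"
    using F by (auto intro: continuous_intros)
  moreover have d: "\<delta>/2 > 0" using assms by simp
  ultimately obtain p q where pq: "real_polynomial_function p" "real_polynomial_function q"
    and ap: "\<And>y. y \<in> {0..1} \<Longrightarrow> \<bar>Re (F y) - p y\<bar> < \<delta>/2" "\<And>y. y \<in> {0..1} \<Longrightarrow> \<bar>Im (F y) - q y\<bar> < \<delta>/2"
    by (metis Stone_Weierstrass_real_polynomial_function compact_Icc)
  obtain a m b n where p: "p = (\<lambda>x. \<Sum>i\<le>m. a i * x ^ i)" and q: "q = (\<lambda>x. \<Sum>i\<le>n. b i * x ^ i)"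
    using pq unfolding real_polynomial_function_iff_sum by blast
  define N where "N = max m n"
  define c where "c i = Complex (if i \<le> m then a i else 0) (if i \<le> n then b i else 0)" for i
  have pad: "(\<Sum>i\<le>k. e i * y ^ i) = (\<Sum>i\<le>N. (if i \<le> k then e i else 0) * y ^ i)" if "k \<le> N" for k and e :: "nat \<Rightarrow> real" and y
    using that by (intro sum.mono_neutral_cong_left) auto
  have "p y = Re (\<Sum>i\<le>N. c i * of_real y ^ i)" "q y = Im (\<Sum>i\<le>N. c i * of_real y ^ i)" for y
    unfolding p q by (simp_all add: pad[of m] pad[of n] N_def c_def Re_sum Im_sum flip: of_real_power)
  then have "cmod (F y - (\<Sum>i\<le>N. c i * of_real y ^ i)) < \<delta>" if "y \<in> {0..1}" for y
    using cmod_le[of "F y - (\<Sum>i\<le>N. c i * of_real y ^ i)"] ap[OF that] by simp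
  then show ?thesis using that by blast
qed

text \<open>In the variable y = exp (- x) the approximants are polynomials on (0, 1], so uniform
  approximation by Weierstrass is available; the finite mass of exp (- x) dx turns it into
  approximation in mean square.\<close>

lemma exp_polynomial_dense:
  fixes \<psi> :: "real \<Rightarrow> complex"
  assumes [measurable]: "\<psi> \<in> borel_measurable borel" and K: "\<And>x. cmod (\<psi> x) \<le> K" "K > 0" and e: "e > 0"
  obtains N and c :: "nat \<Rightarrow> complex" where
    "(\<integral>x. (cmod (\<psi> x - (\<Sum>i\<le>N. c i * of_real (exp (- x)) ^ i)))\<^sup>2 * exp (- x) \<partial>half_line) < e"
proof -
  obtain g where g: "\<And>n. continuous_on UNIV (g n)" "\<And>n x. cmod (g n x) \<le> K"
    and lim: "AE x in lborel. (\<lambda>n. g n x) \<longlonglongrightarrow> \<psi> x"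
    using continuous_approx_AE[OF assms(1) K] by blast
  have gm [measurable]: "g n \<in> borel_measurable borel" for n
    using g(1) by (rule borel_measurable_continuous_onI)
  \<comment> \<open>Freezing the argument beyond n makes the function constant for large x, hence
    continuous in y = exp (- x) up to the end point y = 0.\<close>
  define G where "G n x = g n (min x (real n))" for n x
  have [measurable]: "G n \<in> borel_measurable borel" for n unfolding G_def by measurable
  have mr: "f \<in> borel_measurable borel \<Longrightarrow> f \<in> borel_measurable half_line" for f :: "real \<Rightarrow> complex"
    by (rule measurable_restrict_space1) simp
  have inte: "integrable half_line (\<lambda>x. exp (- x))"
    using exp_half_line_integrable[of 1] by (simp add: set_integrable_eq_restrict_space)
  define A where "A = (\<integral>x. exp (- x) \<partial>half_line)"
  have A: "A \<ge> 0" unfolding A_def by (intro Bochner_Integration.integral_nonneg) auto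
  have bd: "(cmod (\<psi> x - G n x))\<^sup>2 * exp (- x) \<le> (2 * K)\<^sup>2 * exp (- x)" for x n
  proof -
    have "cmod (\<psi> x - G n x) \<le> 2 * K"
      using norm_triangle_ineq4[of "\<psi> x" "G n x"] K(1)[of x] g(2)[of n "min x (real n)"] by (simp add: G_def)
    then show ?thesis by (intro mult_right_mono power_mono) auto
  qed
  have "(\<lambda>n. \<integral>x. (cmod (\<psi> x - G n x))\<^sup>2 * exp (- x) \<partial>half_line) \<longlonglongrightarrow> (\<integral>x. 0 \<partial>half_line)"
  proof (rule integral_dominated_convergence)
    show "integrable half_line (\<lambda>x. (2 * K)\<^sup>2 * exp (- x))" using inte by simp
    show "AE x in half_line. norm ((cmod (\<psi> x - G n x))\<^sup>2 * exp (- x)) \<le> (2 * K)\<^sup>2 * exp (- x)" for n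
      using bd by simp
    have "AE x in half_line. (\<lambda>n. g n x) \<longlonglongrightarrow> \<psi> x"
      using lim by (subst AE_restrict_space_iff) auto
    then show "AE x in half_line. (\<lambda>n. (cmod (\<psi> x - G n x))\<^sup>2 * exp (- x)) \<longlonglongrightarrow> 0"
    proof eventually_elim
      case (elim x)
      have "eventually (\<lambda>n. g n x = G n x) sequentially"
        using eventually_ge_at_top[of "nat \<lceil>x\<rceil>"]
        by eventually_elim (simp add: G_def min_def; linarith)
      with elim have "(\<lambda>n. G n x) \<longlonglongrightarrow> \<psi> x" by (rule Lim_transform_eventually)
      then have "(\<lambda>n. (cmod (\<psi> x - G n x))\<^sup>2 * exp (- x)) \<longlonglongrightarrow> (cmod (\<psi> x - \<psi> x))\<^sup>2 * exp (- x)"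
        by (intro tendsto_intros)
      then show ?case by simp
    qed
  qed measurable
  then have "eventually (\<lambda>n. (\<integral>x. (cmod (\<psi> x - G n x))\<^sup>2 * exp (- x) \<partial>half_line) < e/4) sequentially"
    using e by (intro order_tendstoD(2)) auto
  then obtain n where n: "(\<integral>x. (cmod (\<psi> x - G n x))\<^sup>2 * exp (- x) \<partial>half_line) < e/4"
    by (auto simp: eventually_sequentially)
  \<comment> \<open>This is \<open>G n\<close> in the variable y = exp (- x); the maximum carries
    out the freezing and avoids the logarithm of 0.\<close>
  define F where "F y = g n (- ln (max y (exp (- real n))))" for y
  have "continuous_on {0..1} F"
    unfolding F_def
  proof (rule continuous_on_compose2[OF g(1)])
    have "max y (exp (- real n)) > 0" for y by (simp add: less_max_iff_disj)
    then show "continuous_on {0..1} (\<lambda>y. - ln (max y (exp (- real n))))"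
      by (intro continuous_intros) (metis less_irrefl)
  qed simp
  \<comment> \<open>Chosen so that 2 \<delta>^2 A \<le> e/4, with A + 1 in place of A against
    division by 0. Together with twice the error e/4 from above this stays below e.\<close>
  moreover define \<delta> where "\<delta> = sqrt (e / (8 * (A + 1)))"
  have \<delta>: "\<delta> > 0" "\<delta>\<^sup>2 = e / (8 * (A + 1))" using e A by (auto simp: \<delta>_def)
  ultimately obtain N and c :: "nat \<Rightarrow> complex"
    where c: "\<And>y. y \<in> {0..1} \<Longrightarrow> cmod (F y - (\<Sum>i\<le>N. c i * of_real y ^ i)) < \<delta>"
    using complex_polynomial_approx by metis
  have FG: "F (exp (- x)) = G n x" for x
  proof -
    have "max (exp (- x)) (exp (- real n)) = exp (- min x (real n))" by (auto simp: max_def min_def)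
    then show ?thesis by (simp add: F_def G_def)
  qed
  let ?P = "\<lambda>x. \<Sum>i\<le>N. c i * of_real (exp (- x)) ^ i"
  have cP: "continuous_on UNIV ?P" by (intro continuous_intros)
  have [measurable]: "?P \<in> borel_measurable borel"
    by (rule borel_measurable_continuous_onI[OF cP])
  have i1: "integrable half_line (\<lambda>x. (cmod (\<psi> x - G n x))\<^sup>2 * exp (- x))"
    by (rule Bochner_Integration.integrable_bound[OF integrable_mult_right[OF inte, of "(2 * K)\<^sup>2"]])
       (measurable, use bd in auto)
  have le: "(cmod (\<psi> x - ?P x))\<^sup>2 * exp (- x) \<le> 2 * ((cmod (\<psi> x - G n x))\<^sup>2 * exp (- x)) + 2 * \<delta>\<^sup>2 * exp (- x)"
    if "x \<in> space half_line" for x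
  proof -
    have "exp (- x) \<in> {0..1}" using that by (simp add: space_restrict_space)
    from c[OF this] have "cmod (G n x - ?P x) \<le> \<delta>" by (simp add: FG)
    then have "cmod (\<psi> x - ?P x) \<le> cmod (\<psi> x - G n x) + \<delta>"
      using norm_triangle_ineq[of "\<psi> x - G n x" "G n x - ?P x"] by simp
    then have "(cmod (\<psi> x - ?P x))\<^sup>2 \<le> (cmod (\<psi> x - G n x) + \<delta>)\<^sup>2" by (intro power_mono) auto
    also have "\<dots> \<le> 2 * (cmod (\<psi> x - G n x))\<^sup>2 + 2 * \<delta>\<^sup>2"
      using sum_squares_bound[of "cmod (\<psi> x - G n x)" \<delta>] by (simp add: power2_sum)
    finally have "(cmod (\<psi> x - ?P x))\<^sup>2 * exp (- x) \<le> (2 * (cmod (\<psi> x - G n x))\<^sup>2 + 2 * \<delta>\<^sup>2) * exp (- x)"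
      by (intro mult_right_mono) auto
    then show ?thesis by (simp add: algebra_simps)
  qed
  have i2: "integrable half_line (\<lambda>x. 2 * ((cmod (\<psi> x - G n x))\<^sup>2 * exp (- x)) + 2 * \<delta>\<^sup>2 * exp (- x))"
    using i1 inte by simp
  have "(\<integral>x. (cmod (\<psi> x - ?P x))\<^sup>2 * exp (- x) \<partial>half_line) \<le> (\<integral>x. 2 * ((cmod (\<psi> x - G n x))\<^sup>2 * exp (- x)) + 2 * \<delta>\<^sup>2 * exp (- x) \<partial>half_line)"
  proof (rule integral_mono[OF _ i2 le])
    show "integrable half_line (\<lambda>x. (cmod (\<psi> x - ?P x))\<^sup>2 * exp (- x))"
    proof (rule Bochner_Integration.integrable_bound[OF i2])
      show "(\<lambda>x. (cmod (\<psi> x - ?P x))\<^sup>2 * exp (- x)) \<in> borel_measurable half_line"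
        by measurable
      show "AE x in half_line. norm ((cmod (\<psi> x - ?P x))\<^sup>2 * exp (- x)) \<le>
         norm (2 * ((cmod (\<psi> x - G n x))\<^sup>2 * exp (- x)) + 2 * \<delta>\<^sup>2 * exp (- x))"
        using le by (intro AE_I2) (simp add: order.trans[OF le abs_ge_self] abs_mult)
    qed
  qed
  also have "\<dots> = 2 * (\<integral>x. (cmod (\<psi> x - G n x))\<^sup>2 * exp (- x) \<partial>half_line) + 2 * \<delta>\<^sup>2 * A"
    using i1 inte by (simp add: A_def)
  also have "\<dots> < 2 * (e/4) + 2 * \<delta>\<^sup>2 * A" using n by simp
  also have "2 * \<delta>\<^sup>2 * A \<le> e / 4"
    unfolding \<delta>(2) using A e by (simp add: divide_simps)
  finally have "(\<integral>x. (cmod (\<psi> x - ?P x))\<^sup>2 * exp (- x) \<partial>half_line) < e" using e by simp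
  then show ?thesis using that by blast
qed

text \<open>Duality for a function d known only to be bounded. On (0, R) the ideal test function is
  the conjugate of d. Approximating it by exponential sums gives
  \<open>a\<^sup>2 \<le> \<epsilon> * a\<close> for the norm a of d restricted to (0, R), hence a
  \<le> \<epsilon>, and monotone convergence lets R grow.\<close>

lemma exp_test_functions_norm:
  fixes d :: "real \<Rightarrow> complex"
  assumes d [measurable]: "d \<in> borel_measurable borel" and K: "\<And>x. x > 0 \<Longrightarrow> cmod (d x) \<le> K"
    and \<epsilon>: "\<epsilon> \<ge> 0"
    and le: "\<And>N c. cmod (\<integral>x. d x * (\<Sum>i\<le>N. c i * of_real (exp (- x)) ^ Suc i) \<partial>half_line) \<le>
       \<epsilon> * l2norm half_line (\<lambda>x. \<Sum>i\<le>N. c i * of_real (exp (- x)) ^ Suc i)"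
  shows "(\<integral>\<^sup>+x. ennreal ((cmod (d x))\<^sup>2) \<partial>half_line) \<le> ennreal (\<epsilon>\<^sup>2)"
proof -
  have K0: "K \<ge> 0" using K[of 1] norm_ge_zero[of "d 1"] by linarith
  have mr: "f \<in> borel_measurable borel \<Longrightarrow> f \<in> borel_measurable half_line" for f :: "real \<Rightarrow> complex"
    by (rule measurable_restrict_space1) simp
  have inte: "integrable half_line (\<lambda>x. exp (- x))"
    using exp_half_line_integrable[of 1] by (simp add: set_integrable_eq_restrict_space)
  \<comment> \<open>On the half line d may fail to be square integrable, but D does not. In the
    error term one half of the weight exp (- x) goes to d and the other half to the approximation
    error.\<close>
  define D where "D x = d x * of_real (exp (- x / 2))" for x
  have D: "D \<in> square_integrable half_line"
  proof (rule square_integrable_exp_bound)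
    show "D \<in> borel_measurable half_line" unfolding D_def by measurable
    show "cmod (D x) \<le> K * exp (- (1/2) * x)" if "x > 0" for x
      using K[OF that] by (simp add: D_def norm_mult)
  qed simp
  have bound: "(\<integral>x. (cmod (d x))\<^sup>2 * indicator {0<..<R} x \<partial>half_line) \<le> \<epsilon>\<^sup>2"
    "integrable half_line (\<lambda>x. (cmod (d x))\<^sup>2 * indicator {0<..<R} x)" for R :: real
  proof -
    define \<phi> where "\<phi> x = (if 0 < x \<and> x < R then cnj (d x) else 0)" for x
    \<comment> \<open>The test exponents begin at 1, so one factor exp (- x) is divided out of
      \<phi> before polynomials in exp (- x) approximate it.\<close>
    define \<psi> where "\<psi> x = \<phi> x * of_real (exp x)" for x
    have "(\<lambda>x. cnj (d x)) \<in> borel_measurable borel"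
      by (rule measurable_compose[OF d]) (intro borel_measurable_continuous_onI continuous_intros)
    moreover have "\<phi> = (\<lambda>x. indicat_real {0<..<R} x *\<^sub>R cnj (d x))"
      by (auto simp: fun_eq_iff \<phi>_def indicator_def)
    ultimately have [measurable]: "\<phi> \<in> borel_measurable borel"
      by (simp add: borel_measurable_scaleR)
    have [measurable]: "\<psi> \<in> borel_measurable borel" unfolding \<psi>_def by measurable
    have \<psi>K: "cmod (\<psi> x) \<le> K * exp R + 1" for x
    proof (cases "0 < x \<and> x < R")
      case True
      then have "cmod (\<psi> x) \<le> K * exp R"
        using K[of x] K0 by (auto simp: \<psi>_def \<phi>_def norm_mult intro!: mult_mono)
      then show ?thesis by simp
    qed (use K0 in \<open>auto simp: \<psi>_def \<phi>_def add_nonneg_nonneg\<close>)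
    have \<psi>0: "K * exp R + 1 > 0" using K0 by (simp add: add_nonneg_pos)
    have \<phi>2: "(cmod (\<phi> x))\<^sup>2 = (cmod (d x))\<^sup>2 * indicator {0<..<R} x" for x
      by (auto simp: \<phi>_def indicator_def)
    have \<phi>: "\<phi> \<in> square_integrable half_line"
    proof (rule square_integrable_exp_bound)
      show "\<phi> \<in> borel_measurable half_line" by measurable
      show "cmod (\<phi> x) \<le> (K * exp R + 1) * exp (- 1 * x)" for x
      proof -
        have "cmod (\<phi> x) = cmod (\<psi> x) * exp (- x)" by (simp add: \<psi>_def norm_mult exp_minus)
        also have "\<dots> \<le> (K * exp R + 1) * exp (- x)" by (intro mult_right_mono \<psi>K) simp
        finally show ?thesis by simp
      qed
    qed simp
    show int: "integrable half_line (\<lambda>x. (cmod (d x))\<^sup>2 * indicator {0<..<R} x)"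
      using square_integrableD(2)[OF \<phi>] by (simp add: \<phi>2)
    define a where "a = l2norm half_line \<phi>"
    have a2: "a\<^sup>2 = (\<integral>x. (cmod (d x))\<^sup>2 * indicator {0<..<R} x \<partial>half_line)"
      by (simp add: a_def l2norm_square \<phi>2)
    have a0: "a \<ge> 0" by (simp add: a_def)
    have d\<phi>: "(\<integral>x. d x * \<phi> x \<partial>half_line) = of_real (a\<^sup>2)"
    proof -
      have "d x * \<phi> x = of_real ((cmod (d x))\<^sup>2 * indicator {0<..<R} x)" for x
        using complex_norm_square[of "d x"] by (auto simp: \<phi>_def indicator_def)
      then show ?thesis unfolding a2 by (simp only: integral_complex_of_real)
    qed
    have ineq: "a\<^sup>2 \<le> \<epsilon> * a + (\<epsilon> + l2norm half_line D) * \<eta>" if \<eta>: "\<eta> > 0" for \<eta>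
    proof -
      have "\<exists>N (c :: nat \<Rightarrow> complex). (\<integral>x. (cmod (\<psi> x - (\<Sum>i\<le>N. c i * of_real (exp (- x)) ^ i)))\<^sup>2 * exp (- x) \<partial>half_line) < \<eta>\<^sup>2"
      proof (rule exp_polynomial_dense[of \<psi> "K * exp R + 1" "\<eta>\<^sup>2"])
        fix N and c :: "nat \<Rightarrow> complex"
        assume "(\<integral>x. (cmod (\<psi> x - (\<Sum>i\<le>N. c i * of_real (exp (- x)) ^ i)))\<^sup>2 * exp (- x) \<partial>half_line) < \<eta>\<^sup>2"
        then show ?thesis by blast
      qed (use \<psi>K \<psi>0 \<eta> in simp_all)
      then obtain N and c :: "nat \<Rightarrow> complex" where c: "(\<integral>x. (cmod (\<psi> x - (\<Sum>i\<le>N. c i * of_real (exp (- x)) ^ i)))\<^sup>2 * exp (- x) \<partial>half_line) < \<eta>\<^sup>2" by blast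
      define P where "P x = (\<Sum>i\<le>N. c i * of_real (exp (- x)) ^ i)" for x
      define p where "p x = (\<Sum>i\<le>N. c i * of_real (exp (- x)) ^ Suc i)" for x
      have [measurable]: "P \<in> borel_measurable borel" "p \<in> borel_measurable borel"
        unfolding P_def p_def by (intro borel_measurable_continuous_onI continuous_intros)+
      have pP: "p x = of_real (exp (- x)) * P x" for x
        by (simp add: p_def P_def sum_distrib_left mult_ac)
      have \<phi>\<psi>: "\<phi> x = of_real (exp (- x)) * \<psi> x" for x
        by (simp add: \<psi>_def exp_minus flip: of_real_mult)
      define r where "r x = p x - \<phi> x" for x
      \<comment> \<open>The norm of w is the weighted mean square error of the polynomial
        approximation, and r is w with a further factor exp (- x/2). So r is small, and d r = D w
        has a small integral by Cauchy-Schwarz.\<close>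
      define w where "w x = (P x - \<psi> x) * of_real (exp (- x / 2))" for x
      have rw: "r x = of_real (exp (- x / 2)) * w x" for x
      proof -
        have "of_real (exp (- x)) = complex_of_real (exp (- x / 2)) * of_real (exp (- x / 2))"
          by (simp flip: exp_add of_real_mult)
        then show ?thesis by (simp add: r_def w_def pP \<phi>\<psi> algebra_simps)
      qed
      have bP: "cmod (P x) \<le> (\<Sum>i\<le>N. cmod (c i))" if "x > 0" for x
        unfolding P_def
      proof (rule sum_norm_le)
        fix i
        have "exp (- x) ^ i \<le> 1" using that by (intro power_le_one) auto
        then show "cmod (c i * of_real (exp (- x)) ^ i) \<le> cmod (c i)"
          by (simp add: norm_mult norm_power mult_left_le)
      qed
      define L where "L = (\<Sum>i\<le>N. cmod (c i)) + (K * exp R + 1)"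
      have w2: "(cmod (w x))\<^sup>2 = (cmod (\<psi> x - P x))\<^sup>2 * exp (- x)" for x
      proof -
        have "(exp (- x / 2))\<^sup>2 = exp (- x)" by (simp add: power2_eq_square flip: exp_add)
        then show ?thesis by (simp add: w_def norm_mult power_mult_distrib norm_minus_commute)
      qed
      have w: "w \<in> square_integrable half_line"
      proof (rule square_integrable_exp_bound)
        show "w \<in> borel_measurable half_line" unfolding w_def by measurable
        show "cmod (w x) \<le> L * exp (- (1/2) * x)" if "x > 0" for x
          using norm_triangle_ineq4[of "P x" "\<psi> x"] bP[OF that] \<psi>K[of x] by (simp add: w_def L_def norm_mult)
      qed simp
      have lw: "l2norm half_line w \<le> \<eta>"
      proof -
        have "(l2norm half_line w)\<^sup>2 \<le> \<eta>\<^sup>2"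
          unfolding l2norm_square w2 P_def using c by simp
        then show ?thesis by (rule power2_le_imp_le) (use \<eta> in simp)
      qed
      have rle: "cmod (r x) \<le> cmod (w x)" if "x \<in> space half_line" for x
        unfolding rw using that by (auto simp: norm_mult space_restrict_space intro!: mult_left_le_one_le)
      have r: "r \<in> square_integrable half_line"
        by (rule square_integrable_mono[OF w _ rle]) (unfold r_def, measurable)
      have lr: "l2norm half_line r \<le> \<eta>"
      proof -
        have "l2norm half_line r \<le> l2norm half_line w"
          unfolding l2norm_def
          by (intro real_sqrt_le_mono integral_mono square_integrableD(2)[OF r] square_integrableD(2)[OF w] power_mono rle norm_ge_zero)
        with lw show ?thesis by simp
      qed
      have p: "p \<in> square_integrable half_line"
        using square_integrable_add[OF r \<phi>] by (simp add: r_def)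
      have lp: "l2norm half_line p \<le> a + \<eta>"
        using l2norm_triangle[OF r \<phi>] lr by (simp add: r_def a_def)
      have ddr: "d x * r x = D x * w x" for x by (simp add: rw D_def)
      have i1: "integrable half_line (\<lambda>x. d x * \<phi> x)"
      proof -
        have "d x * \<phi> x = of_real ((cmod (d x))\<^sup>2 * indicator {0<..<R} x)" for x
          using complex_norm_square[of "d x"] by (auto simp: \<phi>_def indicator_def)
        then show ?thesis using int by (simp only: integrable_of_real)
      qed
      have i2: "integrable half_line (\<lambda>x. d x * r x)"
        unfolding ddr by (rule integrable_mult_square_integrable_complex[OF D w])
      have "(\<integral>x. d x * p x \<partial>half_line) = (\<integral>x. d x * \<phi> x + d x * r x \<partial>half_line)"
        by (intro Bochner_Integration.integral_cong refl) (simp add: r_def algebra_simps)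
      also have "\<dots> = of_real (a\<^sup>2) + (\<integral>x. D x * w x \<partial>half_line)"
        using i1 i2 by (simp add: d\<phi> ddr)
      finally have "of_real (a\<^sup>2) = (\<integral>x. d x * p x \<partial>half_line) - (\<integral>x. D x * w x \<partial>half_line)" by simp
      then have "a\<^sup>2 = cmod ((\<integral>x. d x * p x \<partial>half_line) - (\<integral>x. D x * w x \<partial>half_line))"
        by (metis abs_power2 norm_of_real)
      also have "\<dots> \<le> cmod (\<integral>x. d x * p x \<partial>half_line) + cmod (\<integral>x. D x * w x \<partial>half_line)"
        by (rule norm_triangle_ineq4)
      also have "\<dots> \<le> \<epsilon> * l2norm half_line p + l2norm half_line D * l2norm half_line w"
        using le[of c N] Cauchy_Schwarz_integral[OF D w] by (intro add_mono) (auto simp: p_def [abs_def])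
      also have "\<dots> \<le> \<epsilon> * (a + \<eta>) + l2norm half_line D * \<eta>"
        using lp lw \<epsilon> by (intro add_mono mult_left_mono) auto
      finally show ?thesis by (simp add: algebra_simps)
    qed
    have "a\<^sup>2 \<le> \<epsilon> * a"
    proof (rule field_le_epsilon)
      fix t :: real assume t: "t > 0"
      define C where "C = \<epsilon> + l2norm half_line D + 1"
      have C: "C > 0" using \<epsilon> by (simp add: C_def add_nonneg_pos)
      have "a\<^sup>2 \<le> \<epsilon> * a + (\<epsilon> + l2norm half_line D) * (t / C)"
        using t C by (intro ineq) simp
      also have "(\<epsilon> + l2norm half_line D) * (t / C) \<le> C * (t / C)"
        using t C by (intro mult_right_mono) (auto simp: C_def)
      finally show "a\<^sup>2 \<le> \<epsilon> * a + t" using C by simp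
    qed
    then have "a \<le> \<epsilon>"
      using a0 \<epsilon> by (cases "a = 0") (auto simp: power2_eq_square)
    then show "(\<integral>x. (cmod (d x))\<^sup>2 * indicator {0<..<R} x \<partial>half_line) \<le> \<epsilon>\<^sup>2"
      unfolding a2[symmetric] using a0 by (rule power_mono)
  qed
  define f where "f n x = ennreal ((cmod (d x))\<^sup>2 * indicator {0<..<real n} x)" for n x
  have "(\<lambda>n. \<integral>\<^sup>+x. f n x \<partial>half_line) \<longlonglongrightarrow> (\<integral>\<^sup>+x. ennreal ((cmod (d x))\<^sup>2 * indicator {0<..} x) \<partial>half_line)"
  proof (rule nn_integral_LIMSEQ)
    show "incseq f" by (auto simp: incseq_def le_fun_def f_def indicator_def)
    show "f n \<in> borel_measurable half_line" for n
    proof -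
      have "f n \<in> borel_measurable borel" unfolding f_def by measurable
      then show ?thesis by (intro measurable_restrict_space1) simp
    qed
    show "(\<lambda>n. f n x) \<longlonglongrightarrow> ennreal ((cmod (d x))\<^sup>2 * indicator {0<..} x)" for x
    proof (rule tendsto_eventually)
      show "eventually (\<lambda>n. f n x = ennreal ((cmod (d x))\<^sup>2 * indicator {0<..} x)) sequentially"
        using eventually_gt_at_top[of "nat \<lceil>x\<rceil>"]
        by eventually_elim (auto simp: f_def indicator_def, linarith)
    qed
  qed
  moreover have "(\<integral>\<^sup>+x. f n x \<partial>half_line) \<le> ennreal (\<epsilon>\<^sup>2)" for n
  proof -
    have "(\<integral>\<^sup>+x. f n x \<partial>half_line) = ennreal (\<integral>x. (cmod (d x))\<^sup>2 * indicator {0<..<real n} x \<partial>half_line)"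
      unfolding f_def by (rule nn_integral_eq_integral[OF bound(2)]) auto
    then show ?thesis using bound(1)[of "real n"] by (simp add: ennreal_leI)
  qed
  ultimately have "(\<integral>\<^sup>+x. ennreal ((cmod (d x))\<^sup>2 * indicator {0<..} x) \<partial>half_line) \<le> ennreal (\<epsilon>\<^sup>2)"
    by (intro LIMSEQ_le_const2) auto
  also have "(\<integral>\<^sup>+x. ennreal ((cmod (d x))\<^sup>2 * indicator {0<..} x) \<partial>half_line) = (\<integral>\<^sup>+x. ennreal ((cmod (d x))\<^sup>2) \<partial>half_line)"
    by (intro nn_integral_cong) (simp add: space_restrict_space)
  finally show ?thesis .
qed

section \<open>The truncated operator\<close>

lemma laguerre_square_integrable: "laguerre_fun n \<in> square_integrable half_line"
proof (rule square_integrable_exp_bound)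
  show "laguerre_fun n \<in> borel_measurable half_line"
    by (rule measurable_restrict_space1) simp
  show "cmod (laguerre_fun n x) \<le> (2 * 2 ^ n) * exp (- (1/6) * x)" if "x > 0" for x
    using norm_laguerre_fun_le[of x n] that by (simp add: power_one_over mult_ac)
qed simp

definition V_trunc :: "(real \<Rightarrow> complex) \<Rightarrow> real \<Rightarrow> real \<Rightarrow> real \<Rightarrow> complex" where
  "V_trunc h a a' x = (LINT s:{a..1 - a'}|lborel. q_plus s x * h s)"

definition cut_to :: "(real \<Rightarrow> complex) \<Rightarrow> real \<Rightarrow> real \<Rightarrow> real \<Rightarrow> complex" where
  "cut_to h a a' s = (if a \<le> s \<and> s \<le> 1 - a' then h s else 0)"

lemma cut_measurable:
  assumes [measurable]: "h \<in> borel_measurable unit_interval"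
  shows "cut_to h a a' \<in> borel_measurable unit_interval"
proof -
  have "(\<lambda>s. indicat_real {a..1 - a'} s *\<^sub>R h s) \<in> borel_measurable unit_interval"
    by (rule borel_measurable_scaleR[OF _ assms], rule measurable_restrict_space1) simp
  moreover have "cut_to h a a' = (\<lambda>s. indicat_real {a..1 - a'} s *\<^sub>R h s)"
    by (auto simp: fun_eq_iff cut_to_def indicator_def)
  ultimately show ?thesis by simp
qed

lemma norm_cut_le: "cmod (cut_to h a a' s) \<le> cmod (h s)"
  by (simp add: cut_to_def)

lemma cut_square_integrable:
  assumes h: "h \<in> square_integrable unit_interval"
  shows "cut_to h a a' \<in> square_integrable unit_interval"
  by (rule square_integrable_mono[OF h cut_measurable[OF square_integrableD(1)[OF h]] norm_cut_le])

lemma cut_integrable: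
  assumes h: "h \<in> square_integrable unit_interval"
  shows "integrable unit_interval (\<lambda>s. cmod (cut_to h a a' s))"
proof -
  have "set_integrable lborel {0<..<1::real} (\<lambda>_. 1 :: real)"
    by (rule set_integrable_subset[OF borel_integrable_atLeastAtMost'[of 0 1]]) auto
  then have "integrable unit_interval (\<lambda>_. 1 :: real)" by (simp add: set_integrable_eq_restrict_space)
  then have "(\<lambda>_. 1 :: complex) \<in> square_integrable unit_interval"
    by (simp add: square_integrable_def)
  from integrable_cmod_mult[OF cut_square_integrable[OF h] this] show ?thesis by simp
qed

lemma V_trunc_eq:
  assumes "0 < a" "0 < a'"
  shows "V_trunc h a a' x = (\<integral>s. q_plus s x * cut_to h a a' s \<partial>unit_interval)"
proof -
  have "(\<integral>s. q_plus s x * cut_to h a a' s \<partial>unit_interval) = (LINT s:{0<..<1}|lborel. q_plus s x * cut_to h a a' s)"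
    by (simp add: set_lebesgue_integral_eq_restrict_space)
  also have "\<dots> = V_trunc h a a' x"
    unfolding V_trunc_def set_lebesgue_integral_def using assms
    by (intro Bochner_Integration.integral_cong refl) (auto simp: cut_to_def indicator_def)
  finally show ?thesis ..
qed

definition cut_bound :: "real \<Rightarrow> real \<Rightarrow> real" where
  "cut_bound a a' = 1/2 * pi powr (-3/2) * a powr (-1) * a' powr (-1/2) *
     (LINT u:{-1<..<1}|lborel. (1 - u\<^sup>2) powr (-1/2))"

lemma norm_q_plus_cut_le:
  assumes "0 < a" "0 < a'"
  shows "cmod (q_plus s x * cut_to h a a' s) \<le> cut_bound a a' * cmod (cut_to h a a' s)"
proof (cases "a \<le> s \<and> s \<le> 1 - a'")
  case True
  have "(LINT u:{-1<..<1}|lborel. (1 - u\<^sup>2) powr (-1/2)) \<ge> (0::real)"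
    unfolding set_lebesgue_integral_def by (intro Bochner_Integration.integral_nonneg) simp
  moreover have "q_factor s \<le> 1/2 * pi powr (-3/2) * a powr (-1) * a' powr (-1/2)"
    unfolding q_factor_def using True assms by (intro mult_mono powr_mono2') auto
  ultimately have "cmod (q_plus s x) \<le> cut_bound a a'"
    unfolding cut_bound_def by (intro order.trans[OF norm_q_plus_le] mult_right_mono)
  then show ?thesis by (simp add: norm_mult mult_right_mono)
qed (auto simp: cut_to_def)

lemma norm_V_trunc_le:
  assumes h: "h \<in> square_integrable unit_interval" and a: "0 < a" "0 < a'"
  shows "cmod (V_trunc h a a' x) \<le> cut_bound a a' * (\<integral>s. cmod (cut_to h a a' s) \<partial>unit_interval)"
proof -
  have "cmod (V_trunc h a a' x) \<le> (\<integral>s. cmod (q_plus s x * cut_to h a a' s) \<partial>unit_interval)"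
    unfolding V_trunc_eq[OF a] by (rule integral_norm_bound)
  also have "\<dots> \<le> (\<integral>s. cut_bound a a' * cmod (cut_to h a a' s) \<partial>unit_interval)"
    by (intro integral_mono' integrable_mult_right cut_integrable[OF h] norm_q_plus_cut_le[OF a]
        order.trans[OF norm_ge_zero norm_q_plus_cut_le[OF a]])
  finally have "cmod (V_trunc h a a' x) \<le> (\<integral>s. cut_bound a a' * cmod (cut_to h a a' s) \<partial>unit_interval)" .
  then show ?thesis by simp
qed

lemma q_plus_mult_measurable_pair:
  fixes M N :: "real measure"
  assumes "g \<in> borel_measurable M" "(\<lambda>s. s) \<in> borel_measurable M" "(\<lambda>x. x) \<in> borel_measurable N"
  shows "(\<lambda>(x, s). q_plus s x * g s) \<in> borel_measurable (N \<Otimes>\<^sub>M M)"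
proof -
  have "(\<lambda>p. q_plus (snd p) (fst p) * g (snd p)) \<in> borel_measurable (N \<Otimes>\<^sub>M M)"
    using assms
    by (intro borel_measurable_times q_plus_measurable measurable_compose[OF measurable_fst] measurable_compose[OF measurable_snd])
  then show ?thesis by (simp add: case_prod_beta)
qed

lemma V_trunc_measurable:
  assumes h: "h \<in> square_integrable unit_interval" and a: "0 < a" "0 < a'"
  shows "V_trunc h a a' \<in> borel_measurable borel"
proof -
  interpret sigma_finite_measure unit_interval by (rule sigma_finite_restrict_lborel) simp
  have "(\<lambda>x. \<integral>s. q_plus s x * cut_to h a a' s \<partial>unit_interval) \<in> borel_measurable borel"
    by (intro borel_measurable_lebesgue_integral q_plus_mult_measurable_pair
        cut_measurable square_integrableD(1)[OF h] ident_measurable_restrict_lborel) simp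
  then show ?thesis by (simp add: V_trunc_eq[OF a, abs_def])
qed

text \<open>After truncation the kernel is bounded in s as well as in x, so a constant times exp (-
  Re z x) |h s| serves as the Fubini majorant.\<close>

lemma V_trunc_laplace:
  assumes h: "h \<in> square_integrable unit_interval" and a: "0 < a" "0 < a'"
    and \<alpha>: "0 < Re \<alpha>" "Re \<alpha> < pi/2"
  shows "(\<integral>x. V_trunc h a a' x * exp (- (cos \<alpha> / sin \<alpha>) * of_real x) \<partial>half_line) =
    (\<integral>s. cut_to h a a' s * laplace_kernel \<alpha> s \<partial>unit_interval)"
proof -
  define z where "z = cos \<alpha> / sin \<alpha>"
  have z: "Re z > 0" using Re_cot_pos(1)[OF \<alpha>] by (simp add: z_def)
  define f where "f x s = q_plus s x * cut_to h a a' s * exp (- z * of_real x)" for x s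
  have "(\<integral>x. V_trunc h a a' x * exp (- z * of_real x) \<partial>half_line) = (\<integral>x. \<integral>s. f x s \<partial>unit_interval \<partial>half_line)"
    unfolding V_trunc_eq[OF a] f_def by simp
  also have "\<dots> = (\<integral>s. \<integral>x. f x s \<partial>half_line \<partial>unit_interval)"
  proof (rule Fubini_dominated)
    have "(\<lambda>p. (case p of (x, s) \<Rightarrow> q_plus s x * cut_to h a a' s) * exp (- z * of_real (fst p))) \<in> borel_measurable (half_line \<Otimes>\<^sub>M unit_interval)"
      by (intro borel_measurable_times q_plus_mult_measurable_pair measurable_compose[OF measurable_fst cexp_measurable_restrict_lborel]
          cut_measurable square_integrableD(1)[OF h] ident_measurable_restrict_lborel)
    then show "case_prod f \<in> borel_measurable (half_line \<Otimes>\<^sub>M unit_interval)"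
      by (simp add: f_def case_prod_beta')
    show "integrable half_line (\<lambda>x. exp (- Re z * x))"
      using exp_half_line_integrable[OF z] by (simp add: set_integrable_eq_restrict_space)
    show "integrable unit_interval (\<lambda>s. cut_bound a a' * cmod (cut_to h a a' s))"
      using cut_integrable[OF h] by simp
    show "cmod (f x s) \<le> exp (- Re z * x) * (cut_bound a a' * cmod (cut_to h a a' s))" for x s
      using mult_left_mono[OF norm_q_plus_cut_le[OF a, of s x h], of "exp (- Re z * x)"]
      by (simp add: f_def norm_mult mult_ac)
  qed (simp_all add: sigma_finite_restrict_lborel)
  also have "\<dots> = (\<integral>s. cut_to h a a' s * laplace_kernel \<alpha> s \<partial>unit_interval)"
  proof (rule Bochner_Integration.integral_cong [OF refl])
    fix s assume "s \<in> space unit_interval"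
    then have s: "0 < s" "s < 1" by (auto simp: space_restrict_space)
    have "(\<integral>x. f x s \<partial>half_line) = (\<integral>x. cut_to h a a' s * (q_plus s x * exp (- z * of_real x)) \<partial>half_line)"
      by (intro Bochner_Integration.integral_cong refl) (simp add: f_def)
    also have "\<dots> = cut_to h a a' s * (LINT x:{0<..}|lborel. q_plus s x * exp (- z * of_real x))"
      by (simp add: set_lebesgue_integral_eq_restrict_space)
    also have "\<dots> = cut_to h a a' s * laplace_kernel \<alpha> s"
      unfolding z_def q_plus_laplace[OF s \<alpha>] ..
    finally show "(\<integral>x. f x s \<partial>half_line) = cut_to h a a' s * laplace_kernel \<alpha> s" .
  qed
  finally show ?thesis unfolding z_def .
qed

lemma laplace_kernel_in_square_integrable:
  assumes "0 < Re \<alpha>" "Re \<alpha> < pi/2"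
  shows "laplace_kernel \<alpha> \<in> square_integrable unit_interval"
  using laplace_kernel_square_integrable[OF assms]
  by (auto simp: square_integrable_def intro!: laplace_kernel_measurable ident_measurable_restrict_lborel)

text \<open>The angle with cotangent i + 1, which corresponds to the test function exp (- (i + 1)
  x).\<close>

definition test_angle :: "nat \<Rightarrow> real" where
  "test_angle i = arctan (1 / (real i + 1))"

lemma test_angle: "0 < test_angle i" "test_angle i < pi/2"
  "cos (test_angle i) / sin (test_angle i) = real i + 1"
proof -
  have pos: "1 / (real i + 1) > 0" by (intro divide_pos_pos) auto
  show "0 < test_angle i" "test_angle i < pi/2"
    using pos arctan_ubound by (auto simp: test_angle_def)
  have "1 + (1 / (real i + 1))\<^sup>2 > 0" by (intro add_pos_nonneg) auto
  then show "cos (test_angle i) / sin (test_angle i) = real i + 1"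
    using pos by (simp add: test_angle_def cos_arctan sin_arctan field_simps)
qed

lemma exp_power_eq: "complex_of_real (exp (- x)) ^ Suc i = exp (- of_real (cos (test_angle i) / sin (test_angle i)) * of_real x)"
proof -
  have "complex_of_real (exp (- x)) ^ Suc i = exp (of_nat (Suc i) * of_real (- x))"
    by (simp only: exp_of_nat_mult exp_of_real)
  then show ?thesis unfolding test_angle(3) by (simp add: algebra_simps)
qed

text \<open>Both systems have the Gram matrix 1 / (i + j + 2), a Hilbert matrix.\<close>

lemma l2norm_test_functions:
  "l2norm unit_interval (\<lambda>s. \<Sum>i\<le>N. c i * laplace_kernel (of_real (test_angle i)) s) =
   l2norm half_line (\<lambda>x. \<Sum>i\<le>N. c i * of_real (exp (- x)) ^ Suc i)"
proof -
  define g where "g i j = complex_of_real (1 / ((real i + 1) + (real j + 1)))" for i j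
  let ?L = "\<lambda>i. laplace_kernel (of_real (test_angle i))"
  let ?e = "\<lambda>i x. complex_of_real (exp (- x)) ^ Suc i"
  have cL: "cnj (?L i s) = ?L i s" for i s
    unfolding laplace_kernel_real by simp
  have 1: "of_real (\<integral>s. (cmod (\<Sum>i\<le>N. c i * ?L i s))\<^sup>2 \<partial>unit_interval) = (\<Sum>i\<le>N. \<Sum>j\<le>N. c i * cnj (c j) * g i j)"
  proof (rule integral_norm_square_sum)
    fix i j
    show "integrable unit_interval (\<lambda>s. ?L i s * cnj (?L j s))"
      unfolding cL by (intro laplace_kernel_gram(1) test_angle)
    show "(\<integral>s. ?L i s * cnj (?L j s) \<partial>unit_interval) = g i j"
      unfolding cL g_def laplace_kernel_gram(2)[OF test_angle(1,2) test_angle(1,2)] test_angle(3) ..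
  qed
  have ee: "?e i x * cnj (?e j x) = exp (- of_real ((real i + 1) + (real j + 1)) * of_real x)" for i j x
  proof -
    have c: "cnj (?e j x) = ?e j x" by simp
    show ?thesis
      unfolding c unfolding exp_power_eq test_angle(3) exp_add[symmetric]
      by (rule arg_cong[of _ _ exp]) (simp add: algebra_simps)
  qed
  have 2: "of_real (\<integral>x. (cmod (\<Sum>i\<le>N. c i * ?e i x))\<^sup>2 \<partial>half_line) = (\<Sum>i\<le>N. \<Sum>j\<le>N. c i * cnj (c j) * g i j)"
  proof (rule integral_norm_square_sum)
    fix i j :: nat
    have pos: "Re (of_real ((real i + 1) + (real j + 1))) > 0" by simp
    show "integrable half_line (\<lambda>x. ?e i x * cnj (?e j x))"
      unfolding ee using cexp_half_line_integrable[OF pos] by (simp add: set_integrable_eq_restrict_space)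
    show "(\<integral>x. ?e i x * cnj (?e j x) \<partial>half_line) = g i j"
      unfolding ee g_def using cexp_half_line_integral[OF pos]
      by (simp add: set_lebesgue_integral_eq_restrict_space)
  qed
  have "complex_of_real (\<integral>s. (cmod (\<Sum>i\<le>N. c i * ?L i s))\<^sup>2 \<partial>unit_interval) =
      of_real (\<integral>x. (cmod (\<Sum>i\<le>N. c i * ?e i x))\<^sup>2 \<partial>half_line)"
    unfolding 1 2 ..
  then have "(\<integral>s. (cmod (\<Sum>i\<le>N. c i * ?L i s))\<^sup>2 \<partial>unit_interval) =
      (\<integral>x. (cmod (\<Sum>i\<le>N. c i * ?e i x))\<^sup>2 \<partial>half_line)"
    by (simp only: of_real_eq_iff)
  then show ?thesis by (simp only: l2norm_def)
qed

section \<open>The limit of vanishing cut-offs\<close>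

abbreviation cutoff :: "(real \<times> real) filter" where
  "cutoff \<equiv> at_right 0 \<times>\<^sub>F at_right 0"

lemma eventually_cutoff:
  assumes "t > 0"
  shows "eventually (\<lambda>(a, a'). 0 < a \<and> 0 < a' \<and> a < t \<and> a' < t) cutoff"
proof -
  have "eventually (\<lambda>a. 0 < a \<and> a < t) (at_right 0)"
    using eventually_at_right_real[OF assms] by (rule eventually_mono) auto
  from eventually_prodI[OF this this]
  have "eventually (\<lambda>p. (0 < fst p \<and> fst p < t) \<and> (0 < snd p \<and> snd p < t)) cutoff" .
  then show ?thesis by eventually_elim auto
qed

text \<open>Dominated convergence is a statement on sequences, so limits along the product filter
  are tested on a diagonal sequence.\<close>

lemma cutoff_sequence: "filterlim (\<lambda>k. (1 / (real k + 2), 1 / (real k + 2))) cutoff sequentially"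
proof -
  have "(\<lambda>k. 1 / (real k + 2)) \<longlonglongrightarrow> 0" by real_asymp
  then have "filterlim (\<lambda>k. 1 / (real k + 2)) (at_right 0) sequentially"
    unfolding filterlim_at by (auto intro!: always_eventually divide_pos_pos)
  then show ?thesis by (intro filterlim_Pair)
qed

lemma cut_sequence_tendsto:
  assumes "0 < s" "s < 1"
  shows "(\<lambda>k. cut_to h (1 / (real k + 2)) (1 / (real k + 2)) s) \<longlonglongrightarrow> h s"
proof (rule tendsto_eventually)
  have "(\<lambda>k. 1 / (real k + 2)) \<longlonglongrightarrow> 0" by real_asymp
  then have "eventually (\<lambda>k. 1 / (real k + 2) < min s (1 - s)) sequentially"
    using assms by (intro order_tendstoD(2)) auto
  then show "eventually (\<lambda>k. cut_to h (1 / (real k + 2)) (1 / (real k + 2)) s = h s) sequentially"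
    by eventually_elim (auto simp: cut_to_def)
qed

text \<open>The tail shrinks as either parameter does. Hence one diagonal cut-off with error below
  e, found by dominated convergence, controls a whole neighbourhood in the product filter.\<close>

lemma cut_l2_tendsto:
  assumes h: "h \<in> square_integrable unit_interval"
  shows "((\<lambda>(a, a'). (l2norm unit_interval (\<lambda>s. h s - cut_to h a a' s))\<^sup>2) \<longlongrightarrow> 0) cutoff"
proof (rule order_tendstoI)
  let ?c = "\<lambda>t. cut_to h t t"
  let ?r = "\<lambda>a a'. (l2norm unit_interval (\<lambda>s. h s - cut_to h a a' s))\<^sup>2"
  have sq: "(\<lambda>s. h s - cut_to h a a' s) \<in> square_integrable unit_interval" for a a'
    by (intro square_integrable_diff h cut_square_integrable)
  show "eventually (\<lambda>p. e < (case p of (a, a') \<Rightarrow> ?r a a')) cutoff" if "e < 0" for e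
    using that by (intro always_eventually) (auto intro: less_le_trans)
  fix e :: real assume e: "0 < e"
  define t where "t k = 1 / (real k + 2)" for k
  have "(\<lambda>k. ?r (t k) (t k)) \<longlonglongrightarrow> (\<integral>s. 0 \<partial>unit_interval)"
    unfolding l2norm_square
  proof (rule integral_dominated_convergence[OF _ _ square_integrableD(2)[OF h]])
    show "(\<lambda>s. (cmod (h s - ?c (t k) s))\<^sup>2) \<in> borel_measurable unit_interval" for k
      using square_integrableD(2)[OF sq] by (rule borel_measurable_integrable)
    show "AE s in unit_interval. norm ((cmod (h s - ?c (t k) s))\<^sup>2) \<le> (cmod (h s))\<^sup>2" for k
      by (intro AE_I2) (auto simp: cut_to_def)
    show "AE s in unit_interval. (\<lambda>k. (cmod (h s - ?c (t k) s))\<^sup>2) \<longlonglongrightarrow> 0"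
    proof (intro AE_I2)
      fix s assume "s \<in> space unit_interval"
      then have "(\<lambda>k. ?c (t k) s) \<longlonglongrightarrow> h s"
        unfolding t_def by (intro cut_sequence_tendsto) (auto simp: space_restrict_space)
      then have "(\<lambda>k. (cmod (h s - ?c (t k) s))\<^sup>2) \<longlonglongrightarrow> (cmod (h s - h s))\<^sup>2"
        by (intro tendsto_intros)
      then show "(\<lambda>k. (cmod (h s - ?c (t k) s))\<^sup>2) \<longlonglongrightarrow> 0" by simp
    qed
  qed simp
  then have "eventually (\<lambda>k. ?r (t k) (t k) < e) sequentially"
    using e by (intro order_tendstoD(2)) auto
  then obtain k where k: "?r (t k) (t k) < e" by (auto simp: eventually_sequentially)
  have "t k > 0" by (simp add: t_def add_pos_pos)
  from eventually_cutoff[OF this]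
  show "eventually (\<lambda>p. (case p of (a, a') \<Rightarrow> ?r a a') < e) cutoff"
  proof eventually_elim
    case (elim p)
    obtain a a' where p: "p = (a, a')" by (cases p)
    have le: "?r a a' \<le> ?r (t k) (t k)"
      unfolding l2norm_square
    proof (rule integral_mono[OF square_integrableD(2)[OF sq] square_integrableD(2)[OF sq]])
      show "(cmod (h s - cut_to h a a' s))\<^sup>2 \<le> (cmod (h s - ?c (t k) s))\<^sup>2" for s
        using elim by (auto simp: p cut_to_def)
    qed
    have "?r a a' < e" using le k by (rule order.strict_trans1)
    then show ?case by (simp only: p case_prod_conv)
  qed
qed

text \<open>The identity for truncations survives in the limit: the side on the half line converges
  by Cauchy-Schwarz, the side on the unit interval by dominated convergence. It expresses all
  pairings of h through its image and so prepares injectivity.\<close>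

lemma L2_lim_V_trunc_laplace:
  assumes h: "h \<in> square_integrable unit_interval"
    and f: "f \<in> L2_lim half_line cutoff (\<lambda>(a, a'). V_trunc h a a')"
    and \<alpha>: "0 < Re \<alpha>" "Re \<alpha> < pi/2"
  shows "(\<integral>s. h s * laplace_kernel \<alpha> s \<partial>unit_interval) =
    (\<integral>x. f x * exp (- (cos \<alpha> / sin \<alpha>) * of_real x) \<partial>half_line)"
proof -
  let ?L = "laplace_kernel \<alpha>"
  define e where "e x = exp (- (cos \<alpha> / sin \<alpha>) * of_real x)" for x :: real
  have e: "e \<in> square_integrable half_line"
    unfolding e_def by (intro cexp_square_integrable Re_cot_pos \<alpha>)
  have L: "?L \<in> square_integrable unit_interval"
    by (rule laplace_kernel_in_square_integrable[OF \<alpha>])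
  define t where "t k = 1 / (real k + 2)" for k
  have t: "t k > 0" for k by (simp add: t_def add_pos_pos)
  define V where "V k = V_trunc h (t k) (t k)" for k
  have f2: "f \<in> square_integrable half_line" using f by (simp add: L2_lim_def)
  define n where "n k = (\<integral>\<^sup>+x. ennreal ((cmod (V k x - f x))\<^sup>2) \<partial>half_line)" for k
  have "n \<longlonglongrightarrow> 0"
  proof -
    have "((\<lambda>p. \<integral>\<^sup>+x. ennreal ((cmod ((case p of (a, a') \<Rightarrow> V_trunc h a a') x - f x))\<^sup>2) \<partial>half_line) \<longlongrightarrow> 0) cutoff"
      using f by (simp add: L2_lim_def)
    from filterlim_compose[OF this cutoff_sequence] show ?thesis
      by (simp add: n_def [abs_def] V_def t_def)
  qed
  then have en: "(\<lambda>k. enn2real (n k)) \<longlonglongrightarrow> 0" and fin: "eventually (\<lambda>k. n k < top) sequentially"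
    using tendsto_enn2real[of n 0 sequentially] order_tendstoD(2)[of n 0 sequentially top] by auto
  have Vm: "V k \<in> borel_measurable half_line" for k
    unfolding V_def by (intro measurable_restrict_space1) (use V_trunc_measurable[OF h t t] in simp)
  have "eventually (\<lambda>k. cmod ((\<integral>x. V k x * e x \<partial>half_line) - (\<integral>x. f x * e x \<partial>half_line)) \<le>
     sqrt (enn2real (n k)) * l2norm half_line e) sequentially"
    using fin
  proof eventually_elim
    case (elim k)
    note [measurable] = Vm[of k] square_integrableD(1)[OF f2]
    \<comment> \<open>For general h the truncated integral has not been shown to be square
      integrable. It becomes so here, from its finite distance to f.\<close>
    have "integrable half_line (\<lambda>x. (cmod (V k x - f x))\<^sup>2)"
    proof (rule integrableI_bounded)
      show "(\<integral>\<^sup>+x. ennreal (norm ((cmod (V k x - f x))\<^sup>2)) \<partial>half_line) < \<infinity>"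
        using elim by (simp add: n_def)
    qed measurable
    then have d: "(\<lambda>x. V k x - f x) \<in> square_integrable half_line" by (simp add: square_integrable_def)
    have ln: "l2norm half_line (\<lambda>x. V k x - f x) = sqrt (enn2real (n k))"
      unfolding l2norm_def n_def using square_integrableD[OF d] by (subst integral_eq_nn_integral) auto
    have v: "V k \<in> square_integrable half_line" using square_integrable_add[OF d f2] by simp
    have "(\<integral>x. V k x * e x \<partial>half_line) - (\<integral>x. f x * e x \<partial>half_line) = (\<integral>x. (V k x - f x) * e x \<partial>half_line)"
      using integrable_mult_square_integrable_complex[OF v e] integrable_mult_square_integrable_complex[OF f2 e]
      by (simp add: left_diff_distrib)
    then show ?case using Cauchy_Schwarz_integral[OF d e] by (simp add: ln)
  qed
  moreover have "(\<lambda>k. sqrt (enn2real (n k)) * l2norm half_line e) \<longlonglongrightarrow> 0"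
  proof -
    have "(\<lambda>k. sqrt (enn2real (n k)) * l2norm half_line e) \<longlonglongrightarrow> sqrt 0 * l2norm half_line e"
      by (intro tendsto_intros en)
    then show ?thesis by simp
  qed
  ultimately have "(\<lambda>k. (\<integral>x. V k x * e x \<partial>half_line) - (\<integral>x. f x * e x \<partial>half_line)) \<longlonglongrightarrow> 0"
    by (rule Lim_null_comparison)
  then have "(\<lambda>k. \<integral>x. V k x * e x \<partial>half_line) \<longlonglongrightarrow> (\<integral>x. f x * e x \<partial>half_line)"
    by (simp add: LIM_zero_iff)
  then have 1: "(\<lambda>k. \<integral>s. cut_to h (t k) (t k) s * ?L s \<partial>unit_interval) \<longlonglongrightarrow> (\<integral>x. f x * e x \<partial>half_line)"
    unfolding V_def e_def by (simp only: V_trunc_laplace[OF h t t \<alpha>])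
  have 2: "(\<lambda>k. \<integral>s. cut_to h (t k) (t k) s * ?L s \<partial>unit_interval) \<longlonglongrightarrow> (\<integral>s. h s * ?L s \<partial>unit_interval)"
  proof (rule integral_dominated_convergence[OF _ _ integrable_cmod_mult[OF h L]])
    show "(\<lambda>s. h s * ?L s) \<in> borel_measurable unit_interval"
      by (intro borel_measurable_times square_integrableD(1) h L)
    show "(\<lambda>s. cut_to h (t k) (t k) s * ?L s) \<in> borel_measurable unit_interval" for k
      by (intro borel_measurable_times square_integrableD(1) cut_square_integrable h L)
    show "AE s in unit_interval. norm (cut_to h (t k) (t k) s * ?L s) \<le> cmod (h s) * cmod (?L s)" for k
      by (intro AE_I2) (simp add: norm_mult mult_right_mono norm_cut_le)
    show "AE s in unit_interval. (\<lambda>k. cut_to h (t k) (t k) s * ?L s) \<longlonglongrightarrow> h s * ?L s"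
      unfolding t_def by (intro AE_I2 tendsto_intros cut_sequence_tendsto) (auto simp: space_restrict_space)
  qed
  show ?thesis using LIMSEQ_unique[OF 2 1] by (simp only: e_def)
qed

section \<open>Limits and representatives\<close>

text \<open>The inequality |f - g|^2 \<le> 2 |G - f|^2 + 2 |G - g|^2 is used under the extended
  integral, where the right side may be infinite for some i.\<close>

lemma L2_lim_unique:
  assumes F: "F \<noteq> bot" and G: "eventually (\<lambda>i. G i \<in> borel_measurable M) F"
    and f: "f \<in> L2_lim M F G" and g: "g \<in> L2_lim M F G"
  shows "AE x in M. f x = g x"
proof -
  let ?n = "\<lambda>f g. \<integral>\<^sup>+x. ennreal ((cmod (f x - g x))\<^sup>2) \<partial>M"
  have [measurable]: "f \<in> borel_measurable M" "g \<in> borel_measurable M"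
    using f g by (auto simp: L2_lim_def square_integrable_def)
  have lim: "((\<lambda>i. ?n (G i) f) \<longlongrightarrow> 0) F"
            "((\<lambda>i. ?n (G i) g) \<longlongrightarrow> 0) F"
    using f g by (auto simp: L2_lim_def)
  let ?b = "\<lambda>i. 2 * ?n (G i) f + 2 * ?n (G i) g"
  have "(?b \<longlongrightarrow> 2 * 0 + 2 * 0) F"
    by (intro tendsto_add ennreal_tendsto_cmult lim) auto
  moreover have "eventually (\<lambda>i. ?n f g \<le> ?b i) F"
    using G
  proof eventually_elim
    case (elim i)
    note [measurable] = elim
    have "?n f g \<le>
       (\<integral>\<^sup>+x. 2 * ennreal ((cmod (G i x - f x))\<^sup>2) + 2 * ennreal ((cmod (G i x - g x))\<^sup>2) \<partial>M)"
    proof (rule nn_integral_mono)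
      fix x
      let ?p = "cmod (G i x - f x)" and ?q = "cmod (G i x - g x)"
      have "cmod (f x - g x) \<le> ?p + ?q"
        using norm_triangle_ineq4[of "G i x - g x" "G i x - f x"] by (simp add: algebra_simps)
      then have "(cmod (f x - g x))\<^sup>2 \<le> (?p + ?q)\<^sup>2" by (intro power_mono) auto
      also have "\<dots> \<le> 2 * ?p\<^sup>2 + 2 * ?q\<^sup>2" using sum_squares_bound[of ?p ?q] by (simp add: power2_sum)
      finally have "ennreal ((cmod (f x - g x))\<^sup>2) \<le> ennreal (2 * ?p\<^sup>2 + 2 * ?q\<^sup>2)" by (rule ennreal_leI)
      then show "ennreal ((cmod (f x - g x))\<^sup>2) \<le> 2 * ennreal (?p\<^sup>2) + 2 * ennreal (?q\<^sup>2)"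
        by (simp add: ennreal_plus ennreal_mult)
    qed
    also have "\<dots> = ?b i"
      by (subst nn_integral_add) (auto simp: nn_integral_cmult)
    finally show ?case .
  qed
  ultimately have "?n f g \<le> 0"
    by (intro tendsto_lowerbound[OF _ _ F, of ?b]) auto
  then have "?n f g = 0" by simp
  then have "AE x in M. ennreal ((cmod (f x - g x))\<^sup>2) = 0"
    by (subst (asm) nn_integral_0_iff_AE) auto
  then show ?thesis by eventually_elim auto
qed

lemma L2_lim_cong_AE:
  assumes f: "f \<in> L2_lim M F G" and g: "g \<in> square_integrable M" "AE x in M. g x = f x"
    and GG: "eventually (\<lambda>i. AE x in M. G' i x = G i x) F"
  shows "g \<in> L2_lim M F G'"
proof -
  have "((\<lambda>i. \<integral>\<^sup>+x. ennreal ((cmod (G i x - f x))\<^sup>2) \<partial>M) \<longlongrightarrow> 0) F"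
    using f by (simp add: L2_lim_def)
  moreover have "eventually (\<lambda>i. (\<integral>\<^sup>+x. ennreal ((cmod (G i x - f x))\<^sup>2) \<partial>M) = (\<integral>\<^sup>+x. ennreal ((cmod (G' i x - g x))\<^sup>2) \<partial>M)) F"
    using GG
  proof eventually_elim
    case (elim i)
    show ?case
    proof (rule nn_integral_cong_AE)
      show "AE x in M. ennreal ((cmod (G i x - f x))\<^sup>2) = ennreal ((cmod (G' i x - g x))\<^sup>2)"
        using elim g(2) by eventually_elim simp
    qed
  qed
  ultimately have "((\<lambda>i. \<integral>\<^sup>+x. ennreal ((cmod (G' i x - g x))\<^sup>2) \<partial>M) \<longlongrightarrow> 0) F"
    by (rule Lim_transform_eventually)
  then show ?thesis using g(1) by (simp add: L2_lim_def)
qed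

lemma V_trunc_cong_AE:
  assumes h: "h \<in> square_integrable unit_interval" "g \<in> square_integrable unit_interval"
    and eq: "AE s in unit_interval. h s = g s" and a: "0 < a" "0 < a'"
  shows "V_trunc h a a' = V_trunc g a a'"
proof
  fix x
  show "V_trunc h a a' x = V_trunc g a a' x"
    unfolding V_trunc_eq[OF a]
  proof (rule integral_cong_AE)
    show "(\<lambda>s. q_plus s x * cut_to h a a' s) \<in> borel_measurable unit_interval"
         "(\<lambda>s. q_plus s x * cut_to g a a' s) \<in> borel_measurable unit_interval"
      by (intro borel_measurable_times q_plus_measurable ident_measurable_restrict_lborel borel_measurable_const
          cut_measurable square_integrableD(1) h)+
    show "AE s in unit_interval. q_plus s x * cut_to h a a' s = q_plus s x * cut_to g a a' s"
      using eq by eventually_elim (simp add: cut_to_def)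
  qed
qed

lemma V_op_eq: "V_op H = (\<Union>h\<in>H. L2_lim half_line cutoff (\<lambda>(a, a'). V_trunc h a a'))"
  unfolding V_op_def V_trunc_def [abs_def] by (simp add: case_prod_beta)

section \<open>The preimage of a Laguerre function under \<open>V\<close>\<close>

context
  fixes \<beta> :: real
  assumes \<beta>: "0 < \<beta>" "\<beta> < pi" "tan (\<beta> / 2) = 1 / 2"
begin

text \<open>Paired with a test exponential, the difference on the left gives minus the pairing of
  the cut-off remainder with the corresponding Laplace kernel. Cauchy-Schwarz on the unit interval
  and the equality of norms of the two test systems then meet the hypothesis of the duality lemma,
  with \<epsilon> the norm of the remainder.\<close>

lemma V_trunc_h_fun_bound:
  assumes a: "0 < a" "0 < a'"
  shows "(\<integral>\<^sup>+x. ennreal ((cmod (V_trunc (h_fun \<beta> n) a a' x - laguerre_fun n x))\<^sup>2) \<partial>half_line) \<le>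
     ennreal ((l2norm unit_interval (\<lambda>s. h_fun \<beta> n s - cut_to (h_fun \<beta> n) a a' s))\<^sup>2)"
proof (rule exp_test_functions_norm)
  let ?h = "h_fun \<beta> n"
  let ?d = "\<lambda>x. V_trunc ?h a a' x - laguerre_fun n x" and ?r = "\<lambda>s. ?h s - cut_to ?h a a' s"
    and ?K = "cut_bound a a' * (\<integral>s. cmod (cut_to ?h a a' s) \<partial>unit_interval)"
  have h: "?h \<in> square_integrable unit_interval" by (rule h_fun_square_integrable[OF \<beta>])
  have l: "laguerre_fun n \<in> square_integrable half_line" by (rule laguerre_square_integrable)
  have [measurable]: "V_trunc ?h a a' \<in> borel_measurable borel" by (rule V_trunc_measurable[OF h a])
  show "(\<lambda>x. ?d x) \<in> borel_measurable borel" by measurable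
  show "cmod (?d x) \<le>
      ?K + 2 * 2 ^ n" if "x > 0" for x
  proof -
    have "cmod (laguerre_fun n x) \<le> 2 * exp (- (x / 6)) * 2 ^ n"
      using norm_laguerre_fun_le[of x n] that by (simp add: power_one_over)
    also have "\<dots> \<le> 2 * 1 * 2 ^ n" using that by (intro mult_right_mono mult_left_mono) auto
    finally show ?thesis
      using norm_triangle_ineq4[of "V_trunc ?h a a' x" "laguerre_fun n x"] norm_V_trunc_le[OF h a, of x] by simp
  qed
  show "0 \<le> l2norm unit_interval ?r" by simp
  fix N and c :: "nat \<Rightarrow> complex"
  let ?e = "\<lambda>i x. complex_of_real (exp (- x)) ^ Suc i"
  let ?L = "\<lambda>i. laplace_kernel (of_real (test_angle i))"
  have re: "0 < Re (of_real (test_angle i))" "Re (of_real (test_angle i)) < pi/2" for i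
    using test_angle by auto
  have e_eq: "?e i x = exp (- (cos (of_real (test_angle i)) / sin (of_real (test_angle i))) * of_real x)" for i x
    unfolding exp_power_eq cos_of_real sin_of_real by simp
  have L: "?L i \<in> square_integrable unit_interval" for i
    by (rule laplace_kernel_in_square_integrable[OF re])
  have e2: "?e i \<in> square_integrable half_line" for i
    unfolding e_eq by (intro cexp_square_integrable Re_cot_pos re)
  have eint: "integrable half_line (?e i)" for i
    unfolding e_eq using cexp_half_line_integrable[OF Re_cot_pos(1)[OF re]]
    by (simp add: set_integrable_eq_restrict_space)
  have Vint: "integrable half_line (\<lambda>x. V_trunc ?h a a' x * ?e i x)" for i
  proof (rule Bochner_Integration.integrable_bound[OF integrable_mult_right[OF eint[of i], of "of_real (?K)"]])
    show "(\<lambda>x. V_trunc ?h a a' x * ?e i x) \<in> borel_measurable half_line"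
      by (intro borel_measurable_times measurable_restrict_space1 square_integrableD(1)[OF e2]) simp
    show "AE x in half_line. norm (V_trunc ?h a a' x * ?e i x) \<le>
       norm (of_real (?K) * ?e i x)"
      unfolding norm_mult[of _ "?e i _"] norm_of_real
      by (intro AE_I2 mult_right_mono order.trans[OF norm_V_trunc_le[OF h a] abs_ge_self]) simp
  qed
  have lint: "integrable half_line (\<lambda>x. laguerre_fun n x * ?e i x)" for i
    by (rule integrable_mult_square_integrable_complex[OF l e2])
  have sq: "?r \<in> square_integrable unit_interval"
    by (intro square_integrable_diff h cut_square_integrable)
  have pairing: "(\<integral>x. ?d x * ?e i x \<partial>half_line) =
     - (\<integral>s. ?r s * ?L i s \<partial>unit_interval)" for i
  proof -
    have "(\<integral>x. ?d x * ?e i x \<partial>half_line) =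
       (\<integral>x. V_trunc ?h a a' x * ?e i x \<partial>half_line) - (\<integral>x. laguerre_fun n x * ?e i x \<partial>half_line)"
      using Vint lint by (simp only: left_diff_distrib Bochner_Integration.integral_diff)
    also have "(\<integral>x. V_trunc ?h a a' x * ?e i x \<partial>half_line) = (\<integral>s. cut_to ?h a a' s * ?L i s \<partial>unit_interval)"
      unfolding e_eq by (rule V_trunc_laplace[OF h a re])
    also have "(\<integral>x. laguerre_fun n x * ?e i x \<partial>half_line) = (\<integral>s. ?h s * ?L i s \<partial>unit_interval)"
      unfolding exp_power_eq by (rule h_fun_pairing[OF \<beta> test_angle(1,2), symmetric])
    also have "(\<integral>s. cut_to ?h a a' s * ?L i s \<partial>unit_interval) - (\<integral>s. ?h s * ?L i s \<partial>unit_interval) =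
        - (\<integral>s. ?r s * ?L i s \<partial>unit_interval)"
      using integrable_mult_square_integrable_complex[OF h L] integrable_mult_square_integrable_complex[OF cut_square_integrable[OF h] L]
      by (simp only: left_diff_distrib Bochner_Integration.integral_diff minus_diff_eq)
    finally show ?thesis .
  qed
  have dint: "integrable half_line (\<lambda>x. ?d x * ?e i x)" for i
    unfolding left_diff_distrib by (intro Bochner_Integration.integrable_diff Vint lint)
  have hint: "integrable unit_interval (\<lambda>s. ?r s * ?L i s)" for i
    by (rule integrable_mult_square_integrable_complex[OF sq L])
  have "(\<integral>x. ?d x * (\<Sum>i\<le>N. c i * ?e i x) \<partial>half_line) = - (\<integral>s. ?r s * (\<Sum>i\<le>N. c i * ?L i s) \<partial>unit_interval)"
    unfolding integral_mult_sum[OF dint] integral_mult_sum[OF hint] pairing by (simp add: sum_negf)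
  then have "cmod (\<integral>x. ?d x * (\<Sum>i\<le>N. c i * ?e i x) \<partial>half_line) =
     cmod (\<integral>s. ?r s * (\<Sum>i\<le>N. c i * ?L i s) \<partial>unit_interval)"
    by simp
  also have "\<dots> \<le> l2norm unit_interval ?r * l2norm unit_interval (\<lambda>s. \<Sum>i\<le>N. c i * ?L i s)"
    by (intro Cauchy_Schwarz_integral sq square_integrable_sum square_integrable_cmult L) simp
  finally show "cmod (\<integral>x. ?d x * (\<Sum>i\<le>N. c i * ?e i x) \<partial>half_line) \<le>
     l2norm unit_interval ?r * l2norm half_line (\<lambda>x. \<Sum>i\<le>N. c i * ?e i x)"
    unfolding l2norm_test_functions .
qed

lemma laguerre_in_L2_lim:
  "laguerre_fun n \<in> L2_lim half_line cutoff (\<lambda>(a, a'). V_trunc (h_fun \<beta> n) a a')"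
proof -
  let ?h = "h_fun \<beta> n"
  have h: "?h \<in> square_integrable unit_interval" by (rule h_fun_square_integrable[OF \<beta>])
  have up: "((\<lambda>p. ennreal (case p of (a, a') \<Rightarrow> (l2norm unit_interval (\<lambda>s. ?h s - cut_to ?h a a' s))\<^sup>2)) \<longlongrightarrow> ennreal 0) cutoff"
    by (intro tendsto_ennrealI cut_l2_tendsto h)
  have "((\<lambda>p. \<integral>\<^sup>+x. ennreal ((cmod ((case p of (a, a') \<Rightarrow> V_trunc ?h a a') x - laguerre_fun n x))\<^sup>2) \<partial>half_line) \<longlongrightarrow> 0) cutoff"
  proof (rule tendsto_sandwich[OF _ _ tendsto_const])
    show "((\<lambda>p. ennreal (case p of (a, a') \<Rightarrow> (l2norm unit_interval (\<lambda>s. ?h s - cut_to ?h a a' s))\<^sup>2)) \<longlongrightarrow> 0) cutoff"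
      using up by simp
    show "eventually (\<lambda>p. (\<integral>\<^sup>+x. ennreal ((cmod ((case p of (a, a') \<Rightarrow> V_trunc ?h a a') x - laguerre_fun n x))\<^sup>2) \<partial>half_line) \<le>
       ennreal (case p of (a, a') \<Rightarrow> (l2norm unit_interval (\<lambda>s. ?h s - cut_to ?h a a' s))\<^sup>2)) cutoff"
      using eventually_cutoff[OF zero_less_one]
      by eventually_elim (use V_trunc_h_fun_bound in auto)
  qed simp
  then show ?thesis using laguerre_square_integrable by (simp add: L2_lim_def)
qed

text \<open>\<open>V_op\<close> takes a union over representatives, so a limit obtained from another
  representative is first carried over to \<open>h_fun \<beta> n\<close> itself; uniqueness of
  limits then identifies it with the Laguerre function.\<close>

lemma V_op_h_fun: "V_op (L2_class unit_interval (h_fun \<beta> n)) = L2_class half_line (laguerre_fun n)"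
proof -
  let ?h = "h_fun \<beta> n"
  have h: "?h \<in> square_integrable unit_interval" by (rule h_fun_square_integrable[OF \<beta>])
  have nb: "cutoff \<noteq> bot" by (simp add: prod_filter_eq_bot trivial_limit_at_right_real)
  have m: "eventually (\<lambda>p. (case p of (a, a') \<Rightarrow> V_trunc ?h a a') \<in> borel_measurable half_line) cutoff"
    using eventually_cutoff[OF zero_less_one]
    by eventually_elim (use V_trunc_measurable[OF h] in \<open>auto intro!: measurable_restrict_space1\<close>)
  show ?thesis
  proof (intro equalityI subsetI)
    fix f assume "f \<in> V_op (L2_class unit_interval ?h)"
    then obtain g where g: "g \<in> square_integrable unit_interval" "AE s in unit_interval. g s = ?h s"
      and f: "f \<in> L2_lim half_line cutoff (\<lambda>(a, a'). V_trunc g a a')"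
      by (auto simp: V_op_eq L2_class_def)
    have f2: "f \<in> square_integrable half_line" using f by (simp add: L2_lim_def)
    have "eventually (\<lambda>p. AE x in half_line. (case p of (a, a') \<Rightarrow> V_trunc ?h a a') x = (case p of (a, a') \<Rightarrow> V_trunc g a a') x) cutoff"
      using eventually_cutoff[OF zero_less_one]
      by eventually_elim (use V_trunc_cong_AE[OF g(1) h g(2)] in auto)
    then have "f \<in> L2_lim half_line cutoff (\<lambda>(a, a'). V_trunc ?h a a')"
      by (intro L2_lim_cong_AE[OF f f2]) auto
    from L2_lim_unique[OF nb m this laguerre_in_L2_lim]
    show "f \<in> L2_class half_line (laguerre_fun n)" using f2 by (simp add: L2_class_def)
  next
    fix f assume "f \<in> L2_class half_line (laguerre_fun n)"
    then have "f \<in> L2_lim half_line cutoff (\<lambda>(a, a'). V_trunc ?h a a')"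
      by (intro L2_lim_cong_AE[OF laguerre_in_L2_lim]) (auto simp: L2_class_def)
    then show "f \<in> V_op (L2_class unit_interval ?h)"
      using h by (auto simp: V_op_eq L2_class_def)
  qed
qed

text \<open>A representative g of a preimage and \<open>h_fun \<beta> n\<close> have the same
  pairings with all Laplace kernels, both being the Laplace transform of the same Laguerre function.
  Totality of the kernels makes them equal almost everywhere.\<close>

lemma V_op_h_fun_unique:
  assumes H: "H \<in> L2 unit_interval" and V: "V_op H = L2_class half_line (laguerre_fun n)"
  shows "H = L2_class unit_interval (h_fun \<beta> n)"
proof -
  let ?h = "h_fun \<beta> n"
  have h: "?h \<in> square_integrable unit_interval" by (rule h_fun_square_integrable[OF \<beta>])
  obtain h0 where h0: "H = L2_class unit_interval h0" using H by (auto simp: L2_def)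
  \<comment> \<open>The class on the right is not empty, so the limit really exists for some
    representative of H.\<close>
  have "laguerre_fun n \<in> V_op H"
    unfolding V using laguerre_square_integrable by (simp add: L2_class_def)
  then obtain g where g: "g \<in> square_integrable unit_interval" "AE s in unit_interval. g s = h0 s"
    and l: "laguerre_fun n \<in> L2_lim half_line cutoff (\<lambda>(a, a'). V_trunc g a a')"
    by (auto simp: V_op_eq h0 L2_class_def)
  have "AE s in unit_interval. g s - ?h s = 0"
  proof (rule laplace_kernel_total)
    show "(\<lambda>s. g s - ?h s) \<in> square_integrable unit_interval" by (rule square_integrable_diff[OF g(1) h])
    fix \<alpha> assume \<alpha>: "0 < Re \<alpha>" "Re \<alpha> < pi/2"
    have L: "laplace_kernel \<alpha> \<in> square_integrable unit_interval"
      by (rule laplace_kernel_in_square_integrable[OF \<alpha>])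
    have "(\<integral>s. g s * laplace_kernel \<alpha> s \<partial>unit_interval) = (\<integral>s. ?h s * laplace_kernel \<alpha> s \<partial>unit_interval)"
      unfolding L2_lim_V_trunc_laplace[OF g(1) l \<alpha>] L2_lim_V_trunc_laplace[OF h laguerre_in_L2_lim \<alpha>] ..
    then show "(\<integral>s. (g s - ?h s) * laplace_kernel \<alpha> s \<partial>unit_interval) = 0"
      using integrable_mult_square_integrable_complex[OF g(1) L] integrable_mult_square_integrable_complex[OF h L]
      by (simp add: left_diff_distrib)
  qed
  with g(2) have eq: "AE s in unit_interval. h0 s = ?h s" by eventually_elim simp
  have "(AE s in unit_interval. f s = h0 s) \<longleftrightarrow> (AE s in unit_interval. f s = ?h s)" for f
    by (rule iffI; use eq in \<open>elim AE_mp\<close>) auto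
  then show ?thesis unfolding h0 by (simp add: L2_class_def)
qed

end

theorem mainTheorem7:
  fixes \<beta> :: real
  assumes "0 < \<beta>" and "\<beta> < pi" and "tan (\<beta> / 2) = 1 / 2"
  shows "(\<forall>n. laguerre_fun n \<in> square_integrable half_line \<and>
              h_fun \<beta> n \<in> square_integrable unit_interval \<and>
              {H \<in> L2 unit_interval. V_op H = L2_class half_line (laguerre_fun n)} =
                {L2_class unit_interval (h_fun \<beta> n)}) \<and>
         (\<forall>n. \<forall>s\<in>{0<..<1}.
              set_integrable lborel {0<..} (\<lambda>x. q_plus s x * laguerre_fun n x) \<and>
              (LINT x:{0<..}|lborel. q_plus s x * laguerre_fun n x) = h_fun \<beta> n s)"
proof (intro conjI allI ballI)
  fix n
  show "laguerre_fun n \<in> square_integrable half_line" by (rule laguerre_square_integrable)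
  show h: "h_fun \<beta> n \<in> square_integrable unit_interval" by (rule h_fun_square_integrable[OF assms])
  then have "L2_class unit_interval (h_fun \<beta> n) \<in> L2 unit_interval" by (simp add: L2_def)
  then show "{H \<in> L2 unit_interval. V_op H = L2_class half_line (laguerre_fun n)} =
                {L2_class unit_interval (h_fun \<beta> n)}"
    using V_op_h_fun[OF assms, of n] V_op_h_fun_unique[OF assms, of _ n] by blast
next
  fix n and s :: real assume "s \<in> {0<..<1}"
  then have s: "0 < s" "s < 1" by auto
  show "set_integrable lborel {0<..} (\<lambda>x. q_plus s x * laguerre_fun n x)"
    by (rule q_plus_laguerre(1)[OF assms s])
  show "(LINT x:{0<..}|lborel. q_plus s x * laguerre_fun n x) = h_fun \<beta> n s"
    by (rule q_plus_laguerre(2)[OF assms s])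
qed

end
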